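(* Let $M$ and $N$ be connected smooth manifolds. Two vector bundles $\pi:E_\pi\to M$ and $\eta:E_\eta\to N$ are isomorphic if and only if their algebras of fiberwise polynomial functions $\mathrm{Pol}(\pi)$ and $\mathrm{Pol}(\eta)$ are isomorphic as $\mathbb{R}$-algebras.
   Context: Vector bundles are smooth, real, of finite rank (rank $1$ is allowed). For a vector bundle $\pi:E_\pi\to M$, $\mathrm{Pol}^k(\pi)\subset C^\infty(E_\pi)$ ($k\in\mathbb{N}$) denotes the space of smooth functions on $E_\pi$ whose restriction to each fiber is a homogeneous polynomial of degree $k$, and $\mathrm{Pol}(\pi)=\bigoplus_{k\ge 0}\mathrm{Pol}^k(\pi)$ is the $\mathbb{R}$-algebra of fiberwise polynomial functions (pointwise product). Vector bundles $\pi:E_\pi\to M$ and $\eta:E_\eta\to N$ are isomorphic if there is a diffeomorphism $E_\pi\to E_\eta$ covering a diffeomorphism $M\to N$ and restricting to a linear isomorphism from each fiber of $\pi$ onto the corresponding fiber of $\eta$. *)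

theory Defs
  imports "HOL-Analysis.Analysis" "HOL-Algebra.Module" "HOL-Algebra.QuotRing"
begin

section \<open>Model spaces\<close>

text \<open>
  Finite-dimensional real inner product spaces. The class \<^class>\<open>euclidean_space\<close> only contains
  spaces of positive dimension; the class below also contains the zero-dimensional ones, so that
  zero-dimensional manifolds and bundles of rank zero are covered.
\<close>

class fin_dim_inner = real_inner +
  assumes finite_spanning_set: "\<exists>B. finite B \<and> (\<forall>x. \<exists>c. x = (\<Sum>b\<in>B. c b *\<^sub>R b))"

instance prod :: (fin_dim_inner, fin_dim_inner) fin_dim_inner
proof
  obtain A :: "'a set" where A: "finite A" "\<And>x. \<exists>c. x = (\<Sum>b\<in>A. c b *\<^sub>R b)"
    using finite_spanning_set by blast
  obtain B :: "'b set" where B: "finite B" "\<And>x. \<exists>c. x = (\<Sum>b\<in>B. c b *\<^sub>R b)"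
    using finite_spanning_set by blast
  let ?C = "(\<lambda>a. (a, 0)) ` A \<union> (\<lambda>b. (0, b)) ` B"
  have "x \<in> span ?C" for x :: "'a \<times> 'b"
  proof -
    obtain c d where c: "fst x = (\<Sum>a\<in>A. c a *\<^sub>R a)" and d: "snd x = (\<Sum>b\<in>B. d b *\<^sub>R b)"
      using A(2) B(2) by metis
    have "x = (\<Sum>a\<in>A. c a *\<^sub>R (a, 0)) + (\<Sum>b\<in>B. d b *\<^sub>R (0, b))"
      by (rule prod_eqI) (simp_all add: c d fst_sum snd_sum)
    also have "\<dots> \<in> span ?C"
      by (intro span_add span_sum span_scale span_base) auto
    finally show ?thesis .
  qed
  moreover have "finite ?C" using A(1) B(1) by simp
  ultimately show "\<exists>C. finite C \<and> (\<forall>x :: 'a \<times> 'b. \<exists>c. x = (\<Sum>b\<in>C. c b *\<^sub>R b))"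
    using span_finite[of ?C] by (intro exI[of _ ?C]) blast
qed

subclass (in euclidean_space) fin_dim_inner
proof
  show "\<exists>B. finite B \<and> (\<forall>x. \<exists>c. x = (\<Sum>b\<in>B. c b *\<^sub>R b))"
  proof (intro exI conjI allI)
    fix x :: 'a
    show "x = (\<Sum>b\<in>Basis. inner x b *\<^sub>R b)"
      by (rule euclidean_representation[symmetric])
  qed (rule finite_Basis)
qed

instantiation unit :: fin_dim_inner
begin

definition plus_unit :: "unit \<Rightarrow> unit \<Rightarrow> unit" where "plus_unit x y = ()"
definition minus_unit :: "unit \<Rightarrow> unit \<Rightarrow> unit" where "minus_unit x y = ()"
definition uminus_unit :: "unit \<Rightarrow> unit" where "uminus_unit x = ()"
definition zero_unit :: unit where "zero_unit = ()"
definition scaleR_unit :: "real \<Rightarrow> unit \<Rightarrow> unit" where "scaleR_unit c x = ()"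
definition inner_unit :: "unit \<Rightarrow> unit \<Rightarrow> real" where "inner_unit x y = 0"
definition norm_unit :: "unit \<Rightarrow> real" where "norm_unit x = 0"
definition dist_unit :: "unit \<Rightarrow> unit \<Rightarrow> real" where "dist_unit x y = 0"
definition sgn_unit :: "unit \<Rightarrow> unit" where "sgn_unit x = ()"
definition uniformity_unit :: "(unit \<times> unit) filter"
  where "uniformity_unit = (INF e\<in>{0 <..}. principal {(x, y). dist x y < e})"
definition open_unit :: "unit set \<Rightarrow> bool" where
  "open_unit U \<longleftrightarrow> (\<forall>x\<in>U. eventually (\<lambda>(x', y). x' = x \<longrightarrow> y \<in> U) uniformity)"

instance
  by standard (auto simp: uniformity_unit_def open_unit_def dist_unit_def inner_unit_def
      norm_unit_def intro!: exI[of _ "{}"])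

end

section \<open>Smooth manifolds\<close>

fun Ck_on :: "nat \<Rightarrow> 'a::real_normed_vector set \<Rightarrow> ('a \<Rightarrow> 'b::real_normed_vector) \<Rightarrow> bool" where
  "Ck_on 0 S f \<longleftrightarrow> continuous_on S f"
| "Ck_on (Suc k) S f \<longleftrightarrow>
     (\<forall>x\<in>S. f differentiable (at x)) \<and> (\<forall>v. Ck_on k S (\<lambda>x. frechet_derivative f (at x) v))"

text \<open>In finite dimensions this is the usual notion for open \<open>S\<close>, the only sets it is used for.\<close>

definition smooth_on :: "'a::real_normed_vector set \<Rightarrow> ('a \<Rightarrow> 'b::real_normed_vector) \<Rightarrow> bool" where
  "smooth_on S f \<longleftrightarrow> (\<forall>k. Ck_on k S f)"

text \<open>
  A chart is a pair \<open>(U, \<phi>)\<close> of its domain and its coordinate map, the latter being relevant only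
  on \<open>U\<close>. The atlas need not be maximal: it represents the smooth structure it generates.
\<close>

record ('a, 'm) manifold =
  top_of :: "'a topology"
  atlas :: "('a set \<times> ('a \<Rightarrow> 'm)) set"

abbreviation points :: "('a, 'm, 'z) manifold_scheme \<Rightarrow> 'a set" where
  "points M \<equiv> topspace (top_of M)"

definition smooth_manifold :: "('a, 'm::fin_dim_inner) manifold \<Rightarrow> bool" where
  "smooth_manifold M \<longleftrightarrow>
     Hausdorff_space (top_of M) \<and> second_countable (top_of M) \<and>
     points M = (\<Union>(U, \<phi>)\<in>atlas M. U) \<and>
     (\<forall>(U, \<phi>)\<in>atlas M. openin (top_of M) U \<and> open (\<phi> ` U) \<and>
        homeomorphic_map (subtopology (top_of M) U) (top_of_set (\<phi> ` U)) \<phi>) \<and>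
     (\<forall>(U, \<phi>)\<in>atlas M. \<forall>(V, \<psi>)\<in>atlas M. smooth_on (\<phi> ` (U \<inter> V)) (\<psi> \<circ> inv_into U \<phi>))"

definition smooth_map ::
    "('a, 'm::fin_dim_inner) manifold \<Rightarrow> ('b, 'n::fin_dim_inner) manifold \<Rightarrow> ('a \<Rightarrow> 'b) \<Rightarrow> bool" where
  "smooth_map M N f \<longleftrightarrow>
     continuous_map (top_of M) (top_of N) f \<and>
     (\<forall>(U, \<phi>)\<in>atlas M. \<forall>(V, \<psi>)\<in>atlas N.
        smooth_on (\<phi> ` (U \<inter> f -` V)) (\<psi> \<circ> f \<circ> inv_into U \<phi>))"

definition diffeomorphism ::
    "('a, 'm::fin_dim_inner) manifold \<Rightarrow> ('b, 'n::fin_dim_inner) manifold \<Rightarrow> ('a \<Rightarrow> 'b) \<Rightarrow> bool" where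
  "diffeomorphism M N f \<longleftrightarrow>
     bij_betw f (points M) (points N) \<and> smooth_map M N f \<and> smooth_map N M (inv_into (points M) f)"

definition model_manifold :: "('m::fin_dim_inner, 'm) manifold" where
  "model_manifold = \<lparr>top_of = euclidean, atlas = {(UNIV, id)}\<rparr>"

definition open_submanifold :: "('a, 'm::fin_dim_inner) manifold \<Rightarrow> 'a set \<Rightarrow> ('a, 'm) manifold" where
  "open_submanifold M W =
     \<lparr>top_of = subtopology (top_of M) W, atlas = (\<lambda>(U, \<phi>). (U \<inter> W, \<phi>)) ` atlas M\<rparr>"

definition prod_manifold ::
    "('a, 'm::fin_dim_inner) manifold \<Rightarrow> ('b, 'n::fin_dim_inner) manifold
      \<Rightarrow> ('a \<times> 'b, 'm \<times> 'n) manifold" where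
  "prod_manifold M N =
     \<lparr>top_of = prod_topology (top_of M) (top_of N),
      atlas = {(U \<times> V, map_prod \<phi> \<psi>) |U \<phi> V \<psi>. (U, \<phi>) \<in> atlas M \<and> (V, \<psi>) \<in> atlas N}\<rparr>"

section \<open>Vector bundles\<close>

definition real_ring :: "real ring" where
  "real_ring = \<lparr>carrier = UNIV, monoid.mult = (*), one = 1, zero = 0, add = (+)\<rparr>"

text \<open>
  A bundle over a base with model space \<open>'m\<close>, with typical fibre \<open>'f\<close>. The fibrewise operations are
  given by globally defined functions; only their values within fibres are relevant.
\<close>

record ('a, 'e, 'm, 'f) vbundle =
  total_space :: "('e, 'm \<times> 'f) manifold"
  proj :: "'e \<Rightarrow> 'a"
  vadd :: "'e \<Rightarrow> 'e \<Rightarrow> 'e"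
  vzero :: "'a \<Rightarrow> 'e"
  vscale :: "real \<Rightarrow> 'e \<Rightarrow> 'e"

text \<open>The ring multiplication and unit of a \<^typ>\<open>('r, 'v) module\<close> record play no role in modules.\<close>

definition fibre ::
    "('a, 'e, 'm::fin_dim_inner, 'f::fin_dim_inner) vbundle \<Rightarrow> 'a \<Rightarrow> (real, 'e) module" where
  "fibre P x =
     \<lparr>carrier = {e \<in> points (total_space P). proj P e = x}, monoid.mult = undefined, one = undefined,
      zero = vzero P x, add = vadd P, smult = vscale P\<rparr>"

definition local_trivialization ::
    "('a, 'm::fin_dim_inner) manifold \<Rightarrow> ('a, 'e, 'm, 'f::fin_dim_inner) vbundle
      \<Rightarrow> 'a set \<Rightarrow> ('e \<Rightarrow> 'a \<times> 'f) \<Rightarrow> bool" where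
  "local_trivialization M P U \<psi> \<longleftrightarrow>
     diffeomorphism (open_submanifold (total_space P) (proj P -` U))
       (prod_manifold (open_submanifold M U) model_manifold) \<psi> \<and>
     (\<forall>e \<in> points (total_space P). proj P e \<in> U \<longrightarrow> fst (\<psi> e) = proj P e) \<and>
     (\<forall>x\<in>U. \<forall>u \<in> carrier (fibre P x). \<forall>v \<in> carrier (fibre P x). \<forall>c.
        snd (\<psi> (u \<oplus>\<^bsub>fibre P x\<^esub> v)) = snd (\<psi> u) + snd (\<psi> v) \<and>
        snd (\<psi> (c \<odot>\<^bsub>fibre P x\<^esub> u)) = c *\<^sub>R snd (\<psi> u))"

definition vector_bundle ::
    "('a, 'm::fin_dim_inner) manifold \<Rightarrow> ('a, 'e, 'm, 'f::fin_dim_inner) vbundle \<Rightarrow> bool" where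
  "vector_bundle M P \<longleftrightarrow>
     smooth_manifold M \<and> smooth_manifold (total_space P) \<and> smooth_map (total_space P) M (proj P) \<and>
     (\<forall>x \<in> points M. Module.module real_ring (fibre P x)) \<and>
     (\<forall>x \<in> points M. \<exists>U \<psi>. openin (top_of M) U \<and> x \<in> U \<and> local_trivialization M P U \<psi>)"

definition linear_iso :: "(real, 'v) module \<Rightarrow> (real, 'w) module \<Rightarrow> ('v \<Rightarrow> 'w) \<Rightarrow> bool" where
  "linear_iso V W h \<longleftrightarrow>
     bij_betw h (carrier V) (carrier W) \<and>
     (\<forall>u \<in> carrier V. \<forall>v \<in> carrier V. h (u \<oplus>\<^bsub>V\<^esub> v) = h u \<oplus>\<^bsub>W\<^esub> h v) \<and>
     (\<forall>c. \<forall>u \<in> carrier V. h (c \<odot>\<^bsub>V\<^esub> u) = c \<odot>\<^bsub>W\<^esub> h u)"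

definition bundle_isomorphic ::
    "('a, 'm::fin_dim_inner) manifold \<Rightarrow> ('a, 'd, 'm, 'f::fin_dim_inner) vbundle
      \<Rightarrow> ('b, 'n::fin_dim_inner) manifold \<Rightarrow> ('b, 'e, 'n, 'g::fin_dim_inner) vbundle \<Rightarrow> bool" where
  "bundle_isomorphic M P N Q \<longleftrightarrow>
     (\<exists>F f. diffeomorphism (total_space P) (total_space Q) F \<and> diffeomorphism M N f \<and>
        (\<forall>e \<in> points (total_space P). proj Q (F e) = f (proj P e)) \<and>
        (\<forall>x \<in> points M. linear_iso (fibre P x) (fibre Q (f x)) F))"

section \<open>Fibrewise polynomial functions\<close>

definition linear_functional :: "(real, 'v) module \<Rightarrow> ('v \<Rightarrow> real) \<Rightarrow> bool" where
  "linear_functional V l \<longleftrightarrow>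
     (\<forall>u \<in> carrier V. \<forall>v \<in> carrier V. l (u \<oplus>\<^bsub>V\<^esub> v) = l u + l v) \<and>
     (\<forall>c. \<forall>u \<in> carrier V. l (c \<odot>\<^bsub>V\<^esub> u) = c * l u)"

text \<open>
  Coordinate-free form: a linear combination of products of \<open>k\<close> linear functionals.
\<close>

definition homogeneous_polynomial :: "(real, 'v) module \<Rightarrow> nat \<Rightarrow> ('v \<Rightarrow> real) \<Rightarrow> bool" where
  "homogeneous_polynomial V k p \<longleftrightarrow>
     (\<exists>(m::nat) c l. (\<forall>j<m. \<forall>i<k. linear_functional V (l j i)) \<and>
        (\<forall>v \<in> carrier V. p v = (\<Sum>j<m. c j * (\<Prod>i<k. l j i v))))"

text \<open>Functions on the total space are represented by functions that are \<^const>\<open>undefined\<close> outside.\<close>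

definition Pol_hom ::
    "('a, 'm::fin_dim_inner) manifold \<Rightarrow> ('a, 'e, 'm, 'f::fin_dim_inner) vbundle
      \<Rightarrow> nat \<Rightarrow> ('e \<Rightarrow> real) set" where
  "Pol_hom M P k =
     {p \<in> extensional (points (total_space P)). smooth_map (total_space P) model_manifold p \<and>
        (\<forall>x \<in> points M. homogeneous_polynomial (fibre P x) k p)}"

definition Pol ::
    "('a, 'm::fin_dim_inner) manifold \<Rightarrow> ('a, 'e, 'm, 'f::fin_dim_inner) vbundle
      \<Rightarrow> (real, 'e \<Rightarrow> real) module" where
  "Pol M P =
     \<lparr>carrier = {(\<lambda>e \<in> points (total_space P). \<Sum>k\<le>d. p k e) |(d::nat) p. \<forall>k\<le>d. p k \<in> Pol_hom M P k},
      monoid.mult = (\<lambda>p q. \<lambda>e \<in> points (total_space P). p e * q e),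
      one = (\<lambda>e \<in> points (total_space P). 1),
      zero = (\<lambda>e \<in> points (total_space P). 0),
      add = (\<lambda>p q. \<lambda>e \<in> points (total_space P). p e + q e),
      smult = (\<lambda>c p. \<lambda>e \<in> points (total_space P). c * p e)\<rparr>"

definition algebra_isomorphic :: "(real, 'v) module \<Rightarrow> (real, 'w) module \<Rightarrow> bool" where
  "algebra_isomorphic A B \<longleftrightarrow>
     (\<exists>h \<in> ring_iso A B. \<forall>c. \<forall>a \<in> carrier A. h (c \<odot>\<^bsub>A\<^esub> a) = c \<odot>\<^bsub>B\<^esub> h a)"

end

theory Submission
  imports Defs
begin

text \<open>
  One direction is pullback of functions along the inverse of a bundle isomorphism. For the other, a
  homomorphism \<open>h\<close> of \<open>\<real>\<close>-algebras \<open>Pol(\<pi>) \<rightarrow> Pol(\<eta>)\<close> is turned into geometry in three steps.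

  The base. On a line through the origin of a fibre a polynomial function is a polynomial in one
  variable, so a unit of \<open>Pol(\<pi>)\<close> is constant on fibres. The functions that are constant on fibres are
  the functions \<open>C\<^sup>\<infinity>(M) = Pol\<^sup>0(\<pi>)\<close> of the base, and each of them is a difference of two units.
  Hence \<open>h\<close> maps \<open>C\<^sup>\<infinity>(M)\<close> into \<open>C\<^sup>\<infinity>(N)\<close> (\<open>h_const_in\<close>). Every character of \<open>C\<^sup>\<infinity>(M)\<close> is the evaluation
  at a point (\<open>character_is_evaluation\<close>), which gives a smooth map \<open>f : N \<rightarrow> M\<close> such that \<open>h g = g \<circ> f\<close>
  for \<open>g \<in> C\<^sup>\<infinity>(M)\<close>.

  The fibres. An isomorphism \<open>h\<close> need not respect degrees: it corresponds to a map \<open>E\<^sub>\<eta> \<rightarrow> E\<^sub>\<pi>\<close> over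
  \<open>f\<close> that is polynomial on fibres and may move the zero section. What has to be taken is its
  derivative along the zero section. Algebraically, sending a fibrewise linear function \<open>l\<close> to the
  component of degree 1 of \<open>h l\<close> is \<open>C\<^sup>\<infinity>\<close>-linear over \<open>f\<close>, and is therefore the transpose of a smooth map
  \<open>A : E\<^sub>\<eta> \<rightarrow> E\<^sub>\<pi>\<close> over \<open>f\<close> that is linear on fibres (\<open>fibre_map_exists\<close>).

  Bijectivity. The component of degree 1 of \<open>h p\<close> is a derivation in \<open>p\<close> and vanishes on
  \<open>C\<^sup>\<infinity>(M)\<close>. Locally \<open>Pol(\<pi>)\<close> is generated over \<open>C\<^sup>\<infinity>(M)\<close> by a frame of linear functions; this is
  Euler's identity, which divides a homogeneous function by linear ones with smooth quotients
  (\<open>frame_division\<close>). So if \<open>h\<close> is onto, then every linear function on \<open>E\<^sub>\<eta>\<close> is locally a combination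
  of linear functions on \<open>E\<^sub>\<pi>\<close> composed with \<open>A\<close>, with coefficients in \<open>C\<^sup>\<infinity>(N)\<close>
  (\<open>linear_functions_locally_spanned\<close>). This makes \<open>A\<close> injective on fibres. Applied to \<open>h\<close> and to its
  inverse it shows that all fibres have the same dimension, hence that \<open>A\<close> is bijective on fibres, and
  the same formula shows that the inverse of \<open>A\<close> is smooth.
\<close>

section \<open>Calculus in finite-dimensional inner product spaces\<close>

lemma orthonormal_basis_exists:
  "\<exists>B :: 'a::fin_dim_inner set. finite B \<and> (\<forall>v. v = (\<Sum>b\<in>B. (v \<bullet> b) *\<^sub>R b)) \<and>
     (\<forall>b\<in>B. \<forall>c\<in>B. b \<bullet> c = (if b = c then 1 else 0))"
proof -
  obtain B0 :: "'a set" where B0: "finite B0" "\<And>x. \<exists>c. x = (\<Sum>b\<in>B0. c b *\<^sub>R b)"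
    using finite_spanning_set by blast
  obtain C where C: "finite C" "span C = span B0" "pairwise orthogonal C"
    using basis_orthogonal[OF B0(1)] by blast
  define B where "B = (\<lambda>c. c /\<^sub>R norm c) ` (C - {0})"
  have fin: "finite B" using C(1) by (simp add: B_def)
  have on: "b \<bullet> c = (if b = c then 1 else 0)" if "b \<in> B" "c \<in> B" for b c
  proof -
    obtain x y where xy: "x \<in> C" "x \<noteq> 0" "b = x /\<^sub>R norm x" "y \<in> C" "y \<noteq> 0" "c = y /\<^sub>R norm y"
      using \<open>b \<in> B\<close> \<open>c \<in> B\<close> by (auto simp: B_def)
    show ?thesis
    proof (cases "x = y")
      case True
      then have "b \<bullet> c = 1" using xy by (simp add: power2_norm_eq_inner[symmetric] power2_eq_square)
      then show ?thesis using True xy by simp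
    next
      case False
      then have "x \<bullet> y = 0" using C(3) xy by (auto simp: pairwise_def orthogonal_def)
      then have "b \<bullet> c = 0" using xy by simp
      moreover have "b \<bullet> b \<noteq> 0" using xy by simp
      ultimately show ?thesis by auto
    qed
  qed
  have sp: "v \<in> span B" for v
  proof -
    obtain c where "v = (\<Sum>b\<in>B0. c b *\<^sub>R b)" using B0(2) by blast
    then have "v \<in> span C" unfolding C(2) by (simp add: span_sum span_scale span_base)
    moreover have "span C \<subseteq> span B"
    proof (rule span_minimal[OF _ subspace_span], rule subsetI)
      fix x assume x: "x \<in> C"
      show "x \<in> span B"
      proof (cases "x = 0")
        case False
        then have "x /\<^sub>R norm x \<in> span B" using x by (intro span_base) (auto simp: B_def)
        from span_scale[OF this, of "norm x"] show ?thesis using False by simp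
      qed (simp add: span_zero)
    qed
    ultimately show ?thesis by blast
  qed
  have "v = (\<Sum>b\<in>B. (v \<bullet> b) *\<^sub>R b)" for v
  proof -
    obtain u where u: "v = (\<Sum>b\<in>B. u b *\<^sub>R b)" using sp[of v] span_finite[OF fin] by auto
    have "v \<bullet> c = u c" if "c \<in> B" for c
    proof -
      have "v \<bullet> c = (\<Sum>b\<in>B. u b * (b \<bullet> c))" by (simp add: u inner_sum_left)
      also have "\<dots> = (\<Sum>b\<in>B. if b = c then u b else 0)"
        using that on by (intro sum.cong) auto
      also have "\<dots> = u c" using fin that by simp
      finally show ?thesis .
    qed
    then show ?thesis using u by simp
  qed
  with fin on show ?thesis by blast
qed

text \<open>The class provides no canonical basis. A chosen orthonormal basis serves for coordinates \<open>v \<bullet> b\<close>.\<close>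

definition onb :: "'a::fin_dim_inner set" where
  "onb = (SOME B. finite B \<and> (\<forall>v. v = (\<Sum>b\<in>B. (v \<bullet> b) *\<^sub>R b)) \<and>
     (\<forall>b\<in>B. \<forall>c\<in>B. b \<bullet> c = (if b = c then 1 else 0)))"

lemma
  fixes v b c :: "'a::fin_dim_inner"
  shows finite_onb [simp]: "finite (onb :: 'a::fin_dim_inner set)"
    and onb_representation: "v = (\<Sum>b\<in>onb. (v \<bullet> b) *\<^sub>R b)"
    and onb_inner: "b \<in> onb \<Longrightarrow> c \<in> onb \<Longrightarrow> b \<bullet> c = (if b = c then 1 else 0)"
proof -
  note onb = someI_ex[OF orthonormal_basis_exists[where 'a='a], folded onb_def]
  show "finite (onb :: 'a set)" using onb by (rule conjunct1)
  show "v = (\<Sum>b\<in>onb. (v \<bullet> b) *\<^sub>R b)"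
    using onb[THEN conjunct2, THEN conjunct1] by (rule spec)
  show "b \<in> onb \<Longrightarrow> c \<in> onb \<Longrightarrow> b \<bullet> c = (if b = c then 1 else 0)"
    using onb[THEN conjunct2, THEN conjunct2] by simp
qed

lemma onb_sum_inner: "c \<in> onb \<Longrightarrow> (\<Sum>b\<in>onb. u b *\<^sub>R b) \<bullet> c = u c"
  by (simp add: inner_sum_left onb_inner if_distrib[of "\<lambda>x. _ * x"] cong: sum.cong if_cong)

text \<open>A ball is a closed subset of a box, and a box is a sum of finitely many compact segments.\<close>

lemma compact_cball_fin_dim: "compact (cball a r :: 'a::fin_dim_inner set)"
proof -
  have box: "finite B \<Longrightarrow> compact {\<Sum>b\<in>B. c b *\<^sub>R b |c. \<forall>b\<in>B. \<bar>c b\<bar> \<le> r}" for B :: "'a set"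
  proof (induction B rule: finite_induct)
    case empty
    then show ?case by (simp add: Collect_conv_if)
  next
    case (insert b B)
    let ?K = "{\<Sum>b\<in>B. c b *\<^sub>R b |c. \<forall>b\<in>B. \<bar>c b\<bar> \<le> r}"
    let ?L = "(\<lambda>t. t *\<^sub>R b) ` {-r..r}"
    have "compact ?L" by (intro compact_continuous_image continuous_intros) auto
    from compact_sums[OF this insert.IH] have "compact {x + y |x y. x \<in> ?L \<and> y \<in> ?K}" .
    also have "{x + y |x y. x \<in> ?L \<and> y \<in> ?K} =
        {\<Sum>b\<in>insert b B. c b *\<^sub>R b |c. \<forall>b\<in>insert b B. \<bar>c b\<bar> \<le> r}" (is "?A = ?C")
    proof
      show "?A \<subseteq> ?C"
      proof
        fix z assume "z \<in> ?A"
        then obtain t c where z: "t \<in> {-r..r}" "\<forall>b\<in>B. \<bar>c b\<bar> \<le> r" "z = t *\<^sub>R b + (\<Sum>b\<in>B. c b *\<^sub>R b)"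
          by blast
        have "(\<Sum>x\<in>B. (c(b := t)) x *\<^sub>R x) = (\<Sum>x\<in>B. c x *\<^sub>R x)"
          using insert by (intro sum.cong) auto
        then have "z = (\<Sum>x\<in>insert b B. (c(b := t)) x *\<^sub>R x)" using insert z(3) by simp
        moreover have "\<forall>x\<in>insert b B. \<bar>(c(b := t)) x\<bar> \<le> r" using z by auto
        ultimately show "z \<in> ?C" by blast
      qed
      show "?C \<subseteq> ?A"
      proof
        fix z assume "z \<in> ?C"
        then obtain c where c: "\<forall>x\<in>insert b B. \<bar>c x\<bar> \<le> r" "z = (\<Sum>x\<in>insert b B. c x *\<^sub>R x)"
          by blast
        then have "z = c b *\<^sub>R b + (\<Sum>x\<in>B. c x *\<^sub>R x)" using insert by simp
        moreover have "c b *\<^sub>R b \<in> ?L" using c(1) by (intro imageI) auto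
        ultimately show "z \<in> ?A" using c by blast
      qed
    qed
    finally show ?case .
  qed
  have "compact (cball 0 r :: 'a set)"
  proof -
    have "cball (0::'a) r \<subseteq> {\<Sum>b\<in>onb. c b *\<^sub>R b |c. \<forall>b\<in>onb. \<bar>c b\<bar> \<le> r}"
    proof
      fix v :: 'a assume v: "v \<in> cball 0 r"
      have "\<bar>v \<bullet> b\<bar> \<le> r" if "b \<in> onb" for b
      proof -
        have "norm b = 1" using onb_inner[OF that that] by (simp add: norm_eq_sqrt_inner)
        then show ?thesis using Cauchy_Schwarz_ineq2[of v b] v by auto
      qed
      then show "v \<in> {\<Sum>b\<in>onb. c b *\<^sub>R b |c. \<forall>b\<in>onb. \<bar>c b\<bar> \<le> r}"
        by (intro CollectI exI[of _ "\<lambda>b. v \<bullet> b"] conjI onb_representation) auto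
    qed
    then have eq: "cball (0::'a) r = {\<Sum>b\<in>onb. c b *\<^sub>R b |c. \<forall>b\<in>onb. \<bar>c b\<bar> \<le> r} \<inter> cball 0 r"
      by blast
    show ?thesis by (subst eq) (rule compact_Int_closed[OF box[OF finite_onb] closed_cball])
  qed
  then have "compact ((+) a ` cball 0 r)" by (rule compact_translation)
  then show ?thesis by simp
qed

subsection \<open>Functions of class \<open>C\<^sup>k\<close>\<close>

lemma Ck_on_has_derivative:
  "Ck_on (Suc k) S f \<Longrightarrow> x \<in> S \<Longrightarrow> (f has_derivative frechet_derivative f (at x)) (at x)"
  by (simp add: frechet_derivative_works[symmetric])

lemma Ck_on_cong:
  assumes "open S" "\<And>x. x \<in> S \<Longrightarrow> f x = g x"
  shows "Ck_on k S f = Ck_on k S g"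
proof -
  have "Ck_on k S g" if "Ck_on k S f" "\<And>x. x \<in> S \<Longrightarrow> f x = g x" for f g :: "'a \<Rightarrow> 'b"
    using that
  proof (induction k arbitrary: f g)
    case 0
    then show ?case using continuous_on_cong[of S S f g] by simp
  next
    case (Suc k)
    have d: "(g has_derivative frechet_derivative f (at x)) (at x)" if "x \<in> S" for x
      using Ck_on_has_derivative[OF Suc.prems(1) that] \<open>open S\<close> that Suc.prems(2)
      by (rule has_derivative_transform_within_open)
    have "Ck_on k S (\<lambda>x. frechet_derivative g (at x) v)" for v
    proof (rule Suc.IH)
      show "Ck_on k S (\<lambda>x. frechet_derivative f (at x) v)" using Suc.prems(1) by simp
      show "frechet_derivative f (at x) v = frechet_derivative g (at x) v" if "x \<in> S" for x
        using frechet_derivative_at[OF d[OF that]] by simp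
    qed
    moreover have "g differentiable (at x)" if "x \<in> S" for x
      using d[OF that] by (rule differentiableI)
    ultimately show ?case by simp
  qed
  with assms show ?thesis by metis
qed

lemma Ck_on_SucI:
  assumes "open S" "\<And>x. x \<in> S \<Longrightarrow> (f has_derivative f' x) (at x)"
    and "\<And>v. Ck_on k S (\<lambda>x. f' x v)"
  shows "Ck_on (Suc k) S f"
proof -
  have "Ck_on k S (\<lambda>x. frechet_derivative f (at x) v)" for v
    using assms(3)[of v] frechet_derivative_at[OF assms(2)]
    by (subst Ck_on_cong[OF assms(1), of _ "\<lambda>x. f' x v"]) auto
  then show ?thesis using differentiableI[OF assms(2)] by simp
qed

lemma Ck_on_subset: "Ck_on k S f \<Longrightarrow> T \<subseteq> S \<Longrightarrow> Ck_on k T f"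
  by (induction k arbitrary: f) (auto intro: continuous_on_subset)

lemma Ck_on_SucD: "Ck_on (Suc k) S f \<Longrightarrow> Ck_on k S f"
proof (induction k arbitrary: f)
  case 0
  then show ?case
    by (auto intro!: continuous_at_imp_continuous_on differentiable_imp_continuous_within)
qed auto

lemma Ck_on_local:
  assumes "\<And>x. x \<in> S \<Longrightarrow> \<exists>T. open T \<and> x \<in> T \<and> Ck_on k T f"
  shows "Ck_on k S f"
  using assms
proof (induction k arbitrary: f)
  case 0
  then show ?case
    by (simp, intro continuous_at_imp_continuous_on ballI)
      (metis continuous_on_eq_continuous_at)
next
  case (Suc k)
  have "f differentiable (at x)" if "x \<in> S" for x
    using Suc.prems[OF that] by auto
  moreover have "Ck_on k S (\<lambda>x. frechet_derivative f (at x) v)" for v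
  proof (rule Suc.IH)
    show "\<exists>T. open T \<and> x \<in> T \<and> Ck_on k T (\<lambda>x. frechet_derivative f (at x) v)" if "x \<in> S" for x
      using Suc.prems[OF that] by auto
  qed
  ultimately show ?case by simp
qed

lemma Ck_on_const: "Ck_on k S (\<lambda>x. c)"
proof (induction k arbitrary: c)
  case (Suc k)
  then show ?case by (simp add: frechet_derivative_const)
qed simp

lemma Ck_on_bounded_linear:
  assumes "open S" "bounded_linear L" "Ck_on k S f"
  shows "Ck_on k S (\<lambda>x. L (f x))"
  using assms(3)
proof (induction k arbitrary: f)
  case 0
  then show ?case
    using assms(2) by (auto intro: bounded_linear.continuous_on)
next
  case (Suc k)
  show ?case
  proof (rule Ck_on_SucI[OF assms(1)])
    show "((\<lambda>x. L (f x)) has_derivative (\<lambda>v. L (frechet_derivative f (at x) v))) (at x)"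
      if "x \<in> S" for x
      using bounded_linear.has_derivative[OF assms(2) Ck_on_has_derivative[OF Suc.prems that]] .
    show "Ck_on k S (\<lambda>x. L (frechet_derivative f (at x) v))" for v
      using Suc by simp
  qed
qed

lemma Ck_on_id: "Ck_on k S (\<lambda>x. x)"
proof (cases k)
  case (Suc n)
  then show ?thesis by (simp add: Ck_on_const)
qed simp

lemma Ck_on_add:
  assumes "open S" "Ck_on k S f" "Ck_on k S g"
  shows "Ck_on k S (\<lambda>x. f x + g x)"
  using assms(2,3)
proof (induction k arbitrary: f g)
  case 0
  then show ?case by (auto intro: continuous_on_add)
next
  case (Suc k)
  show ?case
  proof (rule Ck_on_SucI[OF assms(1)])
    show "((\<lambda>x. f x + g x) has_derivative
        (\<lambda>v. frechet_derivative f (at x) v + frechet_derivative g (at x) v)) (at x)"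
      if "x \<in> S" for x
      using Ck_on_has_derivative[OF Suc.prems(1) that] Ck_on_has_derivative[OF Suc.prems(2) that]
      by (rule has_derivative_add)
    show "Ck_on k S (\<lambda>x. frechet_derivative f (at x) v + frechet_derivative g (at x) v)" for v
      using Suc by simp
  qed
qed

lemma Ck_on_scaleR:
  assumes "open S" "Ck_on k S c" "Ck_on k S f"
  shows "Ck_on k S (\<lambda>x. c x *\<^sub>R f x)"
  using assms(2,3)
proof (induction k arbitrary: c f)
  case 0
  then show ?case by (auto intro: continuous_on_scaleR)
next
  case (Suc k)
  show ?case
  proof (rule Ck_on_SucI[OF assms(1)])
    show "((\<lambda>x. c x *\<^sub>R f x) has_derivative
        (\<lambda>v. c x *\<^sub>R frechet_derivative f (at x) v + frechet_derivative c (at x) v *\<^sub>R f x)) (at x)"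
      if "x \<in> S" for x
      using Ck_on_has_derivative[OF Suc.prems(1) that] Ck_on_has_derivative[OF Suc.prems(2) that]
      by (rule has_derivative_scaleR)
    show "Ck_on k S (\<lambda>x. c x *\<^sub>R frechet_derivative f (at x) v + frechet_derivative c (at x) v *\<^sub>R f x)"
      for v
      using Suc.prems Ck_on_SucD[OF Suc.prems(1)] Ck_on_SucD[OF Suc.prems(2)]
      by (intro Ck_on_add[OF assms(1)] Suc.IH) (simp_all del: Ck_on.simps(1))
  qed
qed

lemma Ck_on_sum:
  assumes "open S" "\<And>i. i \<in> I \<Longrightarrow> Ck_on k S (f i)"
  shows "Ck_on k S (\<lambda>x. \<Sum>i\<in>I. f i x)"
proof (cases "finite I")
  case True
  then show ?thesis using assms(2)
    by (induction I rule: finite_induct) (simp_all add: Ck_on_const Ck_on_add[OF assms(1)])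
qed (simp add: Ck_on_const)

text \<open>The chain rule produces \<open>g'(f x)(f'(x) v)\<close>, in which the direction of the outer derivative
  varies with \<open>x\<close>; expanding it in a basis reduces this to derivatives in fixed directions.\<close>

lemma Ck_on_compose:
  fixes g :: "'b::fin_dim_inner \<Rightarrow> 'c::real_normed_vector"
  assumes "open S" "open T" "\<And>x. x \<in> S \<Longrightarrow> f x \<in> T" "Ck_on k S f" "Ck_on k T g"
  shows "Ck_on k S (\<lambda>x. g (f x))"
  using assms(4,5)
proof (induction k arbitrary: g)
  case 0
  then show ?case using assms(3) continuous_on_compose2[of T g S f] by auto
next
  case (Suc k)
  have f: "Ck_on k S f" using Suc.prems(1) by (rule Ck_on_SucD)
  show ?case
  proof (rule Ck_on_SucI[OF assms(1)])
    fix x assume x: "x \<in> S"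
    have "((\<lambda>x. g (f x)) has_derivative
        (\<lambda>v. frechet_derivative g (at (f x)) (frechet_derivative f (at x) v))) (at x)"
      using Ck_on_has_derivative[OF Suc.prems(1) x]
        Ck_on_has_derivative[OF Suc.prems(2) assms(3)[OF x]]
      by (rule has_derivative_compose)
    moreover have "frechet_derivative g (at (f x)) (frechet_derivative f (at x) v) =
        (\<Sum>b\<in>onb. (frechet_derivative f (at x) v \<bullet> b) *\<^sub>R frechet_derivative g (at (f x)) b)" for v
    proof -
      have "linear (frechet_derivative g (at (f x)))"
        using Ck_on_has_derivative[OF Suc.prems(2) assms(3)[OF x]] has_derivative_linear by blast
      then show ?thesis
        by (subst onb_representation[of "frechet_derivative f (at x) v"]) (simp add: linear_sum linear_scale)
    qed
    ultimately show "((\<lambda>x. g (f x)) has_derivative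
        (\<lambda>v. \<Sum>b\<in>onb. (frechet_derivative f (at x) v \<bullet> b) *\<^sub>R frechet_derivative g (at (f x)) b)) (at x)"
      by simp
  next
    fix v
    have "Ck_on k S (\<lambda>x. frechet_derivative f (at x) v)"
      using Suc.prems by simp
    moreover have "Ck_on k S (\<lambda>x. frechet_derivative g (at (f x)) b)" for b
      using Suc.IH[OF f, of "\<lambda>y. frechet_derivative g (at y) b"] Suc.prems by simp
    ultimately show "Ck_on k S (\<lambda>x. \<Sum>b\<in>onb. (frechet_derivative f (at x) v \<bullet> b) *\<^sub>R
        frechet_derivative g (at (f x)) b)"
      using bounded_linear_inner_left
      by (intro Ck_on_sum Ck_on_scaleR assms(1)) (rule Ck_on_bounded_linear[OF assms(1)])
  qed
qed

subsection \<open>Smooth functions on open sets\<close>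

lemma smooth_on_cong:
  "open S \<Longrightarrow> (\<And>x. x \<in> S \<Longrightarrow> f x = g x) \<Longrightarrow> smooth_on S f = smooth_on S g"
  using Ck_on_cong[of S f g] by (simp add: smooth_on_def)

lemma smooth_on_subset: "smooth_on S f \<Longrightarrow> T \<subseteq> S \<Longrightarrow> smooth_on T f"
  by (auto simp: smooth_on_def intro: Ck_on_subset)

lemma smooth_on_local:
  assumes "\<And>x. x \<in> S \<Longrightarrow> \<exists>T. open T \<and> x \<in> T \<and> smooth_on T f"
  shows "smooth_on S f"
  unfolding smooth_on_def
proof (intro allI Ck_on_local)
  fix k x assume "x \<in> S"
  then obtain T where "open T" "x \<in> T" "smooth_on T f" using assms by blast
  then show "\<exists>T. open T \<and> x \<in> T \<and> Ck_on k T f" unfolding smooth_on_def by (intro exI[of _ T]) simp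
qed

lemma smooth_onD: "smooth_on S f \<Longrightarrow> Ck_on k S f"
  by (simp add: smooth_on_def)

lemma smooth_on_continuous: "smooth_on S f \<Longrightarrow> continuous_on S f"
  by (drule smooth_onD[of _ _ 0]) simp

lemma smooth_on_has_derivative:
  "smooth_on S f \<Longrightarrow> x \<in> S \<Longrightarrow> (f has_derivative frechet_derivative f (at x)) (at x)"
  by (rule Ck_on_has_derivative[of 0], rule smooth_onD)

lemma smooth_on_frechet_derivative:
  "smooth_on S f \<Longrightarrow> smooth_on S (\<lambda>x. frechet_derivative f (at x) v)"
  unfolding smooth_on_def by (metis Ck_on.simps(2))

lemma smooth_on_const: "smooth_on S (\<lambda>x. c)"
  unfolding smooth_on_def by (rule allI, rule Ck_on_const)

lemma smooth_on_id: "smooth_on S (\<lambda>x. x)"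
  unfolding smooth_on_def by (rule allI, rule Ck_on_id)

lemma smooth_on_bounded_linear:
  "open S \<Longrightarrow> bounded_linear L \<Longrightarrow> smooth_on S f \<Longrightarrow> smooth_on S (\<lambda>x. L (f x))"
  by (simp add: smooth_on_def Ck_on_bounded_linear)

lemma smooth_on_add:
  "open S \<Longrightarrow> smooth_on S f \<Longrightarrow> smooth_on S g \<Longrightarrow> smooth_on S (\<lambda>x. f x + g x)"
  by (simp add: smooth_on_def Ck_on_add)

lemma smooth_on_scaleR:
  "open S \<Longrightarrow> smooth_on S c \<Longrightarrow> smooth_on S f \<Longrightarrow> smooth_on S (\<lambda>x. c x *\<^sub>R f x)"
  by (simp add: smooth_on_def Ck_on_scaleR)

lemma smooth_on_mult:
  fixes f g :: "'a::real_normed_vector \<Rightarrow> real"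
  shows "open S \<Longrightarrow> smooth_on S f \<Longrightarrow> smooth_on S g \<Longrightarrow> smooth_on S (\<lambda>x. f x * g x)"
  using smooth_on_scaleR[of S f g] by simp

lemma smooth_on_sum:
  "open S \<Longrightarrow> (\<And>i. i \<in> I \<Longrightarrow> smooth_on S (f i)) \<Longrightarrow> smooth_on S (\<lambda>x. \<Sum>i\<in>I. f i x)"
  by (simp add: smooth_on_def Ck_on_sum)

lemma smooth_on_compose:
  fixes g :: "'b::fin_dim_inner \<Rightarrow> 'c::real_normed_vector"
  assumes "open S" "open T" "\<And>x. x \<in> S \<Longrightarrow> f x \<in> T" "smooth_on S f" "smooth_on T g"
  shows "smooth_on S (\<lambda>x. g (f x))"
  unfolding smooth_on_def using Ck_on_compose[OF assms(1-3) smooth_onD[OF assms(4)] smooth_onD[OF assms(5)]]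
  by (rule allI)

lemma smooth_on_Pair:
  assumes "open S" "smooth_on S f" "smooth_on S g"
  shows "smooth_on S (\<lambda>x. (f x, g x))"
proof -
  have "smooth_on S (\<lambda>x. (f x, 0) + (0, g x))"
    by (intro smooth_on_add assms(1) smooth_on_bounded_linear[OF assms(1) _ assms(2)]
        smooth_on_bounded_linear[OF assms(1) _ assms(3)] bounded_linear_Pair
        bounded_linear_ident bounded_linear_zero)
  then show ?thesis by simp
qed

lemma smooth_on_inner:
  fixes f g :: "'a::real_normed_vector \<Rightarrow> 'b::fin_dim_inner"
  assumes "open S" "smooth_on S f" "smooth_on S g"
  shows "smooth_on S (\<lambda>x. f x \<bullet> g x)"
proof -
  have "f x \<bullet> g x = (\<Sum>b\<in>onb. (f x \<bullet> b) * (g x \<bullet> b))" for x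
    by (subst onb_representation[of "f x"]) (simp add: inner_sum_left inner_commute[of "g x"])
  moreover have "smooth_on S (\<lambda>x. \<Sum>b\<in>onb. (f x \<bullet> b) * (g x \<bullet> b))"
    by (intro smooth_on_sum smooth_on_mult assms(1) bounded_linear_inner_left
        smooth_on_bounded_linear[OF assms(1) _ assms(2)] smooth_on_bounded_linear[OF assms(1) _ assms(3)])
  ultimately show ?thesis by simp
qed

lemma smooth_on_inverse: "smooth_on {x::real. x \<noteq> 0} inverse"
proof -
  have op: "open {x::real. x \<noteq> 0}"
    using open_delete[OF open_UNIV, of "0::real"] by (simp add: set_diff_eq)
  have "Ck_on k {x::real. x \<noteq> 0} inverse" for k
  proof (induction k)
    case (Suc k)
    show ?case
    proof (rule Ck_on_SucI[OF op])
      show "(inverse has_derivative (\<lambda>v. - (inverse x * v * inverse x))) (at x)"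
        if "x \<in> {x::real. x \<noteq> 0}" for x
        using that by (auto intro: has_derivative_inverse')
      have *: "Ck_on k {x. x \<noteq> 0} (\<lambda>x::real. (-v) *\<^sub>R (inverse x *\<^sub>R inverse x))" for v :: real
        using Suc by (intro Ck_on_scaleR[OF op] Ck_on_const)
      show "Ck_on k {x. x \<noteq> 0} (\<lambda>x::real. - (inverse x * v * inverse x))" for v
        using *[of v] by (simp add: algebra_simps)
    qed
  qed (auto intro: continuous_on_inverse)
  then show ?thesis by (simp add: smooth_on_def)
qed

subsection \<open>A smooth cutoff function on the line\<close>

definition flat :: "real poly \<Rightarrow> real \<Rightarrow> real" where
  "flat p t = (if t > 0 then poly p (inverse t) * exp (- inverse t) else 0)"

lemma poly_exp_tendsto_0: "((\<lambda>x::real. poly p x * exp (- x)) \<longlongrightarrow> 0) at_top"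
proof -
  have "((\<lambda>x::real. \<Sum>i\<le>degree p. coeff p i * (x ^ i / exp x)) \<longlongrightarrow> 0) at_top"
    by (intro tendsto_null_sum tendsto_mult_right_zero tendsto_power_div_exp_0)
  then show ?thesis
    by (simp add: poly_altdef exp_minus sum_distrib_right divide_inverse mult.assoc)
qed

text \<open>All derivatives of \<open>exp (-1/t)\<close> have the form \<open>p (1/t) exp (-1/t)\<close>, and such a function
  decays faster than \<open>t\<close> as \<open>t\<close> decreases to 0, so that it is differentiable at 0 too.\<close>

lemma flat_has_derivative:
  "(flat p has_real_derivative flat ((p - pderiv p) * [:0, 0, 1:]) t) (at t)"
proof (cases t "0::real" rule: linorder_cases)
  case less
  have "((\<lambda>_. 0) has_real_derivative 0) (at t)" by simp
  then have "(flat p has_real_derivative 0) (at t)"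
    by (rule has_field_derivative_transform_within_open[of _ _ _ "{..<0}"])
      (use less in \<open>auto simp: flat_def\<close>)
  then show ?thesis using less by (simp add: flat_def)
next
  case equal
  have "((\<lambda>h. flat p h / h) \<longlongrightarrow> 0) (at 0)"
  proof (rule filterlim_split_at)
    have "((\<lambda>h. 0) \<longlongrightarrow> (0::real)) (at_left 0)" by simp
    then show "((\<lambda>h. flat p h / h) \<longlongrightarrow> 0) (at_left 0)"
      by (rule Lim_transform_eventually) (auto simp: flat_def eventually_at_left_field intro: exI[of _ "-1"])
    have "((\<lambda>h. poly ([:0, 1:] * p) (inverse h) * exp (- inverse h)) \<longlongrightarrow> (0::real)) (at_right 0)"
      by (rule filterlim_compose[OF poly_exp_tendsto_0 filterlim_inverse_at_top_right])
    then show "((\<lambda>h. flat p h / h) \<longlongrightarrow> 0) (at_right 0)"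
      by (rule Lim_transform_eventually)
        (auto simp: flat_def eventually_at_right_field field_simps intro: exI[of _ 1])
  qed
  then show ?thesis using equal by (simp add: DERIV_def flat_def)
next
  case greater
  have "((\<lambda>t. poly p (inverse t) * exp (- inverse t)) has_real_derivative
      flat ((p - pderiv p) * [:0, 0, 1:]) t) (at t)"
    using greater
    by (auto intro!: derivative_eq_intros DERIV_chain2[OF poly_DERIV]
        simp: flat_def field_simps power2_eq_square)
  then show ?thesis
    by (rule has_field_derivative_transform_within_open[of _ _ _ "{0<..}"])
      (use greater in \<open>auto simp: flat_def\<close>)
qed

lemma smooth_on_flat: "smooth_on UNIV (flat p)"
proof -
  have "Ck_on k UNIV (flat p)" for k
  proof (induction k arbitrary: p)
    case 0
    then show ?case
      using flat_has_derivative DERIV_isCont continuous_at_imp_continuous_on by (metis Ck_on.simps(1))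
  next
    case (Suc k)
    show ?case
    proof (rule Ck_on_SucI[OF open_UNIV])
      show "(flat p has_derivative (\<lambda>v. flat ((p - pderiv p) * [:0, 0, 1:]) x * v)) (at x)" for x
        using flat_has_derivative[of p x] by (simp add: has_field_derivative_def)
      show "Ck_on k UNIV (\<lambda>x. flat ((p - pderiv p) * [:0, 0, 1:]) x * v)" for v
        using Ck_on_scaleR[OF open_UNIV Suc.IH Ck_on_const, of _ v] by simp
    qed
  qed
  then show ?thesis by (simp add: smooth_on_def)
qed

text \<open>The usual quotient \<open>e (2 - t) / (e (2 - t) + e (t - 1))\<close>, where \<open>e t\<close> is \<open>exp (-1/t)\<close> for
  positive \<open>t\<close> and 0 otherwise.\<close>

lemma smooth_cutoff_exists:
  obtains s :: "real \<Rightarrow> real" where "smooth_on UNIV s" "\<And>t. 0 \<le> s t" "\<And>t. s t \<le> 1"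
    "\<And>t. t \<le> 1 \<Longrightarrow> s t = 1" "\<And>t. t \<ge> 2 \<Longrightarrow> s t = 0"
proof -
  define e where "e = flat 1"
  define s where "s = (\<lambda>t. e (2 - t) * inverse (e (2 - t) + e (t - 1)))"
  have e: "e t \<ge> 0" "t > 0 \<Longrightarrow> e t > 0" "t \<le> 0 \<Longrightarrow> e t = 0" for t
    by (auto simp: e_def flat_def)
  have pos: "e (2 - t) + e (t - 1) > 0" for t
    using e(1)[of "2 - t"] e(1)[of "t - 1"] e(2)[of "2 - t"] e(2)[of "t - 1"] by fastforce
  have aff: "smooth_on UNIV (\<lambda>t::real. 2 - t)" "smooth_on UNIV (\<lambda>t::real. t - 1)"
  proof -
    have "smooth_on UNIV (\<lambda>t::real. 2 + (-1) *\<^sub>R t)" "smooth_on UNIV (\<lambda>t::real. t + (-1))"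
      by (intro smooth_on_add smooth_on_scaleR smooth_on_const smooth_on_id open_UNIV)+
    then show "smooth_on UNIV (\<lambda>t::real. 2 - t)" "smooth_on UNIV (\<lambda>t::real. t - 1)" by simp_all
  qed
  have e1: "smooth_on UNIV (\<lambda>t. e (2 - t))" "smooth_on UNIV (\<lambda>t. e (t - 1))"
    unfolding e_def using aff by (auto intro!: smooth_on_compose[OF _ open_UNIV _ _ smooth_on_flat])
  have op: "open {x::real. x \<noteq> 0}"
    using open_delete[OF open_UNIV, of "0::real"] by (simp add: set_diff_eq)
  have "smooth_on UNIV (\<lambda>t. inverse (e (2 - t) + e (t - 1)))"
    using pos by (intro smooth_on_compose[OF open_UNIV op _ _ smooth_on_inverse] smooth_on_add e1)
      (auto simp: less_imp_neq[symmetric])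
  then have "smooth_on UNIV s"
    unfolding s_def by (intro smooth_on_mult e1 open_UNIV)
  moreover have "0 \<le> s t" for t
    using e(1) pos[of t] by (auto simp: s_def)
  moreover have "s t \<le> 1" for t
    using e(1)[of "t - 1"] pos[of t] by (simp add: s_def field_simps)
  moreover have "s t = 1" if "t \<le> 1" for t
    using e(3)[of "t - 1"] pos[of t] that by (simp add: s_def)
  moreover have "s t = 0" if "t \<ge> 2" for t
    using e(3)[of "2 - t"] that by (simp add: s_def)
  ultimately show ?thesis by (rule that)
qed

section \<open>Smooth functions on manifolds\<close>

text \<open>The local part of the definition of a manifold, on which smoothness depends. It passes to open
  submanifolds and products by manipulating charts alone.\<close>

definition charted :: "('a, 'm::fin_dim_inner) manifold \<Rightarrow> bool" where
  "charted M \<longleftrightarrow>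
     points M = (\<Union>(U, \<phi>)\<in>atlas M. U) \<and>
     (\<forall>(U, \<phi>)\<in>atlas M. openin (top_of M) U \<and> open (\<phi> ` U) \<and>
        homeomorphic_map (subtopology (top_of M) U) (top_of_set (\<phi> ` U)) \<phi>) \<and>
     (\<forall>(U, \<phi>)\<in>atlas M. \<forall>(V, \<psi>)\<in>atlas M. smooth_on (\<phi> ` (U \<inter> V)) (\<psi> \<circ> inv_into U \<phi>))"

lemma smooth_manifold_charted: "smooth_manifold M \<Longrightarrow> charted M"
  by (simp add: smooth_manifold_def charted_def)

context
  fixes M :: "('a, 'm::fin_dim_inner) manifold"
  assumes M: "charted M"
begin

lemma chart_cover: "x \<in> points M \<Longrightarrow> \<exists>(V, \<phi>)\<in>atlas M. x \<in> V"
  using M by (fastforce simp: charted_def)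

lemma chart_open: "(V, \<phi>) \<in> atlas M \<Longrightarrow> openin (top_of M) V"
  using M by (fastforce simp: charted_def)

lemma chart_subset: "(V, \<phi>) \<in> atlas M \<Longrightarrow> V \<subseteq> points M"
  using chart_open openin_subset by blast

lemma chart_homeomorphic:
  "(V, \<phi>) \<in> atlas M \<Longrightarrow> homeomorphic_map (subtopology (top_of M) V) (top_of_set (\<phi> ` V)) \<phi>"
  using M by (fastforce simp: charted_def)

lemma chart_inj: "(V, \<phi>) \<in> atlas M \<Longrightarrow> inj_on \<phi> V"
  using homeomorphic_imp_injective_map[OF chart_homeomorphic] chart_subset
  by (metis inf.absorb2 topspace_subtopology)

lemma chart_inv [simp]: "(V, \<phi>) \<in> atlas M \<Longrightarrow> x \<in> V \<Longrightarrow> inv_into V \<phi> (\<phi> x) = x"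
  using chart_inj by (simp add: inv_into_f_f)

lemma chart_image_open:
  assumes "(V, \<phi>) \<in> atlas M" "openin (top_of M) W"
  shows "open (\<phi> ` (V \<inter> W))"
proof -
  have "openin (subtopology (top_of M) V) (V \<inter> W)"
    using assms(2) by (auto simp: openin_subtopology)
  then have "openin (top_of_set (\<phi> ` V)) (\<phi> ` (V \<inter> W))"
    using homeomorphic_imp_open_map[OF chart_homeomorphic[OF assms(1)]] by (simp add: open_map_def)
  moreover have "open (\<phi> ` V)" using M assms(1) by (fastforce simp: charted_def)
  ultimately show ?thesis using openin_open_trans by blast
qed

lemma chart_preimage_open:
  assumes "(V, \<phi>) \<in> atlas M" "open T"
  shows "openin (top_of M) {x \<in> V. \<phi> x \<in> T}"
proof -
  have "openin (top_of_set (\<phi> ` V)) (\<phi> ` V \<inter> T)" using assms(2) by auto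
  then have "openin (subtopology (top_of M) V) {x \<in> topspace (subtopology (top_of M) V). \<phi> x \<in> \<phi> ` V \<inter> T}"
    by (rule openin_continuous_map_preimage[OF homeomorphic_imp_continuous_map[OF chart_homeomorphic[OF assms(1)]]])
  moreover have "{x \<in> topspace (subtopology (top_of M) V). \<phi> x \<in> \<phi> ` V \<inter> T} = {x \<in> V. \<phi> x \<in> T}"
    using chart_subset[OF assms(1)] by auto
  ultimately show ?thesis using chart_open[OF assms(1)] by (simp add: openin_open_subtopology)
qed

lemma chart_transition:
  "(V, \<phi>) \<in> atlas M \<Longrightarrow> (V', \<phi>') \<in> atlas M \<Longrightarrow> smooth_on (\<phi> ` (V \<inter> V')) (\<lambda>u. \<phi>' (inv_into V \<phi> u))"
  using M by (fastforce simp: charted_def o_def)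

end

text \<open>Only the part of \<open>W\<close> inside the manifold matters, so \<open>UNIV\<close> stands for the whole manifold.\<close>

definition smooth_fun ::
    "('a, 'm::fin_dim_inner) manifold \<Rightarrow> 'a set \<Rightarrow> ('a \<Rightarrow> 'c::real_normed_vector) \<Rightarrow> bool" where
  "smooth_fun M W g \<longleftrightarrow> (\<forall>(V, \<phi>)\<in>atlas M. smooth_on (\<phi> ` (V \<inter> W)) (\<lambda>u. g (inv_into V \<phi> u)))"

lemma smooth_funD:
  "smooth_fun M W g \<Longrightarrow> (V, \<phi>) \<in> atlas M \<Longrightarrow> smooth_on (\<phi> ` (V \<inter> W)) (\<lambda>u. g (inv_into V \<phi> u))"
  by (auto simp: smooth_fun_def)

lemma smooth_funI:
  "(\<And>V \<phi>. (V, \<phi>) \<in> atlas M \<Longrightarrow> smooth_on (\<phi> ` (V \<inter> W)) (\<lambda>u. g (inv_into V \<phi> u))) \<Longrightarrow> smooth_fun M W g"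
  by (auto simp: smooth_fun_def)

lemma smooth_fun_subset: "smooth_fun M W g \<Longrightarrow> W' \<subseteq> W \<Longrightarrow> smooth_fun M W' g"
  by (rule smooth_funI, erule (1) smooth_on_subset[OF smooth_funD]) blast

lemma smooth_map_iff:
  "smooth_map M N f \<longleftrightarrow> continuous_map (top_of M) (top_of N) f \<and>
     (\<forall>(V, \<psi>)\<in>atlas N. smooth_fun M (f -` V) (\<lambda>x. \<psi> (f x)))"
  unfolding smooth_map_def smooth_fun_def by (fastforce simp: o_def)

context
  fixes M :: "('a, 'm::fin_dim_inner) manifold"
  assumes M: "charted M"
begin

lemma smooth_fun_Int_points: "smooth_fun M (points M \<inter> W) g \<longleftrightarrow> smooth_fun M W g"
proof -
  have "V \<inter> (points M \<inter> W) = V \<inter> W" if "(V, \<phi>) \<in> atlas M" for V \<phi>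
    using chart_subset[OF M that] by blast
  then show ?thesis by (fastforce simp: smooth_fun_def)
qed

lemma smooth_fun_cong:
  assumes "openin (top_of M) W" "\<And>x. x \<in> W \<Longrightarrow> f x = g x"
  shows "smooth_fun M W f \<longleftrightarrow> smooth_fun M W g"
proof -
  have "smooth_on (\<phi> ` (V \<inter> W)) (\<lambda>u. f (inv_into V \<phi> u)) \<longleftrightarrow> smooth_on (\<phi> ` (V \<inter> W)) (\<lambda>u. g (inv_into V \<phi> u))"
    if "(V, \<phi>) \<in> atlas M" for V \<phi>
    using assms that by (intro smooth_on_cong) (auto simp: chart_image_open[OF M] chart_inv[OF M])
  then show ?thesis by (fastforce simp: smooth_fun_def)
qed

lemma smooth_fun_local:
  assumes "\<And>x. x \<in> points M \<Longrightarrow> x \<in> W \<Longrightarrow> \<exists>T. openin (top_of M) T \<and> x \<in> T \<and> smooth_fun M T g"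
  shows "smooth_fun M W g"
proof (intro smooth_funI smooth_on_local)
  fix V \<phi> u assume V: "(V, \<phi>) \<in> atlas M" and u: "u \<in> \<phi> ` (V \<inter> W)"
  then obtain x where x: "x \<in> V" "x \<in> W" "u = \<phi> x" by blast
  then obtain T where T: "openin (top_of M) T" "x \<in> T" "smooth_fun M T g"
    using assms chart_subset[OF M V] by blast
  then show "\<exists>T. open T \<and> u \<in> T \<and> smooth_on T (\<lambda>u. g (inv_into V \<phi> u))"
    using x smooth_funD[OF T(3) V] chart_image_open[OF M V T(1)]
    by (intro exI[of _ "\<phi> ` (V \<inter> T)"]) auto
qed

text \<open>One chart is enough, because the transition maps are smooth.\<close>

lemma smooth_fun_chartI:
  assumes V: "(V, \<phi>) \<in> atlas M" and W: "openin (top_of M) W" "W \<subseteq> V"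
    and g: "smooth_on (\<phi> ` W) (\<lambda>u. g (inv_into V \<phi> u))"
  shows "smooth_fun M W g"
proof (rule smooth_funI)
  fix V' \<phi>' assume V': "(V', \<phi>') \<in> atlas M"
  have op: "open (\<phi>' ` (V' \<inter> W))" "open (\<phi> ` W)"
    using chart_image_open[OF M V' W(1)] chart_image_open[OF M V W(1)] W(2) by (auto simp: Int_absorb1)
  have "smooth_on (\<phi>' ` (V' \<inter> W)) (\<lambda>u. \<phi> (inv_into V' \<phi>' u))"
    using chart_transition[OF M V' V] by (rule smooth_on_subset) (use W(2) in blast)
  then have "smooth_on (\<phi>' ` (V' \<inter> W)) (\<lambda>u. g (inv_into V \<phi> (\<phi> (inv_into V' \<phi>' u))))"
    by (rule smooth_on_compose[OF op _ _ g, rotated]) (auto simp: chart_inv[OF M V'])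
  then show "smooth_on (\<phi>' ` (V' \<inter> W)) (\<lambda>u. g (inv_into V' \<phi>' u))"
    using W(2) by (subst smooth_on_cong[OF op(1)]) (auto simp: chart_inv[OF M V'] chart_inv[OF M V])
qed

lemma smooth_fun_const: "smooth_fun M W (\<lambda>x. c)"
  by (simp add: smooth_fun_def smooth_on_const)

lemma smooth_fun_chart:
  assumes "(V, \<phi>) \<in> atlas M"
  shows "smooth_fun M V \<phi>"
proof (rule smooth_fun_chartI[OF assms chart_open[OF M assms] order_refl])
  have "open (\<phi> ` V)" using chart_image_open[OF M assms chart_open[OF M assms]] by simp
  then show "smooth_on (\<phi> ` V) (\<lambda>u. \<phi> (inv_into V \<phi> u))"
    by (subst smooth_on_cong[where g="\<lambda>u. u"]) (auto simp: chart_inv[OF M assms] smooth_on_id)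
qed

context
  fixes W assumes W: "openin (top_of M) W"
begin

lemma smooth_fun_add: "smooth_fun M W f \<Longrightarrow> smooth_fun M W g \<Longrightarrow> smooth_fun M W (\<lambda>x. f x + g x)"
  by (auto intro!: smooth_funI smooth_on_add chart_image_open[OF M _ W] dest: smooth_funD)

lemma smooth_fun_scaleR: "smooth_fun M W f \<Longrightarrow> smooth_fun M W g \<Longrightarrow> smooth_fun M W (\<lambda>x. f x *\<^sub>R g x)"
  by (auto intro!: smooth_funI smooth_on_scaleR chart_image_open[OF M _ W] dest: smooth_funD)

lemma smooth_fun_mult:
  fixes f g :: "'a \<Rightarrow> real"
  shows "smooth_fun M W f \<Longrightarrow> smooth_fun M W g \<Longrightarrow> smooth_fun M W (\<lambda>x. f x * g x)"
  by (auto intro!: smooth_funI smooth_on_mult chart_image_open[OF M _ W] dest: smooth_funD)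

lemma smooth_fun_power:
  fixes f :: "'a \<Rightarrow> real"
  shows "smooth_fun M W f \<Longrightarrow> smooth_fun M W (\<lambda>x. f x ^ n)"
  by (induction n) (simp_all add: smooth_fun_const smooth_fun_mult)

lemma smooth_fun_diff:
  assumes "smooth_fun M W f" "smooth_fun M W g"
  shows "smooth_fun M W (\<lambda>x. f x - g x)"
  using smooth_fun_add[OF assms(1) smooth_fun_scaleR[OF smooth_fun_const[of W "-1"] assms(2)]] by simp

lemma smooth_fun_sum:
  "(\<And>i. i \<in> I \<Longrightarrow> smooth_fun M W (f i)) \<Longrightarrow> smooth_fun M W (\<lambda>x. \<Sum>i\<in>I. f i x)"
  by (auto intro!: smooth_funI smooth_on_sum chart_image_open[OF M _ W] dest: smooth_funD)

lemma smooth_fun_prod: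
  fixes f :: "'i \<Rightarrow> 'a \<Rightarrow> real"
  shows "(\<And>i. i \<in> I \<Longrightarrow> smooth_fun M W (f i)) \<Longrightarrow> smooth_fun M W (\<lambda>x. \<Prod>i\<in>I. f i x)"
  by (induction I rule: infinite_finite_induct) (simp_all add: smooth_fun_const smooth_fun_mult)

lemma smooth_fun_inner:
  fixes f g :: "'a \<Rightarrow> 'b::fin_dim_inner"
  shows "smooth_fun M W f \<Longrightarrow> smooth_fun M W g \<Longrightarrow> smooth_fun M W (\<lambda>x. f x \<bullet> g x)"
  by (auto intro!: smooth_funI smooth_on_inner chart_image_open[OF M _ W] dest: smooth_funD)

lemma smooth_fun_smooth_on:
  fixes f :: "'a \<Rightarrow> 'b::fin_dim_inner"
  assumes "smooth_fun M W f" "open T" "smooth_on T G" "\<And>x. x \<in> W \<Longrightarrow> f x \<in> T"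
  shows "smooth_fun M W (\<lambda>x. G (f x))"
proof (rule smooth_funI)
  fix V \<phi> assume V: "(V, \<phi>) \<in> atlas M"
  show "smooth_on (\<phi> ` (V \<inter> W)) (\<lambda>u. G (f (inv_into V \<phi> u)))"
    using assms(4) by (intro smooth_on_compose[OF chart_image_open[OF M V W] assms(2) _ _ assms(3)]
        smooth_funD[OF assms(1) V]) (auto simp: chart_inv[OF M V])
qed

lemma smooth_fun_inverse:
  fixes f :: "'a \<Rightarrow> real"
  assumes "smooth_fun M W f" "\<And>x. x \<in> W \<Longrightarrow> f x \<noteq> 0"
  shows "smooth_fun M W (\<lambda>x. inverse (f x))"
proof -
  have "open {x::real. x \<noteq> 0}"
    using open_delete[OF open_UNIV, of "0::real"] by (simp add: set_diff_eq)
  with smooth_fun_smooth_on[OF assms(1) _ smooth_on_inverse] assms(2) show ?thesis by simp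
qed

lemma smooth_fun_preimage_open:
  assumes "smooth_fun M W f" "open T"
  shows "openin (top_of M) {x \<in> W. f x \<in> T}"
proof (subst openin_subopen, intro ballI)
  fix x assume x: "x \<in> {x \<in> W. f x \<in> T}"
  then obtain V \<phi> where V: "(V, \<phi>) \<in> atlas M" "x \<in> V"
    using chart_cover[OF M] openin_subset[OF W] by blast
  have cont: "continuous_on (\<phi> ` (V \<inter> W)) (\<lambda>u. f (inv_into V \<phi> u))"
    using smooth_on_continuous[OF smooth_funD[OF assms(1) V(1)]] .
  have "open ((\<lambda>u. f (inv_into V \<phi> u)) -` T \<inter> \<phi> ` (V \<inter> W))"
    using continuous_open_preimage[OF cont chart_image_open[OF M V(1) W] assms(2)]
    by (simp add: Int_commute)
  from chart_preimage_open[OF M V(1) this]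
  have "openin (top_of M) {y \<in> V. \<phi> y \<in> (\<lambda>u. f (inv_into V \<phi> u)) -` T \<inter> \<phi> ` (V \<inter> W)}" (is "openin _ ?Y") .
  moreover have sub: "y \<in> W" if "y \<in> V" "\<phi> y \<in> \<phi> ` (V \<inter> W)" for y
    using that chart_inj[OF M V(1)] by (auto dest: inj_onD)
  have "?Y \<subseteq> {x \<in> W. f x \<in> T}"
  proof
    fix y assume y: "y \<in> ?Y"
    then have "inv_into V \<phi> (\<phi> y) = y" by (simp add: chart_inv[OF M V(1)])
    with y sub show "y \<in> {x \<in> W. f x \<in> T}" by simp
  qed
  moreover have "x \<in> ?Y" using x V(2) by (auto simp: chart_inv[OF M V(1)])
  ultimately show "\<exists>T'. openin (top_of M) T' \<and> x \<in> T' \<and> T' \<subseteq> {x \<in> W. f x \<in> T}"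
    by blast
qed

end

text \<open>The open sets \<open>U\<close> and the complement of \<open>K\<close> cover the manifold, and smoothness is local.\<close>

lemma smooth_fun_extend_zero:
  fixes g :: "'a \<Rightarrow> 'c::real_normed_vector"
  assumes "openin (top_of M) U" "closedin (top_of M) K" "K \<subseteq> U" "smooth_fun M U g"
    "\<And>x. x \<in> points M \<Longrightarrow> x \<notin> K \<Longrightarrow> g x = 0"
  shows "smooth_fun M UNIV g"
proof (rule smooth_fun_local)
  fix x assume x: "x \<in> points M"
  have op: "openin (top_of M) (points M - K)" using assms(2) by blast
  have "smooth_fun M (points M - K) g"
    using smooth_fun_cong[OF op, of g "\<lambda>x. 0"] assms(5) smooth_fun_const by auto
  then show "\<exists>T. openin (top_of M) T \<and> x \<in> T \<and> smooth_fun M T g"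
    using x assms op by (cases "x \<in> K") blast+
qed

lemma smooth_fun_continuous_map:
  "smooth_fun M UNIV g \<Longrightarrow> continuous_map (top_of M) euclidean g"
  using smooth_fun_preimage_open[OF openin_topspace, of g] smooth_fun_Int_points[of UNIV g]
  by (simp add: continuous_map_def)

lemma smooth_map_model: "smooth_map M model_manifold g \<longleftrightarrow> smooth_fun M UNIV g"
  using smooth_fun_continuous_map by (auto simp: smooth_map_iff model_manifold_def)

end

context
  fixes M :: "('a, 'm::fin_dim_inner) manifold"
  assumes M: "charted M"
begin

lemma smooth_fun_points: "smooth_fun M (points M) g \<longleftrightarrow> smooth_fun M UNIV g"
  using smooth_fun_Int_points[OF M, of UNIV g] by simp

lemma smooth_fun_cong_UNIV:
  "(\<And>x. x \<in> points M \<Longrightarrow> f x = g x) \<Longrightarrow> smooth_fun M UNIV f \<longleftrightarrow> smooth_fun M UNIV g"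
  using smooth_fun_cong[OF M openin_topspace, of f g] by (simp add: smooth_fun_points)

lemma smooth_fun_add_UNIV:
  "smooth_fun M UNIV f \<Longrightarrow> smooth_fun M UNIV g \<Longrightarrow> smooth_fun M UNIV (\<lambda>x. f x + g x)"
  using smooth_fun_add[OF M openin_topspace, of f g] by (simp add: smooth_fun_points)

lemma smooth_fun_mult_UNIV:
  fixes f g :: "'a \<Rightarrow> real"
  shows "smooth_fun M UNIV f \<Longrightarrow> smooth_fun M UNIV g \<Longrightarrow> smooth_fun M UNIV (\<lambda>x. f x * g x)"
  using smooth_fun_mult[OF M openin_topspace, of f g] by (simp add: smooth_fun_points)

lemma smooth_fun_sum_UNIV:
  "(\<And>i. i \<in> I \<Longrightarrow> smooth_fun M UNIV (f i)) \<Longrightarrow> smooth_fun M UNIV (\<lambda>x. \<Sum>i\<in>I. f i x)"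
  using smooth_fun_sum[OF M openin_topspace, of I f] by (simp add: smooth_fun_points)

end

lemma smooth_mapD:
  assumes "smooth_map M N f"
  shows "continuous_map (top_of M) (top_of N) f" "f ` points M \<subseteq> points N"
    "(V, \<psi>) \<in> atlas N \<Longrightarrow> smooth_fun M (f -` V) (\<lambda>x. \<psi> (f x))"
  using assms by (auto simp: smooth_map_iff continuous_map_def)

lemma smooth_map_preimage_open:
  "smooth_map M N f \<Longrightarrow> openin (top_of N) W \<Longrightarrow> openin (top_of M) (points M \<inter> f -` W)"
  using openin_continuous_map_preimage[OF smooth_mapD(1)] by (fastforce simp: vimage_def Int_def)

lemma smooth_fun_compose_map:
  assumes M: "charted M" and N: "charted N" and f: "smooth_map M N f"
    and W: "openin (top_of N) W" and g: "smooth_fun N W g"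
  shows "smooth_fun M (f -` W) (\<lambda>x. g (f x))"
proof (rule smooth_fun_local[OF M])
  fix x assume x: "x \<in> points M" "x \<in> f -` W"
  then obtain V \<psi> where V: "(V, \<psi>) \<in> atlas N" "f x \<in> V"
    using chart_cover[OF N] smooth_mapD(2)[OF f] by blast
  let ?T = "points M \<inter> f -` (V \<inter> W)"
  have T: "openin (top_of M) ?T"
    using smooth_map_preimage_open[OF f] V(1) W chart_open[OF N] by blast
  have "smooth_fun M ?T (\<lambda>x. \<psi> (f x))"
    using smooth_mapD(3)[OF f V(1)] by (rule smooth_fun_subset) auto
  then have "smooth_fun M ?T (\<lambda>x. g (inv_into V \<psi> (\<psi> (f x))))"
    by (rule smooth_fun_smooth_on[OF M T _ chart_image_open[OF N V(1) W] smooth_funD[OF g V(1)]]) auto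
  then have "smooth_fun M ?T (\<lambda>x. g (f x))"
    by (subst smooth_fun_cong[OF M T]) (auto simp: chart_inv[OF N V(1)])
  then show "\<exists>T. openin (top_of M) T \<and> x \<in> T \<and> smooth_fun M T (\<lambda>x. g (f x))"
    using x V T by (intro exI[of _ ?T]) auto
qed

lemma smooth_fun_compose_map_UNIV:
  "charted M \<Longrightarrow> charted N \<Longrightarrow> smooth_map M N f \<Longrightarrow> smooth_fun N UNIV g \<Longrightarrow>
   smooth_fun M UNIV (\<lambda>x. g (f x))"
  using smooth_fun_compose_map[OF _ _ _ openin_topspace, of M N f g] smooth_mapD(2)[of M N f]
    smooth_fun_Int_points[of M "f -` points N"] smooth_fun_Int_points[of M UNIV]
    smooth_fun_Int_points[of N UNIV]
  by (metis Int_absorb2 inf_top.right_neutral image_subset_iff_subset_vimage)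

lemma smooth_map_compose:
  assumes L: "charted L" and M: "charted M" and f: "smooth_map L M f" and g: "smooth_map M N g"
    and N: "charted N"
  shows "smooth_map L N (\<lambda>x. g (f x))"
  unfolding smooth_map_iff
proof (intro conjI ballI, safe)
  show "continuous_map (top_of L) (top_of N) (\<lambda>x. g (f x))"
    using continuous_map_compose[OF smooth_mapD(1)[OF f] smooth_mapD(1)[OF g]] by (simp add: o_def)
  fix V \<psi> assume V: "(V, \<psi>) \<in> atlas N"
  let ?W = "points M \<inter> g -` V"
  have W: "openin (top_of M) ?W" by (rule smooth_map_preimage_open[OF g chart_open[OF N V]])
  have "smooth_fun M ?W (\<lambda>x. \<psi> (g x))" using smooth_mapD(3)[OF g V] by (rule smooth_fun_subset) auto
  from smooth_fun_compose_map[OF L M f W this]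
  have "smooth_fun L (points L \<inter> f -` ?W) (\<lambda>x. \<psi> (g (f x)))" by (simp add: smooth_fun_Int_points[OF L])
  moreover have "points L \<inter> f -` ?W = points L \<inter> (\<lambda>x. g (f x)) -` V"
    using smooth_mapD(2)[OF f] by auto
  ultimately show "smooth_fun L ((\<lambda>x. g (f x)) -` V) (\<lambda>x. \<psi> (g (f x)))"
    using smooth_fun_Int_points[OF L] by metis
qed

lemma smooth_map_cong:
  assumes "charted M" "charted N" "\<And>x. x \<in> points M \<Longrightarrow> f x = g x"
  shows "smooth_map M N f \<longleftrightarrow> smooth_map M N g"
proof -
  have "smooth_map M N g" if f: "smooth_map M N f" and eq: "\<And>x. x \<in> points M \<Longrightarrow> f x = g x" for f g
    unfolding smooth_map_iff
  proof (intro conjI ballI, safe)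
    show "continuous_map (top_of M) (top_of N) g"
      using continuous_map_eq[OF smooth_mapD(1)[OF f]] eq by blast
    fix V \<psi> assume V: "(V, \<psi>) \<in> atlas N"
    have op: "openin (top_of M) (points M \<inter> f -` V)"
      by (rule smooth_map_preimage_open[OF f chart_open[OF assms(2) V]])
    have "smooth_fun M (points M \<inter> f -` V) (\<lambda>x. \<psi> (f x))"
      using smooth_mapD(3)[OF f V] by (simp add: smooth_fun_Int_points[OF assms(1)])
    then have "smooth_fun M (points M \<inter> f -` V) (\<lambda>x. \<psi> (g x))"
      using eq by (subst smooth_fun_cong[OF assms(1) op, of _ "\<lambda>x. \<psi> (f x)"]) auto
    moreover have "points M \<inter> f -` V = points M \<inter> g -` V" using eq by auto
    ultimately show "smooth_fun M (g -` V) (\<lambda>x. \<psi> (g x))"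
      using smooth_fun_Int_points[OF assms(1)] by metis
  qed
  then show ?thesis using assms(3) by metis
qed

subsection \<open>Open submanifolds and products\<close>

lemma charted_model: "charted (model_manifold :: ('m::fin_dim_inner, 'm) manifold)"
proof -
  have "smooth_on (UNIV :: 'm set) id" using smooth_on_id unfolding id_def .
  then show ?thesis by (auto simp: charted_def model_manifold_def)
qed

lemma points_model [simp]: "points model_manifold = UNIV"
  by (simp add: model_manifold_def)

lemma points_open_submanifold [simp]: "points (open_submanifold M U) = points M \<inter> U"
  by (simp add: open_submanifold_def)

lemma points_prod_manifold [simp]: "points (prod_manifold M N) = points M \<times> points N"
  by (simp add: prod_manifold_def)

context
  fixes M :: "('a, 'm::fin_dim_inner) manifold" and U
  assumes M: "charted M" and U: "openin (top_of M) U"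
begin

lemma open_submanifold_chartD:
  assumes "(V', \<phi>) \<in> atlas (open_submanifold M U)"
  obtains V where "(V, \<phi>) \<in> atlas M" "V' = V \<inter> U" "\<forall>u\<in>\<phi> ` V'. inv_into V' \<phi> u = inv_into V \<phi> u"
proof -
  obtain V where V: "(V, \<phi>) \<in> atlas M" "V' = V \<inter> U"
    using assms by (auto simp: open_submanifold_def)
  have inj: "inj_on \<phi> V'" using inj_on_subset[OF chart_inj[OF M V(1)], of V'] V(2) by simp
  show ?thesis
  proof (rule that[OF V], rule ballI)
    fix u assume "u \<in> \<phi> ` V'"
    then obtain x where x: "x \<in> V'" "u = \<phi> x" by blast
    then show "inv_into V' \<phi> u = inv_into V \<phi> u"
      using inv_into_f_f[OF inj x(1)] chart_inv[OF M V(1), of x] V(2) by simp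
  qed
qed

lemma openin_open_submanifold:
  "openin (top_of (open_submanifold M U)) W \<longleftrightarrow> openin (top_of M) W \<and> W \<subseteq> U"
  using U by (simp add: open_submanifold_def openin_open_subtopology)

lemma charted_open_submanifold: "charted (open_submanifold M U)"
  unfolding charted_def
proof (intro conjI ballI, safe)
  fix x assume "x \<in> points (open_submanifold M U)"
  then obtain V \<phi> where "(V, \<phi>) \<in> atlas M" "x \<in> V" "x \<in> U" using chart_cover[OF M] by fastforce
  then show "x \<in> (\<Union>(U, \<phi>)\<in>atlas (open_submanifold M U). U)"
    by (auto simp: open_submanifold_def intro!: bexI[of _ "(V, \<phi>)"])
next
  fix x V' \<phi> assume "(V', \<phi>) \<in> atlas (open_submanifold M U)" "x \<in> V'"
  then show "x \<in> points (open_submanifold M U)"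
    using chart_subset[OF M] by (auto simp: open_submanifold_def)
next
  fix V' \<phi> assume "(V', \<phi>) \<in> atlas (open_submanifold M U)"
  then obtain V where V: "(V, \<phi>) \<in> atlas M" "V' = V \<inter> U" "\<forall>u\<in>\<phi> ` V'. inv_into V' \<phi> u = inv_into V \<phi> u"
    by (rule open_submanifold_chartD)
  show "openin (top_of (open_submanifold M U)) V'"
    using chart_open[OF M V(1)] U by (auto simp: openin_open_submanifold V(2))
  show "open (\<phi> ` V')" using chart_image_open[OF M V(1) U] V(2) by simp
  have "homeomorphic_map (subtopology (subtopology (top_of M) V) (V \<inter> U))
      (subtopology (top_of_set (\<phi> ` V)) (\<phi> ` (V \<inter> U))) \<phi>"
  proof (rule homeomorphic_map_subtopologies[OF chart_homeomorphic[OF M V(1)]])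
    have "topspace (subtopology (top_of M) V) = V" using chart_subset[OF M V(1)] by auto
    then show "\<phi> ` (topspace (subtopology (top_of M) V) \<inter> (V \<inter> U)) =
        topspace (top_of_set (\<phi> ` V)) \<inter> \<phi> ` (V \<inter> U)" by auto
  qed
  then show "homeomorphic_map (subtopology (top_of (open_submanifold M U)) V') (top_of_set (\<phi> ` V')) \<phi>"
    by (simp add: open_submanifold_def V(2) subtopology_subtopology Int_absorb1 image_mono Int_ac)
next
  fix V' \<phi> W' \<psi> assume V': "(V', \<phi>) \<in> atlas (open_submanifold M U)" and W': "(W', \<psi>) \<in> atlas (open_submanifold M U)"
  obtain V where V: "(V, \<phi>) \<in> atlas M" "V' = V \<inter> U" "\<forall>u\<in>\<phi> ` V'. inv_into V' \<phi> u = inv_into V \<phi> u"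
    by (rule open_submanifold_chartD[OF V'])
  obtain W where W: "(W, \<psi>) \<in> atlas M" "W' = W \<inter> U"
      "\<forall>u\<in>\<psi> ` W'. inv_into W' \<psi> u = inv_into W \<psi> u"
    by (rule open_submanifold_chartD[OF W'])
  have "V' \<inter> W' = V \<inter> (W \<inter> U)" using V W by auto
  then have op: "open (\<phi> ` (V' \<inter> W'))"
    using chart_image_open[OF M V(1), of "W \<inter> U"] chart_open[OF M W(1)] U by auto
  have "smooth_on (\<phi> ` (V' \<inter> W')) (\<lambda>u. \<psi> (inv_into V \<phi> u))"
    using chart_transition[OF M V(1) W(1)] by (rule smooth_on_subset) (auto simp: V(2) W(2))
  then show "smooth_on (\<phi> ` (V' \<inter> W')) (\<psi> \<circ> inv_into V' \<phi>)"
    using V(3) by (subst smooth_on_cong[OF op, of _ "\<lambda>u. \<psi> (inv_into V \<phi> u)"]) auto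
qed

lemma smooth_fun_open_submanifold:
  assumes "openin (top_of M) W" "W \<subseteq> U"
  shows "smooth_fun (open_submanifold M U) W g \<longleftrightarrow> smooth_fun M W g"
proof -
  have *: "smooth_on (\<phi> ` (V \<inter> U \<inter> W)) (\<lambda>u. g (inv_into (V \<inter> U) \<phi> u)) \<longleftrightarrow>
      smooth_on (\<phi> ` (V \<inter> W)) (\<lambda>u. g (inv_into V \<phi> u))" if V: "(V, \<phi>) \<in> atlas M" for V \<phi>
  proof -
    have eq: "V \<inter> U \<inter> W = V \<inter> W" using assms(2) by auto
    show ?thesis unfolding eq
    proof (rule smooth_on_cong[OF chart_image_open[OF M V assms(1)]])
      fix u assume "u \<in> \<phi> ` (V \<inter> W)"
      then show "g (inv_into (V \<inter> U) \<phi> u) = g (inv_into V \<phi> u)"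
        using assms(2) chart_inv[OF M V] inv_into_f_f[OF inj_on_subset[OF chart_inj[OF M V]], of "V \<inter> U"]
        by auto
    qed
  qed
  show ?thesis unfolding smooth_fun_def by (auto simp: open_submanifold_def split_beta *)
qed

lemma smooth_map_into_open_submanifold:
  assumes "charted L" "smooth_map L M f" "f ` points L \<subseteq> U"
  shows "smooth_map L (open_submanifold M U) f"
  unfolding smooth_map_iff
proof (intro conjI ballI, safe)
  show "continuous_map (top_of L) (top_of (open_submanifold M U)) f"
    using assms smooth_mapD(1) by (auto simp: open_submanifold_def continuous_map_in_subtopology)
  fix V' \<phi> assume "(V', \<phi>) \<in> atlas (open_submanifold M U)"
  then obtain V where V: "(V, \<phi>) \<in> atlas M" "V' = V \<inter> U" "\<forall>u\<in>\<phi> ` V'. inv_into V' \<phi> u = inv_into V \<phi> u"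
    by (rule open_submanifold_chartD)
  have "points L \<inter> f -` V' = points L \<inter> f -` V" using assms(3) V by auto
  with smooth_mapD(3)[OF assms(2) V(1)] show "smooth_fun L (f -` V') (\<lambda>x. \<phi> (f x))"
    using smooth_fun_Int_points[OF assms(1)] by metis
qed

lemma smooth_map_inclusion: "smooth_map (open_submanifold M U) M (\<lambda>x. x)"
  unfolding smooth_map_iff
proof (intro conjI ballI, safe)
  show "continuous_map (top_of (open_submanifold M U)) (top_of M) (\<lambda>x. x)"
    by (simp add: open_submanifold_def continuous_map_from_subtopology)
  fix V \<phi> assume V: "(V, \<phi>) \<in> atlas M"
  let ?O = "open_submanifold M U"
  have "smooth_fun M (V \<inter> U) \<phi>" using smooth_fun_chart[OF M V] by (rule smooth_fun_subset) auto
  then have "smooth_fun ?O (V \<inter> U) \<phi>"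
    using V U chart_open[OF M] by (subst smooth_fun_open_submanifold) auto
  moreover have "points ?O \<inter> V = V \<inter> U" using chart_subset[OF M V] by auto
  ultimately have "smooth_fun ?O (points ?O \<inter> V) \<phi>" by simp
  then show "smooth_fun ?O ((\<lambda>x. x) -` V) \<phi>"
    using smooth_fun_Int_points[OF charted_open_submanifold, of V \<phi>] by simp
qed

end

context
  fixes M :: "('a, 'm::fin_dim_inner) manifold" and N :: "('b, 'n::fin_dim_inner) manifold"
  assumes M: "charted M" and N: "charted N"
begin

lemma prod_chartD:
  assumes "(X, \<kappa>) \<in> atlas (prod_manifold M N)"
  obtains V \<phi> W \<psi> where "(V, \<phi>) \<in> atlas M" "(W, \<psi>) \<in> atlas N" "X = V \<times> W" "\<kappa> = map_prod \<phi> \<psi>"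
    "\<forall>u\<in>\<kappa> ` X. inv_into X \<kappa> u = (inv_into V \<phi> (fst u), inv_into W \<psi> (snd u))"
proof -
  obtain V \<phi> W \<psi> where *: "(V, \<phi>) \<in> atlas M" "(W, \<psi>) \<in> atlas N" "X = V \<times> W" "\<kappa> = map_prod \<phi> \<psi>"
    using assms by (auto simp: prod_manifold_def)
  have inj: "inj_on \<kappa> X"
    using chart_inj[OF M *(1)] chart_inj[OF N *(2)] by (auto simp: *(3,4) inj_on_def)
  have "\<forall>u\<in>\<kappa> ` X. inv_into X \<kappa> u = (inv_into V \<phi> (fst u), inv_into W \<psi> (snd u))"
  proof
    fix u assume u: "u \<in> \<kappa> ` X"
    obtain x where x: "x \<in> X" "u = \<kappa> x" using u by blast
    then show "inv_into X \<kappa> u = (inv_into V \<phi> (fst u), inv_into W \<psi> (snd u))"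
      using inv_into_f_f[OF inj x(1)] * chart_inv[OF M *(1)] chart_inv[OF N *(2)] by auto
  qed
  with * show ?thesis by (rule that)
qed

lemma charted_prod: "charted (prod_manifold M N)"
  unfolding charted_def
proof (intro conjI ballI, safe)
  fix x y assume "(x, y) \<in> points (prod_manifold M N)"
  then obtain V \<phi> W \<psi> where *: "(V, \<phi>) \<in> atlas M" "x \<in> V" "(W, \<psi>) \<in> atlas N" "y \<in> W"
    using chart_cover[OF M, of x] chart_cover[OF N, of y] by auto
  then have "(V \<times> W, map_prod \<phi> \<psi>) \<in> atlas (prod_manifold M N)"
    by (auto simp: prod_manifold_def)
  then show "(x, y) \<in> (\<Union>(U, \<phi>)\<in>atlas (prod_manifold M N). U)"
    using * by (intro UN_I[where a="(V \<times> W, map_prod \<phi> \<psi>)"]) auto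
next
  fix x y X \<kappa> assume "(X, \<kappa>) \<in> atlas (prod_manifold M N)" "(x, y) \<in> X"
  then show "(x, y) \<in> points (prod_manifold M N)"
    using chart_subset[OF M] chart_subset[OF N] by (fastforce simp: prod_manifold_def)
next
  fix X \<kappa> assume "(X, \<kappa>) \<in> atlas (prod_manifold M N)"
  then obtain V \<phi> W \<psi> where *: "(V, \<phi>) \<in> atlas M" "(W, \<psi>) \<in> atlas N" "X = V \<times> W" "\<kappa> = map_prod \<phi> \<psi>"
    "\<forall>u\<in>\<kappa> ` X. inv_into X \<kappa> u = (inv_into V \<phi> (fst u), inv_into W \<psi> (snd u))"
    by (rule prod_chartD)
  show "openin (top_of (prod_manifold M N)) X"
    using chart_open[OF M *(1)] chart_open[OF N *(2)]
    by (auto simp: prod_manifold_def *(3) openin_prod_Times_iff)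
  have im: "\<kappa> ` X = \<phi> ` V \<times> \<psi> ` W" by (auto simp: *(3,4) map_prod_def)
  show "open (\<kappa> ` X)"
    unfolding im using chart_image_open[OF M *(1) chart_open[OF M *(1)]]
      chart_image_open[OF N *(2) chart_open[OF N *(2)]] by (simp add: open_Times)
  obtain \<phi>' \<psi>' where "homeomorphic_maps (subtopology (top_of M) V) (top_of_set (\<phi> ` V)) \<phi> \<phi>'"
    "homeomorphic_maps (subtopology (top_of N) W) (top_of_set (\<psi> ` W)) \<psi> \<psi>'"
    using chart_homeomorphic[OF M *(1)] chart_homeomorphic[OF N *(2)] homeomorphic_map_maps by metis
  then have "homeomorphic_maps (prod_topology (subtopology (top_of M) V) (subtopology (top_of N) W))
      (prod_topology (top_of_set (\<phi> ` V)) (top_of_set (\<psi> ` W)))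
      (\<lambda>(x,y). (\<phi> x, \<psi> y)) (\<lambda>(x,y). (\<phi>' x, \<psi>' y))"
    unfolding homeomorphic_maps_prod by blast
  moreover have "(\<lambda>(x,y). (\<phi> x, \<psi> y)) = \<kappa>" by (auto simp: *(4))
  moreover have "prod_topology (top_of_set (\<phi> ` V)) (top_of_set (\<psi> ` W)) = top_of_set (\<phi> ` V \<times> \<psi> ` W)"
    by (simp add: subtopology_Times[symmetric])
  ultimately show "homeomorphic_map (subtopology (top_of (prod_manifold M N)) X) (top_of_set (\<kappa> ` X)) \<kappa>"
    unfolding homeomorphic_map_maps im by (auto simp: prod_manifold_def *(3) subtopology_Times)
next
  fix X \<kappa> Y \<xi> assume X: "(X, \<kappa>) \<in> atlas (prod_manifold M N)" and Y: "(Y, \<xi>) \<in> atlas (prod_manifold M N)"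
  obtain V \<phi> W \<psi> where *: "(V, \<phi>) \<in> atlas M" "(W, \<psi>) \<in> atlas N" "X = V \<times> W" "\<kappa> = map_prod \<phi> \<psi>"
    "\<forall>u\<in>\<kappa> ` X. inv_into X \<kappa> u = (inv_into V \<phi> (fst u), inv_into W \<psi> (snd u))"
    by (rule prod_chartD[OF X])
  obtain V' \<phi>' W' \<psi>' where **: "(V', \<phi>') \<in> atlas M" "(W', \<psi>') \<in> atlas N" "Y = V' \<times> W'" "\<xi> = map_prod \<phi>' \<psi>'"
    "\<forall>u\<in>\<xi> ` Y. inv_into Y \<xi> u = (inv_into V' \<phi>' (fst u), inv_into W' \<psi>' (snd u))"
    by (rule prod_chartD[OF Y])
  let ?A = "\<phi> ` (V \<inter> V')" and ?B = "\<psi> ` (W \<inter> W')"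
  have im: "\<kappa> ` (X \<inter> Y) = ?A \<times> ?B" by (auto simp: *(3,4) **(3) map_prod_def)
  have op: "open ?A" "open ?B"
    using chart_image_open[OF M *(1) chart_open[OF M **(1)]]
      chart_image_open[OF N *(2) chart_open[OF N **(2)]] by auto
  have opp: "open (?A \<times> ?B)" using op by (rule open_Times)
  have "smooth_on (?A \<times> ?B) (\<lambda>u. (\<phi>' (inv_into V \<phi> (fst u)), \<psi>' (inv_into W \<psi> (snd u))))"
  proof (rule smooth_on_Pair[OF opp])
    show "smooth_on (?A \<times> ?B) (\<lambda>u. \<phi>' (inv_into V \<phi> (fst u)))"
      by (rule smooth_on_compose[OF opp op(1) _ smooth_on_bounded_linear[OF opp bounded_linear_fst smooth_on_id]
          chart_transition[OF M *(1) **(1)]]) auto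
    show "smooth_on (?A \<times> ?B) (\<lambda>u. \<psi>' (inv_into W \<psi> (snd u)))"
      by (rule smooth_on_compose[OF opp op(2) _ smooth_on_bounded_linear[OF opp bounded_linear_snd smooth_on_id]
          chart_transition[OF N *(2) **(2)]]) auto
  qed
  moreover have "(\<xi> \<circ> inv_into X \<kappa>) u = (\<phi>' (inv_into V \<phi> (fst u)), \<psi>' (inv_into W \<psi> (snd u)))"
    if "u \<in> ?A \<times> ?B" for u
  proof -
    have "u \<in> \<kappa> ` X" using that by (force simp: *(3,4) map_prod_def)
    with bspec[OF *(5)] show ?thesis by (simp add: **(4))
  qed
  ultimately show "smooth_on (\<kappa> ` (X \<inter> Y)) (\<xi> \<circ> inv_into X \<kappa>)"
    unfolding im by (subst smooth_on_cong[OF opp]) auto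
qed

lemma smooth_map_Pair:
  assumes L: "charted L" and f: "smooth_map L M f" and g: "smooth_map L N g"
  shows "smooth_map L (prod_manifold M N) (\<lambda>x. (f x, g x))"
  unfolding smooth_map_iff
proof (intro conjI ballI, safe)
  show "continuous_map (top_of L) (top_of (prod_manifold M N)) (\<lambda>x. (f x, g x))"
    using smooth_mapD(1)[OF f] smooth_mapD(1)[OF g]
    by (simp add: prod_manifold_def continuous_map_pairedI)
  fix X \<kappa> assume "(X, \<kappa>) \<in> atlas (prod_manifold M N)"
  then obtain V \<phi> W \<psi> where *: "(V, \<phi>) \<in> atlas M" "(W, \<psi>) \<in> atlas N" "X = V \<times> W" "\<kappa> = map_prod \<phi> \<psi>"
    "\<forall>u\<in>\<kappa> ` X. inv_into X \<kappa> u = (inv_into V \<phi> (fst u), inv_into W \<psi> (snd u))"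
    by (rule prod_chartD)
  let ?T = "points L \<inter> (\<lambda>x. (f x, g x)) -` X"
  have "?T = (points L \<inter> f -` V) \<inter> (points L \<inter> g -` W)" by (auto simp: *(3))
  then have T: "openin (top_of L) ?T"
    using smooth_map_preimage_open[OF f chart_open[OF M *(1)]]
      smooth_map_preimage_open[OF g chart_open[OF N *(2)]] by auto
  have fg: "smooth_fun L ?T (\<lambda>x. \<phi> (f x))" "smooth_fun L ?T (\<lambda>x. \<psi> (g x))"
    using smooth_mapD(3)[OF f *(1)] smooth_mapD(3)[OF g *(2)]
    by (auto intro: smooth_fun_subset simp: *(3))
  have "smooth_fun L ?T (\<lambda>x. (\<phi> (f x), \<psi> (g x)))"
    by (rule smooth_funI, rule smooth_on_Pair) (auto intro: chart_image_open[OF L _ T] smooth_funD[OF fg(1)] smooth_funD[OF fg(2)])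
  then show "smooth_fun L ((\<lambda>x. (f x, g x)) -` X) (\<lambda>x. \<kappa> (f x, g x))"
    by (simp add: smooth_fun_Int_points[OF L] *(4))
qed

end

lemma smooth_map_snd_model:
  assumes M: "charted M"
  shows "smooth_fun (prod_manifold M (model_manifold :: ('f::fin_dim_inner, 'f) manifold)) UNIV snd"
proof (rule smooth_funI)
  let ?P = "prod_manifold M (model_manifold :: ('f, 'f) manifold)"
  fix X \<kappa> assume X: "(X, \<kappa>) \<in> atlas ?P"
  obtain V \<phi> W \<psi> where *: "(V, \<phi>) \<in> atlas M" "(W, \<psi>) \<in> atlas (model_manifold :: ('f, 'f) manifold)"
    "X = V \<times> W" "\<kappa> = map_prod \<phi> \<psi>"
    "\<forall>u\<in>\<kappa> ` X. inv_into X \<kappa> u = (inv_into V \<phi> (fst u), inv_into W \<psi> (snd u))"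
    by (rule prod_chartD[OF M charted_model X])
  then have W: "W = UNIV" "\<psi> = id" by (auto simp: model_manifold_def)
  have op: "open (\<kappa> ` (X \<inter> UNIV))"
    using chart_image_open[OF charted_prod[OF M charted_model] X openin_topspace]
      chart_subset[OF charted_prod[OF M charted_model] X] by (simp add: Int_absorb2)
  have "smooth_on (\<kappa> ` (X \<inter> UNIV)) snd"
    by (rule smooth_on_bounded_linear[OF op bounded_linear_snd smooth_on_id])
  then show "smooth_on (\<kappa> ` (X \<inter> UNIV)) (\<lambda>u. snd (inv_into X \<kappa> u))"
    using *(5) W by (subst smooth_on_cong[OF op, of _ snd]) auto
qed

text \<open>In a chart this is the derivative in the fixed direction \<open>(0, b)\<close>. It serves to differentiate
  polynomial functions along the fibres of a trivialized bundle.\<close>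

lemma smooth_fun_partial_derivative:
  fixes g :: "'a \<times> 'f::fin_dim_inner \<Rightarrow> real"
  assumes M: "charted M" and g: "smooth_fun (prod_manifold M (model_manifold :: ('f, 'f) manifold)) UNIV g"
  shows "smooth_fun (prod_manifold M (model_manifold :: ('f, 'f) manifold)) UNIV
    (\<lambda>z. deriv (\<lambda>t. g (fst z, snd z + t *\<^sub>R b)) 0)"
proof (rule smooth_funI)
  let ?P = "prod_manifold M (model_manifold :: ('f, 'f) manifold)"
  fix X \<kappa> assume X: "(X, \<kappa>) \<in> atlas ?P"
  obtain V \<phi> W \<psi> where *: "(V, \<phi>) \<in> atlas M" "(W, \<psi>) \<in> atlas (model_manifold :: ('f, 'f) manifold)"
    "X = V \<times> W" "\<kappa> = map_prod \<phi> \<psi>"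
    "\<forall>u\<in>\<kappa> ` X. inv_into X \<kappa> u = (inv_into V \<phi> (fst u), inv_into W \<psi> (snd u))"
    by (rule prod_chartD[OF M charted_model X])
  then have W: "W = UNIV" "\<psi> = id" by (auto simp: model_manifold_def)
  let ?A = "\<phi> ` V \<times> (UNIV :: 'f set)"
  have im: "\<kappa> ` (X \<inter> UNIV) = ?A" by (auto simp: *(3,4) W map_prod_def)
  have op: "open ?A"
    using chart_image_open[OF M *(1) chart_open[OF M *(1)]] by (simp add: open_Times)
  let ?G = "\<lambda>u. g (inv_into X \<kappa> u)"
  have G: "smooth_on ?A ?G" using smooth_funD[OF g X] im by simp
  have inv: "inv_into X \<kappa> u = (inv_into V \<phi> (fst u), snd u)" if "u \<in> ?A" for u
    using bspec[OF *(5), of u] that im W by auto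
  have "deriv (\<lambda>t. g (fst (inv_into X \<kappa> u), snd (inv_into X \<kappa> u) + t *\<^sub>R b)) 0 =
      frechet_derivative ?G (at u) (0, b)" if u: "u \<in> ?A" for u
  proof -
    have "g (fst (inv_into X \<kappa> u), snd (inv_into X \<kappa> u) + t *\<^sub>R b) = ?G (u + t *\<^sub>R (0, b))" for t
    proof -
      have "u + t *\<^sub>R (0, b) \<in> ?A" using u by auto
      then show ?thesis using inv[OF u] inv[of "u + t *\<^sub>R (0, b)"] by simp
    qed
    moreover have "((\<lambda>t. ?G (u + t *\<^sub>R (0, b))) has_real_derivative frechet_derivative ?G (at u) (0, b)) (at 0)"
    proof -
      have d: "(?G has_derivative frechet_derivative ?G (at u)) (at (u + 0 *\<^sub>R (0, b)))"
        using smooth_on_has_derivative[OF G u] by (simp add: zero_prod_def[symmetric])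
      have "((\<lambda>t::real. u + t *\<^sub>R (0, b)) has_derivative (\<lambda>t. t *\<^sub>R (0, b))) (at 0)"
        by (auto intro!: derivative_eq_intros)
      from has_derivative_compose[OF this d]
      have "((\<lambda>t. ?G (u + t *\<^sub>R (0, b))) has_derivative
          (\<lambda>t. frechet_derivative ?G (at u) (t *\<^sub>R (0, b)))) (at 0)" .
      moreover have "frechet_derivative ?G (at u) (t *\<^sub>R (0, b)) = frechet_derivative ?G (at u) (0, b) * t" for t
        using linear_scale[OF has_derivative_linear[OF smooth_on_has_derivative[OF G u]], of t "(0,b)"]
        by (simp add: mult.commute)
      ultimately show ?thesis by (simp add: has_field_derivative_def)
    qed
    ultimately show ?thesis by (simp add: DERIV_imp_deriv)
  qed
  with smooth_on_frechet_derivative[OF G, of "(0, b)"]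
  show "smooth_on (\<kappa> ` (X \<inter> UNIV)) (\<lambda>u. deriv (\<lambda>t. g (fst (inv_into X \<kappa> u), snd (inv_into X \<kappa> u) + t *\<^sub>R b)) 0)"
    unfolding im by (subst smooth_on_cong[OF op, of _ "\<lambda>u. frechet_derivative ?G (at u) (0, b)"]) auto
qed

section \<open>Smooth functions determine the manifold\<close>

text \<open>A cutoff function of the squared distance from \<open>x\<close> in a chart. Its support is compact, hence
  closed in a Hausdorff space, so that extending by 0 preserves smoothness.\<close>

lemma bump_function_exists:
  assumes M: "smooth_manifold M" and U: "openin (top_of M) U" and x: "x \<in> U"
  obtains g :: "'a \<Rightarrow> real" and K W where "smooth_fun M UNIV g" "compactin (top_of M) K" "K \<subseteq> U"
    "openin (top_of M) W" "x \<in> W" "W \<subseteq> K" "\<forall>y\<in>W. g y = 1" "\<forall>y\<in>points M - K. g y = 0"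
    "\<forall>y. 0 \<le> g y \<and> g y \<le> 1"
proof -
  note cM = smooth_manifold_charted[OF M]
  obtain V \<phi> where V: "(V, \<phi>) \<in> atlas M" "x \<in> V"
    using chart_cover[OF cM] openin_subset[OF U] x by blast
  obtain r where r: "r > 0" "cball (\<phi> x) r \<subseteq> \<phi> ` (V \<inter> U)"
    using chart_image_open[OF cM V(1) U] V(2) x open_contains_cball by (metis IntI imageI)
  obtain s :: "real \<Rightarrow> real" where s: "smooth_on UNIV s" "\<And>t. 0 \<le> s t" "\<And>t. s t \<le> 1"
    "\<And>t. t \<le> 1 \<Longrightarrow> s t = 1" "\<And>t. t \<ge> 2 \<Longrightarrow> s t = 0"
    using smooth_cutoff_exists by blast
  \<comment> \<open>normalised so that \<open>t\<close> reaches 2 on the sphere of radius \<open>r\<close> and is at most 1 on the ball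
    of half the radius\<close>
  define t where "t = (\<lambda>u. (2 / r\<^sup>2) * ((u - \<phi> x) \<bullet> (u - \<phi> x)))"
  define g where "g = (\<lambda>y. if y \<in> V then s (t (\<phi> y)) else 0)"
  define K where "K = inv_into V \<phi> ` cball (\<phi> x) r"
  define W where "W = {y \<in> V. \<phi> y \<in> ball (\<phi> x) (r/2)}"
  have t_norm: "t u = 2 * (norm (u - \<phi> x))\<^sup>2 / r\<^sup>2" for u
    by (simp add: t_def power2_norm_eq_inner)
  have t_far: "t u \<ge> 2" if "u \<notin> cball (\<phi> x) r" for u
  proof -
    have "r \<le> norm (u - \<phi> x)" using that by (simp add: dist_norm norm_minus_commute)
    then have "r\<^sup>2 \<le> (norm (u - \<phi> x))\<^sup>2" using r(1) by (intro power_mono) auto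
    then show ?thesis using r(1) by (simp add: t_norm field_simps)
  qed
  have t_near: "t u \<le> 1" if "u \<in> ball (\<phi> x) (r/2)" for u
  proof -
    have "norm (u - \<phi> x) \<le> r/2" using that by (simp add: dist_norm norm_minus_commute)
    then have "(norm (u - \<phi> x))\<^sup>2 \<le> (r/2)\<^sup>2" by (intro power_mono) auto
    then have "4 * (norm (u - \<phi> x))\<^sup>2 \<le> r\<^sup>2" by (simp add: power_divide)
    moreover have "0 \<le> (norm (u - \<phi> x))\<^sup>2" by simp
    ultimately have "2 * (norm (u - \<phi> x))\<^sup>2 \<le> r\<^sup>2" by linarith
    then show ?thesis using r(1) by (simp add: t_norm)
  qed
  have ball: "cball (\<phi> x) r \<subseteq> \<phi> ` V" using r(2) by blast
  have KV: "K \<subseteq> V \<inter> U"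
    using r(2) chart_inv[OF cM V(1)] by (fastforce simp: K_def)
  have phiK: "\<phi> ` K = cball (\<phi> x) r"
    using ball by (auto simp: K_def image_image f_inv_into_f subset_iff)
  have "compactin (subtopology (top_of M) V) K"
  proof (subst homeomorphic_map_compactness[OF chart_homeomorphic[OF cM V(1)], symmetric])
    show "K \<subseteq> topspace (subtopology (top_of M) V)" using KV chart_subset[OF cM V(1)] by auto
    show "compactin (top_of_set (\<phi> ` V)) (\<phi> ` K)"
      using ball compact_cball_fin_dim by (simp add: phiK compactin_subtopology)
  qed
  then have K: "compactin (top_of M) K" by (simp add: compactin_subtopology)
  have closed: "closedin (top_of M) K"
    using M K by (intro compactin_imp_closedin) (auto simp: smooth_manifold_def)
  have W: "openin (top_of M) W"
    unfolding W_def by (rule chart_preimage_open[OF cM V(1) open_ball])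
  have "W \<subseteq> K"
  proof
    fix y assume "y \<in> W"
    then show "y \<in> K"
      using r(1) chart_inv[OF cM V(1), of y] by (auto simp: W_def K_def intro!: rev_image_eqI[of "\<phi> y"])
  qed
  have zero: "g y = 0" if "y \<in> points M" "y \<notin> K" for y
  proof (cases "y \<in> V")
    case True
    then have "\<phi> y \<notin> cball (\<phi> x) r"
      using that(2) chart_inv[OF cM V(1), of y] by (force simp: K_def)
    then show ?thesis using s(5) t_far by (simp add: g_def)
  qed (simp add: g_def)
  have "smooth_fun M UNIV g"
  proof (rule smooth_fun_extend_zero[OF cM chart_open[OF cM V(1)] closed _ _ zero])
    show "K \<subseteq> V" using KV by blast
    note VV = chart_open[OF cM V(1)]
    have "smooth_fun M V (\<lambda>y. t (\<phi> y))"
      unfolding t_def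
      by (intro smooth_fun_mult[OF cM VV] smooth_fun_inner[OF cM VV] smooth_fun_diff[OF cM VV]
          smooth_fun_const[OF cM] smooth_fun_chart[OF cM V(1)])
    from smooth_fun_smooth_on[OF cM VV this open_UNIV s(1)]
    show "smooth_fun M V g" by (subst smooth_fun_cong[OF cM VV, of g]) (auto simp: g_def)
  qed auto
  moreover have "\<forall>y\<in>W. g y = 1" using t_near s(4) by (auto simp: W_def g_def)
  ultimately show ?thesis
    using K KV W V(2) r(1) \<open>W \<subseteq> K\<close> zero s(2,3) by (intro that[of g K W]) (auto simp: W_def g_def)
qed

lemma smooth_functions_separate_points:
  assumes M: "smooth_manifold M" and "x \<in> points M" "y \<in> points M" "x \<noteq> y"
  obtains g :: "'a \<Rightarrow> real" where "smooth_fun M UNIV g" "g x \<noteq> g y"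
proof -
  have "closedin (top_of M) {y}"
    using M assms(3) by (simp add: smooth_manifold_def closedin_Hausdorff_singleton)
  then have "openin (top_of M) (points M - {y})" by blast
  moreover have "x \<in> points M - {y}" using assms by blast
  ultimately obtain g :: "'a \<Rightarrow> real" and K W where g: "smooth_fun M UNIV g" "K \<subseteq> points M - {y}"
    "x \<in> W" "\<forall>y\<in>W. g y = 1" "\<forall>y\<in>points M - K. g y = 0"
    by (rule bump_function_exists[OF M])
  then have "g x = 1" "g y = 0" using assms by auto
  with g(1) that show ?thesis by simp
qed

text \<open>Bump functions \<open>b n\<close> equal to 1 on sets \<open>W n\<close> that cover the manifold give a partition of
  unity \<open>\<psi> n = b n * (\<Prod>k<n. 1 - b k)\<close>: on \<open>W k\<close> only the first terms survive, so that
  sums over \<open>n\<close> are locally finite. The sum of \<open>n * \<psi> n\<close> is large off the first few supports.\<close>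

lemma smooth_exhaustion_exists:
  assumes M: "smooth_manifold M"
  obtains \<rho> :: "'a \<Rightarrow> real" where "smooth_fun M UNIV \<rho>"
    "\<forall>c. \<exists>K. compactin (top_of M) K \<and> (\<forall>x\<in>points M - K. \<rho> x > c)"
proof (cases "points M = {}")
  case True
  have "smooth_fun M UNIV (\<lambda>x. 0 :: real)" by (rule smooth_fun_const[OF smooth_manifold_charted[OF M]])
  moreover have "compactin (top_of M) {}" by simp
  ultimately show ?thesis using True that[of "\<lambda>x. 0"] by auto
next
  case False
  note cM = smooth_manifold_charted[OF M]
  define good :: "'a set \<Rightarrow> ('a \<Rightarrow> real) \<Rightarrow> 'a set \<Rightarrow> bool" where
    "good = (\<lambda>W g K. openin (top_of M) W \<and> smooth_fun M UNIV g \<and> compactin (top_of M) K \<and>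
      (\<forall>y\<in>W. g y = 1) \<and> (\<forall>y\<in>points M - K. g y = 0) \<and> (\<forall>y. 0 \<le> g y \<and> g y \<le> 1))"
  let ?C = "{W. \<exists>g K. good W g K}"
  have cover: "\<exists>W\<in>?C. x \<in> W" if x: "x \<in> points M" for x
  proof -
    obtain g :: "'a \<Rightarrow> real" and K W where "smooth_fun M UNIV g" "compactin (top_of M) K" "K \<subseteq> points M"
      "openin (top_of M) W" "x \<in> W" "W \<subseteq> K" "\<forall>y\<in>W. g y = 1" "\<forall>y\<in>points M - K. g y = 0"
      "\<forall>y. 0 \<le> g y \<and> g y \<le> 1"
      by (rule bump_function_exists[OF M openin_topspace x])
    then have "good W g K" unfolding good_def by blast
    then show ?thesis using \<open>x \<in> W\<close> by blast
  qed
  have op: "openin (top_of M) W" if "W \<in> ?C" for W using that by (auto simp: good_def)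
  have un: "\<Union>?C = points M"
  proof (intro equalityI subsetI)
    fix x assume "x \<in> \<Union>?C"
    then obtain W where "W \<in> ?C" "x \<in> W" by (rule UnionE)
    then show "x \<in> points M" using openin_subset[OF op] by (meson subsetD)
  next
    fix x assume "x \<in> points M"
    from cover[OF this] show "x \<in> \<Union>?C" by (simp only: Union_iff)
  qed
  have "Lindelof_space (top_of M)"
    using M by (simp add: smooth_manifold_def second_countable_imp_Lindelof_space)
  then have "\<exists>D. countable D \<and> D \<subseteq> ?C \<and> \<Union>D = points M"
    by (rule Lindelof_spaceD) (use op un in auto)
  then obtain D where D: "countable D" "D \<subseteq> ?C" "\<Union>D = points M" by (elim exE conjE) (rule that)
  have ne: "D \<noteq> {}" using D(3) False by blast
  define W where "W = from_nat_into D"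
  have "W n \<in> ?C" for n using from_nat_into[OF ne, of n] D(2) by (auto simp: W_def)
  then have "\<exists>g K. good (W n) g K" for n by blast
  then obtain b K where gd: "\<And>n. good (W n) (b n) (K n)" by metis
  have b: "openin (top_of M) (W n)" "smooth_fun M UNIV (b n)" "compactin (top_of M) (K n)"
    "y \<in> W n \<Longrightarrow> b n y = 1" "y \<in> points M \<Longrightarrow> y \<notin> K n \<Longrightarrow> b n y = 0" "0 \<le> b n y" "b n y \<le> 1" for n y
    using gd[of n] unfolding good_def by auto
  have Wcover: "\<exists>n. x \<in> W n" if "x \<in> points M" for x
    using that D(3) from_nat_into_surj[OF D(1)] by (metis UnionE W_def)
  define \<psi> where "\<psi> = (\<lambda>n x. b n x * (\<Prod>k<n. 1 - b k x))"
  have \<psi>_sum: "(\<Sum>n<m. \<psi> n x) = 1 - (\<Prod>k<m. 1 - b k x)" for m x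
    by (induction m) (auto simp: \<psi>_def algebra_simps)
  have \<psi>_nonneg: "0 \<le> \<psi> n x" for n x
    using b(6,7) by (auto simp: \<psi>_def intro!: mult_nonneg_nonneg prod_nonneg)
  have \<psi>_zero: "\<psi> n x = 0" if "x \<in> W k" "k < n" for n k x
  proof -
    have "(\<Prod>k<n. 1 - b k x) = 0" using that b(4) by (intro prod_zero) auto
    then show ?thesis by (simp add: \<psi>_def)
  qed
  \<comment> \<open>the sum stops after the first index whose \<open>W k\<close> contains the point, where the remaining terms vanish\<close>
  define L where "L = (\<lambda>x. Suc (LEAST k. x \<in> W k))"
  define \<rho> where "\<rho> = (\<lambda>x. \<Sum>n<L x. real n * \<psi> n x)"
  have \<rho>_eq: "\<rho> x = (\<Sum>n<Suc k. real n * \<psi> n x)" if x: "x \<in> W k" for x k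
  proof -
    have "(LEAST k. x \<in> W k) \<le> k" "x \<in> W (LEAST k. x \<in> W k)" using x by (auto intro: Least_le LeastI)
    then show ?thesis unfolding \<rho>_def L_def
      using \<psi>_zero by (intro sum.mono_neutral_left) auto
  qed
  have \<psi>_smooth: "smooth_fun M (W k) (\<psi> n)" for k n
    unfolding \<psi>_def
    by (intro smooth_fun_mult[OF cM b(1)] smooth_fun_prod[OF cM b(1)] smooth_fun_diff[OF cM b(1)]
        smooth_fun_const[OF cM] smooth_fun_subset[OF b(2)]) auto
  have "smooth_fun M UNIV \<rho>"
  proof (rule smooth_fun_local[OF cM])
    fix x assume "x \<in> points M"
    then obtain k where k: "x \<in> W k" using Wcover by blast
    have "smooth_fun M (W k) (\<lambda>x. \<Sum>n<Suc k. real n * \<psi> n x)"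
      by (intro smooth_fun_sum[OF cM b(1)] smooth_fun_mult[OF cM b(1)] smooth_fun_const[OF cM] \<psi>_smooth)
    then have "smooth_fun M (W k) \<rho>"
      using \<rho>_eq by (subst smooth_fun_cong[OF cM b(1)]) auto
    then show "\<exists>T. openin (top_of M) T \<and> x \<in> T \<and> smooth_fun M T \<rho>" using k b(1) by blast
  qed
  moreover have "\<exists>K. compactin (top_of M) K \<and> (\<forall>x\<in>points M - K. \<rho> x > c)" for c
  proof -
    obtain m :: nat where m: "c < real m" using reals_Archimedean2 by blast
    have "\<rho> x > c" if x: "x \<in> points M" "x \<notin> (\<Union>n\<le>m. K n)" for x
    proof -
      obtain k where k: "x \<in> W k" using Wcover x(1) by blast
      have "\<psi> n x = 0" if "n \<le> m" for n using b(5)[of x n] x that by (auto simp: \<psi>_def)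
      then have "real m * \<psi> n x \<le> real n * \<psi> n x" for n
        using \<psi>_nonneg[of n x] by (cases "n \<le> m") (auto intro: mult_right_mono)
      then have "(\<Sum>n<Suc k. real m * \<psi> n x) \<le> \<rho> x" unfolding \<rho>_eq[OF k] by (rule sum_mono)
      also have "(\<Sum>n<Suc k. real m * \<psi> n x) = real m * (1 - (\<Prod>j<Suc k. 1 - b j x))"
        by (simp only: sum_distrib_left[symmetric] \<psi>_sum)
      also have "(\<Prod>j<Suc k. 1 - b j x) = 0" using b(4)[OF k] by (intro prod_zero) auto
      finally show ?thesis using m by simp
    qed
    moreover have "compactin (top_of M) (\<Union>n\<le>m. K n)"
      using b(3) by (intro compactin_Union) auto
    ultimately show ?thesis by (intro exI[of _ "\<Union>n\<le>m. K n"]) blast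
  qed
  ultimately show ?thesis by (intro that) blast+
qed

text \<open>Milnor's exercise. If a character \<open>c\<close> were no evaluation, then the functions
  \<open>f - c f\<close> would have no common zero. A finite number of them, one being an exhaustion function,
  already has none, and the sum of their squares would be a unit in the kernel of \<open>c\<close>.\<close>

lemma character_is_evaluation:
  fixes M :: "('a, 'm::fin_dim_inner) manifold" and c :: "('a \<Rightarrow> real) \<Rightarrow> real"
  assumes M: "smooth_manifold M"
    and add: "\<And>f g. smooth_fun M UNIV f \<Longrightarrow> smooth_fun M UNIV g \<Longrightarrow> c (\<lambda>x. f x + g x) = c f + c g"
    and mult: "\<And>f g. smooth_fun M UNIV f \<Longrightarrow> smooth_fun M UNIV g \<Longrightarrow> c (\<lambda>x. f x * g x) = c f * c g"
    and const: "\<And>t. c (\<lambda>x. t) = t"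
    and cong: "\<And>f g. (\<And>x. x \<in> points M \<Longrightarrow> f x = g x) \<Longrightarrow> c f = c g"
  shows "\<exists>x\<in>points M. \<forall>f. smooth_fun M UNIV f \<longrightarrow> c f = f x"
proof (rule ccontr)
  note cM = smooth_manifold_charted[OF M]
  note intros = smooth_fun_mult_UNIV[OF cM] smooth_fun_add_UNIV[OF cM] smooth_fun_sum_UNIV[OF cM]
    smooth_fun_const[OF cM]
  assume "\<not> (\<exists>x\<in>points M. \<forall>f. smooth_fun M UNIV f \<longrightarrow> c f = f x)"
  then have "\<forall>x\<in>points M. \<exists>f. smooth_fun M UNIV f \<and> c f \<noteq> f x" by blast
  then obtain F where F: "\<And>x. x \<in> points M \<Longrightarrow> smooth_fun M UNIV (F x)"
    "\<And>x. x \<in> points M \<Longrightarrow> c (F x) \<noteq> F x x" by metis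
  obtain \<rho> :: "'a \<Rightarrow> real" where \<rho>: "smooth_fun M UNIV \<rho>"
    "\<forall>c. \<exists>K. compactin (top_of M) K \<and> (\<forall>x\<in>points M - K. \<rho> x > c)"
    by (rule smooth_exhaustion_exists[OF M])
  obtain K where K: "compactin (top_of M) K" "\<forall>x\<in>points M - K. \<rho> x > c \<rho>" using \<rho>(2) by blast
  define O' where "O' = (\<lambda>x. {y \<in> points M. F x y \<in> - {c (F x)}})"
  have "openin (top_of M) (O' x)" if "x \<in> points M" for x
    unfolding O'_def using F(1)[OF that]
    by (intro smooth_fun_preimage_open[OF cM openin_topspace]) (auto simp: smooth_fun_points[OF cM])
  moreover have "K \<subseteq> \<Union> (O' ` points M)"
    using compactin_subset_topspace[OF K(1)] F(2) by (fastforce simp: O'_def)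
  ultimately obtain \<F> where "finite \<F>" "\<F> \<subseteq> O' ` points M" "K \<subseteq> \<Union>\<F>"
    using compactinD[OF K(1), of "O' ` points M"] by blast
  then obtain X where X: "finite X" "X \<subseteq> points M" "K \<subseteq> \<Union> (O' ` X)"
    by (metis finite_subset_image)
  define S where "S = insert \<rho> (F ` X)"
  have S: "finite S" "\<And>f. f \<in> S \<Longrightarrow> smooth_fun M UNIV f" using X F(1) \<rho>(1) by (auto simp: S_def)
  define sq where "sq = (\<lambda>f x. (f x + - c f) * (f x + - c f))"
  have sq: "smooth_fun M UNIV (sq f)" "c (sq f) = 0" if "smooth_fun M UNIV f" for f
  proof -
    have l: "smooth_fun M UNIV (\<lambda>x. f x + - c f)" by (intro intros that)
    show "smooth_fun M UNIV (sq f)" unfolding sq_def by (rule smooth_fun_mult_UNIV[OF cM l l])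
    have "c (\<lambda>x. f x + - c f) = 0" using add[OF that smooth_fun_const[OF cM], of "- c f"] const by simp
    then show "c (sq f) = 0" using mult[OF l l] by (simp add: sq_def)
  qed
  define G where "G = (\<lambda>x. \<Sum>f\<in>S. sq f x)"
  have G: "smooth_fun M UNIV G" unfolding G_def using S by (intro intros sq) auto
  have "smooth_fun M UNIV (\<lambda>x. \<Sum>f\<in>T. sq f x) \<and> c (\<lambda>x. \<Sum>f\<in>T. sq f x) = 0" if "T \<subseteq> S" for T
  proof -
    have "finite T" using that S(1) finite_subset by blast
    then show ?thesis using that
    proof (induction T rule: finite_induct)
      case (insert f T)
      then have "smooth_fun M UNIV f" using S by blast
      with insert show ?case using add[OF sq(1)[of f], of "\<lambda>x. \<Sum>f\<in>T. sq f x"] sq[of f]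
        by (auto intro: intros)
    qed (use const[of 0] in \<open>auto intro: intros\<close>)
  qed
  then have cG: "c G = 0" unfolding G_def by blast
  have nz: "G x \<noteq> 0" if x: "x \<in> points M" for x
  proof
    assume "G x = 0"
    then have "sq f x = 0" if "f \<in> S" for f
      using that S(1) unfolding G_def by (subst (asm) sum_nonneg_eq_0_iff) (auto simp: sq_def)
    then have *: "f x = c f" if "f \<in> S" for f using that by (fastforce simp: sq_def)
    show False
    proof (cases "x \<in> K")
      case True
      then obtain y where "y \<in> X" "x \<in> O' y" using X(3) by blast
      then show False using *[of "F y"] by (simp add: S_def O'_def)
    next
      case False
      then have "c \<rho> < \<rho> x" using K(2) x by blast
      then show False using *[of \<rho>] by (simp add: S_def)
    qed
  qed
  have "smooth_fun M UNIV (\<lambda>x. inverse (G x))"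
    using smooth_fun_inverse[OF cM openin_topspace, of G] G nz by (simp add: smooth_fun_points[OF cM])
  from mult[OF G this] have "c (\<lambda>x. G x * inverse (G x)) = 0" using cG by simp
  moreover have "c (\<lambda>x. G x * inverse (G x)) = c (\<lambda>x. 1)" by (rule cong) (simp add: nz)
  ultimately show False using const[of 1] by simp
qed

text \<open>Bump functions around \<open>f y\<close> reduce both continuity and smoothness of chart coordinates near
  \<open>y\<close> to the pullbacks of global functions.\<close>

lemma smooth_map_if_pulls_back_smooth_functions:
  assumes M: "smooth_manifold M" and N: "charted N" and f: "f ` points N \<subseteq> points M"
    and pull: "\<And>g :: 'a \<Rightarrow> real. smooth_fun M UNIV g \<Longrightarrow> smooth_fun N UNIV (\<lambda>y. g (f y))"
  shows "smooth_map N M f"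
proof -
  note cM = smooth_manifold_charted[OF M]
  have nbhd: "\<exists>T (g :: 'a \<Rightarrow> real) K W. openin (top_of N) T \<and> y \<in> T \<and> smooth_fun M UNIV g \<and> closedin (top_of M) K \<and>
      K \<subseteq> O' \<and> (\<forall>x\<in>W. g x = 1) \<and> (\<forall>x\<in>points M - K. g x = 0) \<and> f ` T \<subseteq> W \<and> openin (top_of M) W \<and> W \<subseteq> O'"
    if O': "openin (top_of M) O'" "y \<in> points N" "f y \<in> O'" for O' y
  proof -
    obtain g :: "'a \<Rightarrow> real" and K W where g: "smooth_fun M UNIV g" "compactin (top_of M) K" "K \<subseteq> O'"
      "openin (top_of M) W" "f y \<in> W" "W \<subseteq> K" "\<forall>y\<in>W. g y = 1" "\<forall>y\<in>points M - K. g y = 0"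
      "\<forall>y. 0 \<le> g y \<and> g y \<le> 1"
      by (rule bump_function_exists[OF M O'(1,3)])
    obtain g' :: "'a \<Rightarrow> real" and K' W' where g': "smooth_fun M UNIV g'" "compactin (top_of M) K'" "K' \<subseteq> W"
      "openin (top_of M) W'" "f y \<in> W'" "W' \<subseteq> K'" "\<forall>y\<in>W'. g' y = 1" "\<forall>y\<in>points M - K'. g' y = 0"
      "\<forall>y. 0 \<le> g' y \<and> g' y \<le> 1"
      by (rule bump_function_exists[OF M g(4,5)])
    have "smooth_fun N (points N) (\<lambda>y. g' (f y))"
      using pull[OF g'(1)] by (rule smooth_fun_subset) simp
    from smooth_fun_preimage_open[OF N openin_topspace this, of "{0<..}"]
    have T: "openin (top_of N) {z \<in> points N. g' (f z) \<in> {0<..}}" by simp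
    have "f ` {z \<in> points N. g' (f z) \<in> {0<..}} \<subseteq> W"
    proof (rule image_subsetI)
      fix z assume "z \<in> {z \<in> points N. g' (f z) \<in> {0<..}}"
      then have z: "z \<in> points N" "g' (f z) \<in> {0<..}" by auto
      then have "f z \<in> points M" using f by blast
      then show "f z \<in> W" using z g'(3,8) by force
    qed
    moreover have "y \<in> {z \<in> points N. g' (f z) \<in> {0<..}}" using O' g'(5,7) by simp
    moreover have "closedin (top_of M) K"
      using M g(2) by (intro compactin_imp_closedin) (auto simp: smooth_manifold_def)
    moreover have "W \<subseteq> O'" using g by blast
    ultimately show ?thesis using T g
      by (intro exI[of _ "{z \<in> points N. g' (f z) \<in> {0<..}}"] exI[of _ g] exI[of _ K] exI[of _ W]) simp
  qed
  show ?thesis unfolding smooth_map_iff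
  proof (intro conjI ballI, safe)
    show "continuous_map (top_of N) (top_of M) f"
      unfolding continuous_map
    proof (intro conjI allI impI f)
      fix O' assume O': "openin (top_of M) O'"
      show "openin (top_of N) {x \<in> points N. f x \<in> O'}"
      proof (subst openin_subopen, intro ballI)
        fix y assume "y \<in> {x \<in> points N. f x \<in> O'}"
        then obtain T where "openin (top_of N) T" "y \<in> T" "f ` T \<subseteq> O'"
          using nbhd[OF O', of y] by blast
        then show "\<exists>T. openin (top_of N) T \<and> y \<in> T \<and> T \<subseteq> {x \<in> points N. f x \<in> O'}"
          using openin_subset by (intro exI[of _ T]) blast
      qed
    qed
  next
    fix V \<phi> assume V: "(V, \<phi>) \<in> atlas M"
    show "smooth_fun N (f -` V) (\<lambda>y. \<phi> (f y))"
    proof (rule smooth_fun_local[OF N])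
      fix y assume y: "y \<in> points N" "y \<in> f -` V"
      then obtain T g K W where T: "openin (top_of N) T" "y \<in> T" and g: "smooth_fun M UNIV (g :: 'a \<Rightarrow> real)"
        "closedin (top_of M) K" "K \<subseteq> V" "\<forall>x\<in>W. g x = 1" "\<forall>x\<in>points M - K. g x = 0"
        "f ` T \<subseteq> W" "openin (top_of M) W" "W \<subseteq> V"
        using nbhd[OF chart_open[OF cM V], of y] by auto
      have "smooth_fun N T (\<lambda>y. g (f y) * (\<phi> (f y) \<bullet> b))" for b
      proof -
        have "smooth_fun M UNIV (\<lambda>x. g x * (\<phi> x \<bullet> b))"
        proof (rule smooth_fun_extend_zero[OF cM chart_open[OF cM V] g(2,3)])
          show "smooth_fun M V (\<lambda>x. g x * (\<phi> x \<bullet> b))"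
            by (intro smooth_fun_mult[OF cM chart_open[OF cM V]] smooth_fun_inner[OF cM chart_open[OF cM V]]
                smooth_fun_chart[OF cM V] smooth_fun_const[OF cM] smooth_fun_subset[OF g(1)]) simp
        qed (use g(5) in auto)
        from pull[OF this] show ?thesis by (rule smooth_fun_subset) simp
      qed
      then have sm: "smooth_fun N T (\<lambda>y. \<Sum>b\<in>onb. (g (f y) * (\<phi> (f y) \<bullet> b)) *\<^sub>R b)"
        by (intro smooth_fun_sum[OF N T(1)] smooth_fun_scaleR[OF N T(1)] smooth_fun_const[OF N])
      have eq: "\<phi> (f y) = (\<Sum>b\<in>onb. (g (f y) * (\<phi> (f y) \<bullet> b)) *\<^sub>R b)" if "y \<in> T" for y
      proof -
        have "\<phi> (f y) = (\<Sum>b\<in>onb. (\<phi> (f y) \<bullet> b) *\<^sub>R b)" by (rule onb_representation)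
        moreover have "g (f y) = 1" using that g by auto
        ultimately show ?thesis by simp
      qed
      have "smooth_fun N T (\<lambda>y. \<phi> (f y))"
        by (rule iffD2[OF smooth_fun_cong[OF N T(1) eq] sm])
      then show "\<exists>T. openin (top_of N) T \<and> y \<in> T \<and> smooth_fun N T (\<lambda>y. \<phi> (f y))"
        using T by blast
    qed
  qed
qed

section \<open>Polynomial functions on vector spaces\<close>

lemma homogeneous_polynomial_cong:
  "homogeneous_polynomial V k p \<Longrightarrow> (\<And>v. v \<in> carrier V \<Longrightarrow> p v = q v) \<Longrightarrow> homogeneous_polynomial V k q"
  unfolding homogeneous_polynomial_def by simp

lemma homogeneous_polynomial_const: "homogeneous_polynomial V 0 (\<lambda>v. a)"
  unfolding homogeneous_polynomial_def
  by (intro exI[of _ "1::nat"] exI[of _ "\<lambda>j. a"]) simp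

lemma homogeneous_polynomial_zero: "homogeneous_polynomial V k (\<lambda>v. 0)"
  unfolding homogeneous_polynomial_def by (intro exI[of _ "0::nat"]) simp

lemma homogeneous_polynomial_add:
  assumes "homogeneous_polynomial V k p" "homogeneous_polynomial V k q"
  shows "homogeneous_polynomial V k (\<lambda>v. p v + q v)"
proof -
  obtain m c l where p: "\<forall>j<m. \<forall>i<k. linear_functional V (l j i)"
    "\<forall>v\<in>carrier V. p v = (\<Sum>j<m::nat. c j * (\<Prod>i<k. l j i v))"
    using assms(1) unfolding homogeneous_polynomial_def by blast
  obtain m' c' l' where q: "\<forall>j<m'. \<forall>i<k. linear_functional V (l' j i)"
    "\<forall>v\<in>carrier V. q v = (\<Sum>j<m'::nat. c' j * (\<Prod>i<k. l' j i v))"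
    using assms(2) unfolding homogeneous_polynomial_def by blast
  define C where "C = (\<lambda>j. if j < m then c j else c' (j - m))"
  define K where "K = (\<lambda>j. if j < m then l j else l' (j - m))"
  have split: "(\<Sum>j<m + m'. f j) = (\<Sum>j<m. f j) + (\<Sum>j<m'. f (j + m))" for f :: "nat \<Rightarrow> real"
    by (induction m') (simp_all add: add.commute add.left_commute)
  have "p v + q v = (\<Sum>j<m + m'. C j * (\<Prod>i<k. K j i v))" if "v \<in> carrier V" for v
    using p(2) q(2) that by (simp add: split C_def K_def)
  moreover have "\<forall>j<m + m'. \<forall>i<k. linear_functional V (K j i)"
    using p(1) q(1) by (auto simp: K_def)
  ultimately show ?thesis unfolding homogeneous_polynomial_def by blast
qed

lemma homogeneous_polynomial_mult_linear:
  assumes "linear_functional V f" "homogeneous_polynomial V k p"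
  shows "homogeneous_polynomial V (Suc k) (\<lambda>v. f v * p v)"
proof -
  obtain m c l where p: "\<forall>j<m. \<forall>i<k. linear_functional V (l j i)"
    "\<forall>v\<in>carrier V. p v = (\<Sum>j<m::nat. c j * (\<Prod>i<k. l j i v))"
    using assms(2) unfolding homogeneous_polynomial_def by blast
  define K where "K = (\<lambda>j i. if i = k then f else l j i)"
  have "(\<Prod>i<k. K j i v) = (\<Prod>i<k. l j i v)" for j v
    by (rule prod.cong) (auto simp: K_def)
  then have "f v * p v = (\<Sum>j<m. c j * (\<Prod>i<Suc k. K j i v))" if "v \<in> carrier V" for v
    using p(2) that by (simp add: sum_distrib_left K_def mult.commute mult.left_commute)
  moreover have "\<forall>j<m. \<forall>i<Suc k. linear_functional V (K j i)"
    using p(1) assms(1) by (auto simp: K_def less_Suc_eq)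
  ultimately show ?thesis unfolding homogeneous_polynomial_def by blast
qed

text \<open>Closure properties in place of the representation as a sum of products of linear functionals.\<close>

lemma homogeneous_polynomial_induct [consumes 1, case_names const zero add mult cong]:
  assumes p: "homogeneous_polynomial V k p"
    and const: "\<And>a. Q 0 (\<lambda>v. a)"
    and zero: "\<And>k. Q k (\<lambda>v. 0)"
    and add: "\<And>k p q. Q k p \<Longrightarrow> Q k q \<Longrightarrow> Q k (\<lambda>v. p v + q v)"
    and mult: "\<And>k l p. linear_functional V l \<Longrightarrow> Q k p \<Longrightarrow> Q (Suc k) (\<lambda>v. l v * p v)"
    and cong: "\<And>k p q. Q k p \<Longrightarrow> (\<And>v. v \<in> carrier V \<Longrightarrow> p v = q v) \<Longrightarrow> Q k q"
  shows "Q k p"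
proof -
  have mono: "Q k (\<lambda>v. c * (\<Prod>i<k. l i v))" if "\<forall>i<k. linear_functional V (l i)" for c l k
    using that
  proof (induction k)
    case (Suc k)
    then have "Q (Suc k) (\<lambda>v. l k v * (c * (\<Prod>i<k. l i v)))" by (intro mult) auto
    then show ?case by (rule cong) (simp add: mult.commute mult.left_commute)
  qed (simp add: const)
  obtain m c l where p: "\<forall>j<m. \<forall>i<k. linear_functional V (l j i)"
    "\<forall>v\<in>carrier V. p v = (\<Sum>j<m::nat. c j * (\<Prod>i<k. l j i v))"
    using p unfolding homogeneous_polynomial_def by blast
  have "Q k (\<lambda>v. \<Sum>j<m. c j * (\<Prod>i<k. l j i v))" using p(1)
  proof (induction m)
    case (Suc m)
    then have "Q k (\<lambda>v. (\<Sum>j<m. c j * (\<Prod>i<k. l j i v)) + c m * (\<Prod>i<k. l m i v))"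
      by (intro add mono) auto
    then show ?case by simp
  qed (simp add: zero)
  then show ?thesis by (rule cong) (use p(2) in auto)
qed

lemma homogeneous_polynomial_mult:
  assumes "homogeneous_polynomial V k p" "homogeneous_polynomial V n q"
  shows "homogeneous_polynomial V (k + n) (\<lambda>v. p v * q v)"
proof -
  have scale: "homogeneous_polynomial V n (\<lambda>v. a * q v)" for a
  proof -
    obtain m c l where q: "\<forall>j<m. \<forall>i<n. linear_functional V (l j i)"
      "\<forall>v\<in>carrier V. q v = (\<Sum>j<m::nat. c j * (\<Prod>i<n. l j i v))"
      using assms(2) unfolding homogeneous_polynomial_def by blast
    have "\<forall>v\<in>carrier V. a * q v = (\<Sum>j<m. (a * c j) * (\<Prod>i<n. l j i v))"
      using q(2) by (simp add: sum_distrib_left mult.assoc)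
    with q(1) show ?thesis
      unfolding homogeneous_polynomial_def by (intro exI[of _ m] exI[of _ "\<lambda>j. a * c j"] exI[of _ l]) simp
  qed
  show ?thesis using assms(1)
  proof (induction rule: homogeneous_polynomial_induct)
    case (const a)
    then show ?case using scale by simp
  next
    case (zero k)
    then show ?case using homogeneous_polynomial_zero by simp
  next
    case (add k p p')
    then show ?case using homogeneous_polynomial_add by (fastforce simp: distrib_right)
  next
    case (mult k l p)
    then show ?case using homogeneous_polynomial_mult_linear[OF mult(1,2)] by (simp add: mult.assoc)
  next
    case (cong k p p')
    show ?case using cong(1) by (rule homogeneous_polynomial_cong) (simp add: cong(2))
  qed
qed

lemma homogeneous_polynomial_scale:
  "homogeneous_polynomial V k p \<Longrightarrow> homogeneous_polynomial V k (\<lambda>v. a * p v)"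
  using homogeneous_polynomial_mult[OF homogeneous_polynomial_const[of V a]] by simp

lemma homogeneous_polynomial_0_iff:
  "homogeneous_polynomial V 0 p \<longleftrightarrow> (\<exists>a. \<forall>v\<in>carrier V. p v = a)"
proof
  assume "homogeneous_polynomial V 0 p"
  then show "\<exists>a. \<forall>v\<in>carrier V. p v = a" unfolding homogeneous_polynomial_def by auto
next
  assume "\<exists>a. \<forall>v\<in>carrier V. p v = a"
  then obtain a where "\<And>v. v \<in> carrier V \<Longrightarrow> p v = a" by blast
  then show "homogeneous_polynomial V 0 p"
    by (intro homogeneous_polynomial_cong[OF homogeneous_polynomial_const[of V a]]) simp
qed

lemma homogeneous_polynomial_linear:
  "linear_functional V l \<Longrightarrow> homogeneous_polynomial V 1 l"
  using homogeneous_polynomial_mult_linear[OF _ homogeneous_polynomial_const[of V 1]] by simp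

lemma linear_functional_if_homogeneous_1:
  assumes "homogeneous_polynomial V 1 p"
    "\<And>u v. u \<in> carrier V \<Longrightarrow> v \<in> carrier V \<Longrightarrow> u \<oplus>\<^bsub>V\<^esub> v \<in> carrier V"
    "\<And>c u. u \<in> carrier V \<Longrightarrow> c \<odot>\<^bsub>V\<^esub> u \<in> carrier V"
  shows "linear_functional V p"
proof -
  obtain m c l where p: "\<forall>j<m. linear_functional V (l j (0::nat))"
    "\<forall>v\<in>carrier V. p v = (\<Sum>j<m::nat. c j * l j 0 v)"
    using assms(1) unfolding homogeneous_polynomial_def by auto
  then show ?thesis
    using assms(2,3) unfolding linear_functional_def
    by (auto simp: sum.distrib[symmetric] sum_distrib_left algebra_simps intro!: sum.cong)
qed

lemma homogeneous_polynomial_smult: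
  assumes "homogeneous_polynomial V k p" "v \<in> carrier V" "t \<odot>\<^bsub>V\<^esub> v \<in> carrier V"
  shows "p (t \<odot>\<^bsub>V\<^esub> v) = t ^ k * p v"
  using assms
  by (induction rule: homogeneous_polynomial_induct)
    (auto simp: linear_functional_def algebra_simps)

lemma homogeneous_polynomial_pullback:
  assumes "homogeneous_polynomial V k p" "\<And>w. w \<in> carrier W \<Longrightarrow> G w \<in> carrier V"
    "\<And>u w. u \<in> carrier W \<Longrightarrow> w \<in> carrier W \<Longrightarrow> G (u \<oplus>\<^bsub>W\<^esub> w) = G u \<oplus>\<^bsub>V\<^esub> G w"
    "\<And>c w. w \<in> carrier W \<Longrightarrow> G (c \<odot>\<^bsub>W\<^esub> w) = c \<odot>\<^bsub>V\<^esub> G w"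
  shows "homogeneous_polynomial W k (\<lambda>w. p (G w))"
  using assms(1)
proof (induction rule: homogeneous_polynomial_induct)
  case (const a)
  show ?case by (rule homogeneous_polynomial_const)
next
  case (zero k)
  show ?case by (rule homogeneous_polynomial_zero)
next
  case (add k p q)
  then show ?case by (rule homogeneous_polynomial_add)
next
  case (mult k l p)
  from mult(1) have "linear_functional W (\<lambda>w. l (G w))"
    using assms(2-4) by (simp add: linear_functional_def)
  then show ?case using mult(2) by (rule homogeneous_polynomial_mult_linear)
next
  case (cong k p q)
  show ?case using cong(1) by (rule homogeneous_polynomial_cong) (simp add: cong(2) assms(2))
qed

context
  fixes V :: "(real, 'v) module"
  assumes add_closed: "\<And>u v. u \<in> carrier V \<Longrightarrow> v \<in> carrier V \<Longrightarrow> u \<oplus>\<^bsub>V\<^esub> v \<in> carrier V"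
    and smult_closed: "\<And>c u. u \<in> carrier V \<Longrightarrow> c \<odot>\<^bsub>V\<^esub> u \<in> carrier V"
begin

lemma homogeneous_polynomial_add_smult_0:
  assumes "homogeneous_polynomial V k p" "u \<in> carrier V" "v \<in> carrier V"
  shows "p (v \<oplus>\<^bsub>V\<^esub> (0 \<odot>\<^bsub>V\<^esub> u)) = p v"
  using assms(1)
proof (induction rule: homogeneous_polynomial_induct)
  case (mult k l p)
  then show ?case using assms(2,3) smult_closed by (simp add: linear_functional_def)
next
  case (cong k p q)
  then show ?case using assms(2,3) smult_closed add_closed by simp
qed auto

lemma linear_functional_derivative:
  assumes "linear_functional V l" "u \<in> carrier V" "v \<in> carrier V"
  shows "((\<lambda>t. l (v \<oplus>\<^bsub>V\<^esub> (t \<odot>\<^bsub>V\<^esub> u))) has_real_derivative l u) (at 0)"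
proof -
  have "l (v \<oplus>\<^bsub>V\<^esub> (t \<odot>\<^bsub>V\<^esub> u)) = l v + t * l u" for t
    using assms smult_closed by (simp add: linear_functional_def)
  then show ?thesis by (auto intro!: derivative_eq_intros)
qed

text \<open>The Leibniz rule lowers the degree of each product by 1. In degree 0, where \<open>k - 1\<close> is again 0,
  the induction has to remember that the derivative vanishes.\<close>

lemma homogeneous_polynomial_directional_derivative:
  assumes "homogeneous_polynomial V k p" "u \<in> carrier V"
  shows "\<exists>p'. homogeneous_polynomial V (k - 1) p' \<and> (k = 0 \<longrightarrow> (\<forall>v\<in>carrier V. p' v = 0)) \<and>
    (\<forall>v\<in>carrier V. ((\<lambda>t. p (v \<oplus>\<^bsub>V\<^esub> (t \<odot>\<^bsub>V\<^esub> u))) has_real_derivative p' v) (at 0))"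
    (is "\<exists>p'. ?D k p p'")
proof -
  have "homogeneous_polynomial V k p \<and> (\<exists>p'. ?D k p p')"
    using assms(1)
  proof (induction rule: homogeneous_polynomial_induct)
    case (const a)
    have "?D 0 (\<lambda>v. a) (\<lambda>v. 0)" by (simp add: homogeneous_polynomial_zero)
    then show ?case using homogeneous_polynomial_const by blast
  next
    case (zero k)
    have "?D k (\<lambda>v. 0) (\<lambda>v. 0)" by (simp add: homogeneous_polynomial_zero)
    then show ?case using homogeneous_polynomial_zero by blast
  next
    case (add k p q)
    then obtain p' q' where "?D k p p'" "?D k q q'" by blast
    then have "?D k (\<lambda>v. p v + q v) (\<lambda>v. p' v + q' v)"
      by (auto intro: homogeneous_polynomial_add DERIV_add)
    then show ?case using add homogeneous_polynomial_add by blast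
  next
    case (mult k l p)
    then obtain p' where p': "?D k p p'" by blast
    have hom: "homogeneous_polynomial V k p" using mult by blast
    have "homogeneous_polynomial V k (\<lambda>v. l v * p' v)"
    proof (cases k)
      case 0
      then have "\<And>v. v \<in> carrier V \<Longrightarrow> p' v = 0" using p' by blast
      then show ?thesis
        by (intro homogeneous_polynomial_cong[OF homogeneous_polynomial_zero]) simp
    next
      case (Suc n)
      then have "homogeneous_polynomial V n p'" using p' by simp
      from homogeneous_polynomial_mult_linear[OF mult(1) this] show ?thesis by (simp only: Suc)
    qed
    then have "homogeneous_polynomial V k (\<lambda>v. l u * p v + l v * p' v)"
      using homogeneous_polynomial_add[OF homogeneous_polynomial_scale[OF hom]] by blast
    moreover have "((\<lambda>t. l (v \<oplus>\<^bsub>V\<^esub> (t \<odot>\<^bsub>V\<^esub> u)) * p (v \<oplus>\<^bsub>V\<^esub> (t \<odot>\<^bsub>V\<^esub> u)))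
        has_real_derivative l u * p v + l v * p' v) (at 0)" if v: "v \<in> carrier V" for v
    proof -
      have "l (v \<oplus>\<^bsub>V\<^esub> (0 \<odot>\<^bsub>V\<^esub> u)) = l v"
        using homogeneous_polynomial_add_smult_0[OF homogeneous_polynomial_linear[OF mult(1)] assms(2) v] .
      moreover have "p (v \<oplus>\<^bsub>V\<^esub> (0 \<odot>\<^bsub>V\<^esub> u)) = p v"
        using homogeneous_polynomial_add_smult_0[OF hom assms(2) v] .
      moreover have "((\<lambda>t. p (v \<oplus>\<^bsub>V\<^esub> (t \<odot>\<^bsub>V\<^esub> u))) has_real_derivative p' v) (at 0)"
        using p' v by blast
      ultimately show ?thesis
        using DERIV_mult[OF linear_functional_derivative[OF mult(1) assms(2) v],
            of "\<lambda>t. p (v \<oplus>\<^bsub>V\<^esub> (t \<odot>\<^bsub>V\<^esub> u))" "p' v"]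
        by (simp add: algebra_simps)
    qed
    ultimately have "?D (Suc k) (\<lambda>v. l v * p v) (\<lambda>v. l u * p v + l v * p' v)" by simp
    then show ?case using homogeneous_polynomial_mult_linear[OF mult(1) hom] by blast
  next
    case (cong k p q)
    then obtain p' where p': "?D k p p'" by blast
    have "p (v \<oplus>\<^bsub>V\<^esub> (t \<odot>\<^bsub>V\<^esub> u)) = q (v \<oplus>\<^bsub>V\<^esub> (t \<odot>\<^bsub>V\<^esub> u))" if "v \<in> carrier V" for v t
      using that assms(2) cong(2) add_closed smult_closed by simp
    with p' have "?D k q p'" by simp
    then show ?case using cong homogeneous_polynomial_cong by blast
  qed
  then show ?thesis by (rule conjunct2)
qed

text \<open>Euler's identity, for a vector \<open>v\<close> that has the coordinates \<open>a b\<close> with respect to the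
  vectors \<open>u b\<close>.\<close>

lemma euler_identity:
  assumes "homogeneous_polynomial V k p" "v \<in> carrier V" "\<And>b. b \<in> B \<Longrightarrow> u b \<in> carrier V"
    and lin: "\<And>l. linear_functional V l \<Longrightarrow> l v = (\<Sum>b\<in>B. a b * l (u b))"
  shows "(\<Sum>b\<in>B. a b * deriv (\<lambda>t. p (v \<oplus>\<^bsub>V\<^esub> (t \<odot>\<^bsub>V\<^esub> u b))) 0) = real k * p v"
proof -
  let ?d = "\<lambda>p b. deriv (\<lambda>t. p (v \<oplus>\<^bsub>V\<^esub> (t \<odot>\<^bsub>V\<^esub> u b))) 0"
  have D: "((\<lambda>t. p (v \<oplus>\<^bsub>V\<^esub> (t \<odot>\<^bsub>V\<^esub> u b))) has_real_derivative ?d p b) (at 0)"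
    if "homogeneous_polynomial V k p" "b \<in> B" for k p b
    using homogeneous_polynomial_directional_derivative[OF that(1) assms(3)[OF that(2)]] assms(2)
      DERIV_imp_deriv by metis
  have "homogeneous_polynomial V k p \<and> (\<Sum>b\<in>B. a b * ?d p b) = real k * p v"
    using assms(1)
  proof (induction rule: homogeneous_polynomial_induct)
    case (const a)
    then show ?case by (simp add: homogeneous_polynomial_const)
  next
    case (zero k)
    then show ?case by (simp add: homogeneous_polynomial_zero)
  next
    case (add k p q)
    have "?d (\<lambda>v. p v + q v) b = ?d p b + ?d q b" if "b \<in> B" for b
      using D[of k p, OF _ that] D[of k q, OF _ that] add by (intro DERIV_imp_deriv DERIV_add) auto
    then have "(\<Sum>b\<in>B. a b * ?d (\<lambda>v. p v + q v) b) = (\<Sum>b\<in>B. a b * ?d p b) + (\<Sum>b\<in>B. a b * ?d q b)"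
      by (simp add: distrib_left sum.distrib)
    then show ?case using add homogeneous_polynomial_add by (auto simp: distrib_left)
  next
    case (mult k l p)
    then have hom: "homogeneous_polynomial V k p" by blast
    have "?d (\<lambda>v. l v * p v) b = l (u b) * p v + l v * ?d p b" if b: "b \<in> B" for b
    proof (rule DERIV_imp_deriv)
      have "l (v \<oplus>\<^bsub>V\<^esub> (0 \<odot>\<^bsub>V\<^esub> u b)) = l v"
        using homogeneous_polynomial_add_smult_0[OF homogeneous_polynomial_linear[OF mult(1)] assms(3)[OF b] assms(2)] .
      moreover have "p (v \<oplus>\<^bsub>V\<^esub> (0 \<odot>\<^bsub>V\<^esub> u b)) = p v"
        using homogeneous_polynomial_add_smult_0[OF hom assms(3)[OF b] assms(2)] .
      ultimately show "((\<lambda>t. l (v \<oplus>\<^bsub>V\<^esub> (t \<odot>\<^bsub>V\<^esub> u b)) * p (v \<oplus>\<^bsub>V\<^esub> (t \<odot>\<^bsub>V\<^esub> u b)))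
          has_real_derivative l (u b) * p v + l v * ?d p b) (at 0)"
        using DERIV_mult[OF linear_functional_derivative[OF mult(1) assms(3)[OF b] assms(2)] D[OF hom b]]
        by (simp add: algebra_simps)
    qed
    then have "(\<Sum>b\<in>B. a b * ?d (\<lambda>v. l v * p v) b) =
        (\<Sum>b\<in>B. a b * l (u b)) * p v + l v * (\<Sum>b\<in>B. a b * ?d p b)"
      by (simp add: distrib_left sum.distrib sum_distrib_left sum_distrib_right mult.assoc mult.left_commute)
    also have "\<dots> = real (Suc k) * (l v * p v)"
      using mult(2) lin[OF mult(1)] by (simp add: algebra_simps)
    finally show ?case using homogeneous_polynomial_mult_linear[OF mult(1) hom] by blast
  next
    case (cong k p q)
    have "?d p b = ?d q b" if "b \<in> B" for b
      using assms(2,3) that cong(2) add_closed smult_closed by simp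
    then have "(\<Sum>b\<in>B. a b * ?d p b) = (\<Sum>b\<in>B. a b * ?d q b)" by simp
    then show ?case using cong homogeneous_polynomial_cong assms(2) by metis
  qed
  then show ?thesis by (rule conjunct2)
qed

end

section \<open>Vector bundles and their polynomial functions\<close>

lemma open_submanifold_Int_points:
  assumes "charted M"
  shows "open_submanifold M (points M \<inter> W) = open_submanifold M W"
proof -
  have "V \<inter> (points M \<inter> W) = V \<inter> W" if "(V, \<phi>) \<in> atlas M" for V \<phi>
    using chart_subset[OF assms that] by blast
  then have "(\<lambda>(V, \<phi>). (V \<inter> (points M \<inter> W), \<phi>)) ` atlas M = (\<lambda>(V, \<phi>). (V \<inter> W, \<phi>)) ` atlas M"
    by (intro image_cong) auto
  moreover have "subtopology (top_of M) (points M \<inter> W) = subtopology (top_of M) W"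
    by (metis subtopology_restrict)
  ultimately show ?thesis by (simp add: open_submanifold_def)
qed

locale smooth_bundle =
  fixes M :: "('a, 'm::fin_dim_inner) manifold" and P :: "('a, 'e, 'm, 'f::fin_dim_inner) vbundle"
  assumes vector_bundle: "vector_bundle M P"
begin

abbreviation E :: "'e set" where "E \<equiv> points (total_space P)"

lemma base_manifold: "smooth_manifold M" and total_manifold: "smooth_manifold (total_space P)"
  and smooth_proj: "smooth_map (total_space P) M (proj P)"
  using vector_bundle by (auto simp: vector_bundle_def)

lemmas charted_base = smooth_manifold_charted[OF base_manifold]
lemmas charted_total = smooth_manifold_charted[OF total_manifold]

lemma proj_in: "e \<in> E \<Longrightarrow> proj P e \<in> points M"
  using smooth_mapD(2)[OF smooth_proj] by blast

lemma fibre_carrier [simp]: "e \<in> carrier (fibre P x) \<longleftrightarrow> e \<in> E \<and> proj P e = x"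
  by (simp add: fibre_def)

lemma fibre_ops [simp]: "add (fibre P x) = vadd P" "smult (fibre P x) = vscale P" "zero (fibre P x) = vzero P x"
  by (simp_all add: fibre_def)

lemma fibre_module: "x \<in> points M \<Longrightarrow> Module.module real_ring (fibre P x)"
  using vector_bundle by (auto simp: vector_bundle_def)

lemma vadd_in: "u \<in> E \<Longrightarrow> v \<in> E \<Longrightarrow> proj P u = proj P v \<Longrightarrow> vadd P u v \<in> E"
  and proj_vadd [simp]: "u \<in> E \<Longrightarrow> v \<in> E \<Longrightarrow> proj P u = proj P v \<Longrightarrow> proj P (vadd P u v) = proj P v"
proof -
  assume *: "u \<in> E" "v \<in> E" "proj P u = proj P v"
  interpret module real_ring "fibre P (proj P v)" using fibre_module proj_in[OF *(2)] .
  have "vadd P u v \<in> carrier (fibre P (proj P v))" using a_closed[of u v] * by simp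
  then show "vadd P u v \<in> E" "proj P (vadd P u v) = proj P v" by simp_all
qed

lemma vscale_in [simp]: "u \<in> E \<Longrightarrow> vscale P c u \<in> E"
  and proj_vscale [simp]: "u \<in> E \<Longrightarrow> proj P (vscale P c u) = proj P u"
  and vscale_zero: "u \<in> E \<Longrightarrow> vscale P 0 u = vzero P (proj P u)"
  and vscale_one: "u \<in> E \<Longrightarrow> vscale P 1 u = u"
proof -
  assume *: "u \<in> E"
  interpret module real_ring "fibre P (proj P u)" using fibre_module proj_in[OF *] .
  have "vscale P c u \<in> carrier (fibre P (proj P u))"
    using smult_closed[of c u] * by (simp add: real_ring_def)
  then show "vscale P c u \<in> E" "proj P (vscale P c u) = proj P u" by simp_all
  show "vscale P 0 u = vzero P (proj P u)" using smult_l_null[of u] * by (simp add: real_ring_def)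
  show "vscale P 1 u = u" using smult_one[of u] * by (simp add: real_ring_def)
qed

lemma vzero_in [simp]: "x \<in> points M \<Longrightarrow> vzero P x \<in> E"
  and proj_vzero [simp]: "x \<in> points M \<Longrightarrow> proj P (vzero P x) = x"
proof -
  assume *: "x \<in> points M"
  interpret module real_ring "fibre P x" using fibre_module[OF *] .
  have "vzero P x \<in> carrier (fibre P x)" using zero_closed by simp
  then show "vzero P x \<in> E" "proj P (vzero P x) = x" by simp_all
qed

lemma fibre_closed:
  "u \<in> carrier (fibre P x) \<Longrightarrow> v \<in> carrier (fibre P x) \<Longrightarrow> u \<oplus>\<^bsub>fibre P x\<^esub> v \<in> carrier (fibre P x)"
  "u \<in> carrier (fibre P x) \<Longrightarrow> c \<odot>\<^bsub>fibre P x\<^esub> u \<in> carrier (fibre P x)"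
  using vadd_in by auto

subsection \<open>Homogeneous polynomial functions\<close>

lemma Pol_hom_smooth: "p \<in> Pol_hom M P k \<Longrightarrow> smooth_fun (total_space P) UNIV p"
  by (simp add: Pol_hom_def smooth_map_model[OF charted_total])

lemma Pol_hom_poly: "p \<in> Pol_hom M P k \<Longrightarrow> x \<in> points M \<Longrightarrow> homogeneous_polynomial (fibre P x) k p"
  by (simp add: Pol_hom_def)

lemma Pol_homI:
  assumes "smooth_fun (total_space P) UNIV p" "\<And>x. x \<in> points M \<Longrightarrow> homogeneous_polynomial (fibre P x) k p"
  shows "restrict p E \<in> Pol_hom M P k"
proof -
  have "smooth_fun (total_space P) UNIV (restrict p E)"
    using assms(1) by (subst smooth_fun_cong_UNIV[OF charted_total, of _ p]) auto
  moreover have "homogeneous_polynomial (fibre P x) k (restrict p E)" if "x \<in> points M" for x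
    using assms(2)[OF that] by (rule homogeneous_polynomial_cong) auto
  ultimately show ?thesis by (simp add: Pol_hom_def smooth_map_model[OF charted_total])
qed

lemma Pol_hom_vscale: "p \<in> Pol_hom M P k \<Longrightarrow> e \<in> E \<Longrightarrow> p (vscale P t e) = t ^ k * p e"
  using homogeneous_polynomial_smult[OF Pol_hom_poly[of p k "proj P e"], of e t] proj_in[of e] by simp

lemma Pol_hom_linear: "l \<in> Pol_hom M P 1 \<Longrightarrow> x \<in> points M \<Longrightarrow> linear_functional (fibre P x) l"
  using linear_functional_if_homogeneous_1[OF Pol_hom_poly fibre_closed] by blast

lemma Pol_hom_vadd: "l \<in> Pol_hom M P 1 \<Longrightarrow> u \<in> E \<Longrightarrow> v \<in> E \<Longrightarrow> proj P u = proj P v \<Longrightarrow> l (vadd P u v) = l u + l v"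
  using Pol_hom_linear[of l "proj P v"] proj_in[of v] by (auto simp: linear_functional_def)

lemma Pol_hom_const:
  assumes "p \<in> Pol_hom M P 0" "e \<in> E" "e' \<in> E" "proj P e = proj P e'"
  shows "p e = p e'"
  using Pol_hom_poly[OF assms(1) proj_in[OF assms(3)]] assms
  unfolding homogeneous_polynomial_0_iff by auto

lemma Pol_hom_mult:
  "p \<in> Pol_hom M P k \<Longrightarrow> q \<in> Pol_hom M P n \<Longrightarrow> (\<lambda>e\<in>E. p e * q e) \<in> Pol_hom M P (k + n)"
  by (intro Pol_homI smooth_fun_mult_UNIV[OF charted_total] homogeneous_polynomial_mult Pol_hom_smooth Pol_hom_poly)

lemma Pol_hom_add:
  "p \<in> Pol_hom M P k \<Longrightarrow> q \<in> Pol_hom M P k \<Longrightarrow> (\<lambda>e\<in>E. p e + q e) \<in> Pol_hom M P k"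
  by (intro Pol_homI smooth_fun_add_UNIV[OF charted_total] homogeneous_polynomial_add Pol_hom_smooth Pol_hom_poly)

lemma Pol_hom_zero: "(\<lambda>e\<in>E. 0) \<in> Pol_hom M P k"
  by (intro Pol_homI smooth_fun_const[OF charted_total] homogeneous_polynomial_zero)

definition pull :: "('a \<Rightarrow> real) \<Rightarrow> 'e \<Rightarrow> real" where
  "pull g = (\<lambda>e\<in>E. g (proj P e))"

lemma pull_apply [simp]: "e \<in> E \<Longrightarrow> pull g e = g (proj P e)"
  by (simp add: pull_def)

lemma pull_in: "smooth_fun M UNIV g \<Longrightarrow> pull g \<in> Pol_hom M P 0"
  unfolding pull_def
  by (intro Pol_homI smooth_fun_compose_map_UNIV[OF charted_total charted_base smooth_proj])
    (auto simp: homogeneous_polynomial_0_iff)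

subsection \<open>The algebra of polynomial functions\<close>

lemma Pol_ops [simp]: "mult (Pol M P) p q = (\<lambda>e\<in>E. p e * q e)" "one (Pol M P) = (\<lambda>e\<in>E. 1)"
  "add (Pol M P) p q = (\<lambda>e\<in>E. p e + q e)" "smult (Pol M P) c p = (\<lambda>e\<in>E. c * p e)"
  by (simp_all add: Pol_def)

lemma Pol_carrierE:
  assumes "p \<in> carrier (Pol M P)"
  obtains d q where "\<forall>k\<le>d. q k \<in> Pol_hom M P k" "p = (\<lambda>e\<in>E. \<Sum>k\<le>(d::nat). q k e)"
  using assms by (auto simp: Pol_def)

lemma Pol_extensional: "p \<in> carrier (Pol M P) \<Longrightarrow> p \<in> extensional E"
  by (auto elim!: Pol_carrierE)

lemma Pol_eqI:
  "p \<in> carrier (Pol M P) \<Longrightarrow> q \<in> carrier (Pol M P) \<Longrightarrow> (\<And>e. e \<in> E \<Longrightarrow> p e = q e) \<Longrightarrow> p = q"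
  using Pol_extensional extensionalityI by metis

lemma Pol_hom_extensional: "p \<in> Pol_hom M P k \<Longrightarrow> restrict p E = p"
  by (simp add: Pol_hom_def extensional_restrict)

lemma Pol_hom_carrier:
  assumes "p \<in> Pol_hom M P k"
  shows "p \<in> carrier (Pol M P)"
proof -
  let ?q = "\<lambda>j. if j = k then p else (\<lambda>e\<in>E. 0)"
  have "(\<Sum>j\<le>k. ?q j e) = p e" if "e \<in> E" for e
  proof -
    have "(\<Sum>j\<le>k. ?q j e) = (\<Sum>j\<le>k. if j = k then p e else 0)" using that by (intro sum.cong) auto
    then show ?thesis by simp
  qed
  then have "p = (\<lambda>e\<in>E. \<Sum>j\<le>k. ?q j e)"
    using Pol_hom_extensional[OF assms] by (metis (no_types, lifting) restrict_ext)
  moreover have "\<forall>j\<le>k. ?q j \<in> Pol_hom M P j" using assms Pol_hom_zero by auto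
  ultimately show ?thesis unfolding Pol_def by (simp, intro exI[of _ k] exI[of _ ?q]) blast
qed

lemma Pol_add_closed:
  assumes "p \<in> carrier (Pol M P)" "q \<in> carrier (Pol M P)"
  shows "(\<lambda>e\<in>E. p e + q e) \<in> carrier (Pol M P)"
proof -
  obtain d p' where p: "\<forall>k\<le>d. p' k \<in> Pol_hom M P k" "p = (\<lambda>e\<in>E. \<Sum>k\<le>(d::nat). p' k e)"
    using assms(1) by (rule Pol_carrierE)
  obtain d' q' where q: "\<forall>k\<le>d'. q' k \<in> Pol_hom M P k" "q = (\<lambda>e\<in>E. \<Sum>k\<le>(d'::nat). q' k e)"
    using assms(2) by (rule Pol_carrierE)
  define pp where "pp = (\<lambda>k. if k \<le> d then p' k else (\<lambda>e\<in>E. 0))"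
  define qq where "qq = (\<lambda>k. if k \<le> d' then q' k else (\<lambda>e\<in>E. 0))"
  define r where "r = (\<lambda>k. \<lambda>e\<in>E. pp k e + qq k e)"
  have r: "r k \<in> Pol_hom M P k" for k
    unfolding r_def pp_def qq_def using p(1) q(1) Pol_hom_zero by (intro Pol_hom_add) auto
  have "p e + q e = (\<Sum>k\<le>d + d'. r k e)" if e: "e \<in> E" for e
  proof -
    have "(\<Sum>k\<le>d. p' k e) = (\<Sum>k\<le>d + d'. pp k e)"
      using e by (intro sum.mono_neutral_cong_left) (auto simp: pp_def)
    moreover have "(\<Sum>k\<le>d'. q' k e) = (\<Sum>k\<le>d + d'. qq k e)"
      using e by (intro sum.mono_neutral_cong_left) (auto simp: qq_def)
    ultimately show ?thesis using e by (simp add: p(2) q(2) r_def sum.distrib)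
  qed
  then have "(\<lambda>e\<in>E. p e + q e) = (\<lambda>e\<in>E. \<Sum>k\<le>d + d'. r k e)" by (rule restrict_ext)
  with r show ?thesis unfolding Pol_def by (simp, intro exI[of _ "d + d'"] exI[of _ r]) blast
qed

lemma Pol_sum_closed:
  assumes "finite I" "\<And>i. i \<in> I \<Longrightarrow> f i \<in> carrier (Pol M P)"
  shows "(\<lambda>e\<in>E. \<Sum>i\<in>I. f i e) \<in> carrier (Pol M P)"
  using assms
proof (induction I rule: finite_induct)
  case empty
  then show ?case using Pol_hom_carrier[OF Pol_hom_zero] by (simp only: sum.empty)
next
  case (insert i I)
  then have "(\<lambda>e\<in>E. f i e + (\<lambda>e\<in>E. \<Sum>i\<in>I. f i e) e) \<in> carrier (Pol M P)"
    by (intro Pol_add_closed) auto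
  moreover have "(\<lambda>e\<in>E. f i e + (\<lambda>e\<in>E. \<Sum>i\<in>I. f i e) e) = (\<lambda>e\<in>E. \<Sum>i\<in>insert i I. f i e)"
    using insert by (intro restrict_ext) auto
  ultimately show ?case by (simp only:)
qed

lemma Pol_mult_closed:
  assumes "p \<in> carrier (Pol M P)" "q \<in> carrier (Pol M P)"
  shows "(\<lambda>e\<in>E. p e * q e) \<in> carrier (Pol M P)"
proof -
  obtain d p' where p: "\<forall>k\<le>d. p' k \<in> Pol_hom M P k" "p = (\<lambda>e\<in>E. \<Sum>k\<le>(d::nat). p' k e)"
    using assms(1) by (rule Pol_carrierE)
  obtain d' q' where q: "\<forall>k\<le>d'. q' k \<in> Pol_hom M P k" "q = (\<lambda>e\<in>E. \<Sum>k\<le>(d'::nat). q' k e)"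
    using assms(2) by (rule Pol_carrierE)
  define r where "r = (\<lambda>(k, n). \<lambda>e\<in>E. p' k e * q' n e)"
  have "r z \<in> carrier (Pol M P)" if "z \<in> {..d} \<times> {..d'}" for z
    using that p(1) q(1) by (auto simp: r_def intro!: Pol_hom_carrier[OF Pol_hom_mult])
  then have "(\<lambda>e\<in>E. \<Sum>z\<in>{..d} \<times> {..d'}. r z e) \<in> carrier (Pol M P)"
    by (intro Pol_sum_closed) auto
  moreover have "(\<lambda>e\<in>E. \<Sum>z\<in>{..d} \<times> {..d'}. r z e) = (\<lambda>e\<in>E. p e * q e)"
    by (intro restrict_ext) (simp add: p(2) q(2) r_def sum_product sum.cartesian_product split_beta)
  ultimately show ?thesis by simp
qed

lemma Pol_const_in: "(\<lambda>e\<in>E. c) \<in> Pol_hom M P 0"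
  by (intro Pol_homI smooth_fun_const[OF charted_total]) (auto simp: homogeneous_polynomial_0_iff)

lemma Pol_scale_closed: "p \<in> carrier (Pol M P) \<Longrightarrow> (\<lambda>e\<in>E. c * p e) \<in> carrier (Pol M P)"
  using Pol_mult_closed[OF Pol_hom_carrier[OF Pol_const_in[of c]], of p] by (simp cong: restrict_cong)

lemma Pol_hom_scale: "p \<in> Pol_hom M P k \<Longrightarrow> (\<lambda>e\<in>E. c * p e) \<in> Pol_hom M P k"
  using Pol_hom_mult[OF Pol_const_in[of c], of p k] by (simp cong: restrict_cong)

lemma Pol_hom_sum:
  assumes "finite I" "\<And>i. i \<in> I \<Longrightarrow> f i \<in> Pol_hom M P k"
  shows "(\<lambda>e\<in>E. \<Sum>i\<in>I. f i e) \<in> Pol_hom M P k"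
  using assms
proof (induction I rule: finite_induct)
  case (insert i I)
  then have "(\<lambda>e\<in>E. f i e + (\<lambda>e\<in>E. \<Sum>i\<in>I. f i e) e) \<in> Pol_hom M P k"
    by (intro Pol_hom_add) auto
  moreover have "(\<lambda>e\<in>E. f i e + (\<lambda>e\<in>E. \<Sum>i\<in>I. f i e) e) = (\<lambda>e\<in>E. \<Sum>i\<in>insert i I. f i e)"
    using insert by (intro restrict_ext) auto
  ultimately show ?case by (simp only:)
qed (use Pol_hom_zero in \<open>simp only: sum.empty\<close>)

lemma Pol_vscale:
  assumes "p = (\<lambda>e\<in>E. \<Sum>k\<le>d. q k e)" "\<forall>k\<le>d. q k \<in> Pol_hom M P k" "e \<in> E"
  shows "p (vscale P t e) = (\<Sum>k\<le>d. t ^ k * q k e)"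
  using assms by (auto simp: Pol_hom_vscale intro!: sum.cong)

text \<open>The components of degree 0 and 1 of a polynomial function are the first two Taylor coefficients
  of \<open>t \<mapsto> p (t e)\<close> at 0.\<close>

definition const_part :: "('e \<Rightarrow> real) \<Rightarrow> 'e \<Rightarrow> real" where
  "const_part p = (\<lambda>e\<in>E. p (vzero P (proj P e)))"

definition lin_part :: "('e \<Rightarrow> real) \<Rightarrow> 'e \<Rightarrow> real" where
  "lin_part p = (\<lambda>e\<in>E. deriv (\<lambda>t. p (vscale P t e)) 0)"

lemma
  assumes "p \<in> carrier (Pol M P)"
  shows const_part_in: "const_part p \<in> Pol_hom M P 0"
    and lin_part_in: "lin_part p \<in> Pol_hom M P 1"
    and lin_part_DERIV: "e \<in> E \<Longrightarrow> ((\<lambda>t. p (vscale P t e)) has_real_derivative lin_part p e) (at 0)"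
proof -
  obtain d q where q: "\<forall>k\<le>d. q k \<in> Pol_hom M P k" "p = (\<lambda>e\<in>E. \<Sum>k\<le>(d::nat). q k e)"
    using assms by (rule Pol_carrierE)
  note sc = Pol_vscale[OF q(2,1)]
  have "p (vzero P (proj P e)) = q 0 e" if e: "e \<in> E" for e
  proof -
    have "p (vzero P (proj P e)) = (\<Sum>k\<le>d. 0 ^ k * q k e)" using sc[OF e, of 0] vscale_zero[OF e] by simp
    also have "\<dots> = (\<Sum>k\<le>d. if k = 0 then q 0 e else 0)" by (intro sum.cong) auto
    finally show ?thesis by simp
  qed
  then have "const_part p = restrict (q 0) E" unfolding const_part_def by (rule restrict_ext)
  then show "const_part p \<in> Pol_hom M P 0" using q(1) Pol_hom_extensional by auto
  define r where "r = (if d = 0 then (\<lambda>e\<in>E. 0) else q 1)"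
  have r: "r \<in> Pol_hom M P 1" using q(1) Pol_hom_zero by (auto simp: r_def)
  have D: "((\<lambda>t. p (vscale P t e)) has_real_derivative r e) (at 0)" if e: "e \<in> E" for e
  proof -
    have "((\<lambda>t. \<Sum>k\<le>d. t ^ k * q k e) has_real_derivative (\<Sum>k\<le>d. real k * 0 ^ (k - 1) * q k e)) (at 0)"
      by (intro DERIV_sum) (auto intro!: derivative_eq_intros)
    moreover have "(\<Sum>k\<le>d. real k * 0 ^ (k - 1) * q k e) = (\<Sum>k\<le>d. if k = 1 then q 1 e else 0)"
    proof (rule sum.cong)
      show "real k * 0 ^ (k - 1) * q k e = (if k = 1 then q 1 e else 0)" for k
        by (cases k) auto
    qed simp
    moreover have "(\<Sum>k\<le>d. if k = 1 then q 1 e else 0) = r e" using e by (auto simp: r_def)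
    ultimately show ?thesis using sc[OF e] by simp
  qed
  then have "lin_part p = restrict r E" unfolding lin_part_def by (intro restrict_ext DERIV_imp_deriv)
  then have eq: "lin_part p = r" using Pol_hom_extensional[OF r] by simp
  with r show "lin_part p \<in> Pol_hom M P 1" by simp
  show "e \<in> E \<Longrightarrow> ((\<lambda>t. p (vscale P t e)) has_real_derivative lin_part p e) (at 0)"
    using D eq by simp
qed

lemma lin_part_eqI:
  "((\<lambda>t. p (vscale P t e)) has_real_derivative c) (at 0) \<Longrightarrow> e \<in> E \<Longrightarrow> lin_part p e = c"
  by (simp add: lin_part_def DERIV_imp_deriv)

lemma lin_part_add:
  assumes "p \<in> carrier (Pol M P)" "q \<in> carrier (Pol M P)" "e \<in> E"
  shows "lin_part (\<lambda>e\<in>E. p e + q e) e = lin_part p e + lin_part q e"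
  using DERIV_add[OF lin_part_DERIV[OF assms(1,3)] lin_part_DERIV[OF assms(2,3)]] assms(3)
  by (intro lin_part_eqI) auto

lemma lin_part_mult:
  assumes "p \<in> carrier (Pol M P)" "q \<in> carrier (Pol M P)" "e \<in> E"
  shows "lin_part (\<lambda>e\<in>E. p e * q e) e = const_part p e * lin_part q e + const_part q e * lin_part p e"
  using DERIV_mult[OF lin_part_DERIV[OF assms(1,3)] lin_part_DERIV[OF assms(2,3)]] assms(3)
  by (intro lin_part_eqI) (auto simp: const_part_def vscale_zero algebra_simps)

lemma lin_part_const: "p \<in> Pol_hom M P 0 \<Longrightarrow> e \<in> E \<Longrightarrow> lin_part p e = 0"
  by (intro lin_part_eqI) (auto simp: Pol_hom_vscale)

lemma lin_part_linear: "l \<in> Pol_hom M P 1 \<Longrightarrow> e \<in> E \<Longrightarrow> lin_part l e = l e"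
  by (intro lin_part_eqI) (auto simp: Pol_hom_vscale intro!: derivative_eq_intros)

lemma const_part_const: "p \<in> Pol_hom M P 0 \<Longrightarrow> e \<in> E \<Longrightarrow> const_part p e = p e"
  using Pol_hom_const[of p "vzero P (proj P e)" e] proj_in by (simp add: const_part_def)

text \<open>Along a line through the origin of a fibre, a polynomial function is a polynomial in one
  variable, and the units among those are constant.\<close>

lemma unit_fibrewise_constant:
  assumes p: "p \<in> carrier (Pol M P)" and q: "q \<in> carrier (Pol M P)" and pq: "\<And>e. e \<in> E \<Longrightarrow> p e * q e = 1"
  shows "p \<in> Pol_hom M P 0"
proof -
  have "p e = p (vzero P (proj P e))" if e: "e \<in> E" for e
  proof -
    obtain d p' where p': "\<forall>k\<le>d. p' k \<in> Pol_hom M P k" "p = (\<lambda>e\<in>E. \<Sum>k\<le>(d::nat). p' k e)"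
      using p by (rule Pol_carrierE)
    obtain d' q' where q': "\<forall>k\<le>d'. q' k \<in> Pol_hom M P k" "q = (\<lambda>e\<in>E. \<Sum>k\<le>(d'::nat). q' k e)"
      using q by (rule Pol_carrierE)
    define A where "A = (\<Sum>k\<le>d. monom (p' k e) k)"
    define B where "B = (\<Sum>k\<le>d'. monom (q' k e) k)"
    have A: "poly A t = p (vscale P t e)" for t
      using Pol_vscale[OF p'(2,1) e] by (simp add: A_def poly_sum poly_monom mult.commute)
    have B: "poly B t = q (vscale P t e)" for t
      using Pol_vscale[OF q'(2,1) e] by (simp add: B_def poly_sum poly_monom mult.commute)
    have "poly (A * B) = poly 1" using pq e by (auto simp: A B)
    then have AB: "A * B = 1" by (simp add: poly_eq_poly_eq_iff)
    then have "A \<noteq> 0" "B \<noteq> 0" by auto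
    then have "degree A + degree B = 0" using AB degree_mult_eq[of A B] by simp
    then obtain a where "A = [:a:]" by (auto elim: degree_eq_zeroE)
    then have "poly A 1 = poly A 0" by simp
    then show ?thesis using e by (simp add: A vscale_one vscale_zero)
  qed
  then have "const_part p = restrict p E" unfolding const_part_def by (intro restrict_ext) simp
  also have "\<dots> = p" using Pol_extensional[OF p] by (simp add: extensional_restrict)
  finally show ?thesis using const_part_in[OF p] by simp
qed

end

subsection \<open>Trivializations and frames\<close>

locale trivialized_bundle = smooth_bundle M P
  for M :: "('a, 'm::fin_dim_inner) manifold" and P :: "('a, 'e, 'm, 'f::fin_dim_inner) vbundle" +
  fixes U \<psi>
  assumes open_U: "openin (top_of M) U" and trivialization: "local_trivialization M P U \<psi>"
begin

definition EU :: "'e set" where "EU = E \<inter> proj P -` U"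

definition \<psi>i :: "'a \<times> 'f \<Rightarrow> 'e" where "\<psi>i = inv_into EU \<psi>"

abbreviation "MU \<equiv> prod_manifold (open_submanifold M U) (model_manifold :: ('f, 'f) manifold)"

lemma U_sub: "U \<subseteq> points M"
  using open_U by (rule openin_subset)

lemma open_EU: "openin (top_of (total_space P)) EU"
  unfolding EU_def by (rule smooth_map_preimage_open[OF smooth_proj open_U])

lemma EU_sub: "EU \<subseteq> E" by (auto simp: EU_def)

lemma charted_MU: "charted MU"
  by (intro charted_prod charted_open_submanifold charted_base open_U charted_model)

lemma \<psi>_diffeo: "diffeomorphism (open_submanifold (total_space P) EU) MU \<psi>"
  using trivialization open_submanifold_Int_points[OF charted_total, of "proj P -` U"]
  by (simp add: local_trivialization_def EU_def)

lemma \<psi>_bij: "bij_betw \<psi> EU (U \<times> UNIV)"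
  using \<psi>_diffeo U_sub EU_sub by (simp add: diffeomorphism_def Int_absorb1)

lemma \<psi>_smooth: "smooth_map (open_submanifold (total_space P) EU) MU \<psi>"
  and \<psi>i_smooth: "smooth_map MU (open_submanifold (total_space P) EU) \<psi>i"
  using \<psi>_diffeo EU_sub by (simp_all add: diffeomorphism_def \<psi>i_def Int_absorb1)

lemma fst_\<psi>: "e \<in> EU \<Longrightarrow> fst (\<psi> e) = proj P e"
  using trivialization by (simp add: local_trivialization_def EU_def)

lemma \<psi>i_\<psi>: "e \<in> EU \<Longrightarrow> \<psi>i (\<psi> e) = e"
  using \<psi>_bij by (simp add: \<psi>i_def bij_betw_def inv_into_f_f)

lemma \<psi>_\<psi>i: "x \<in> U \<Longrightarrow> \<psi> (\<psi>i (x, w)) = (x, w)"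
  using \<psi>_bij by (simp add: \<psi>i_def bij_betw_def f_inv_into_f)

lemma \<psi>i_in: "x \<in> U \<Longrightarrow> \<psi>i (x, w) \<in> EU"
  using \<psi>_bij by (simp add: \<psi>i_def bij_betw_def inv_into_into)

lemma proj_\<psi>i: "x \<in> U \<Longrightarrow> proj P (\<psi>i (x, w)) = x"
  using fst_\<psi>[OF \<psi>i_in] \<psi>_\<psi>i by simp

lemma \<psi>_eq: "e \<in> EU \<Longrightarrow> \<psi> e = (proj P e, snd (\<psi> e))"
  using fst_\<psi> by (metis prod.collapse)

lemma snd_\<psi>_vadd: "u \<in> EU \<Longrightarrow> v \<in> EU \<Longrightarrow> proj P u = proj P v \<Longrightarrow> snd (\<psi> (vadd P u v)) = snd (\<psi> u) + snd (\<psi> v)"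
  and snd_\<psi>_vscale: "u \<in> EU \<Longrightarrow> snd (\<psi> (vscale P c u)) = c *\<^sub>R snd (\<psi> u)"
  using trivialization by (auto simp: local_trivialization_def EU_def)

lemma vadd_\<psi>i: "x \<in> U \<Longrightarrow> vadd P (\<psi>i (x, w)) (\<psi>i (x, w')) = \<psi>i (x, w + w')"
proof -
  assume x: "x \<in> U"
  let ?s = "vadd P (\<psi>i (x, w)) (\<psi>i (x, w'))"
  have s: "?s \<in> EU" "proj P ?s = x"
    using \<psi>i_in[OF x] proj_\<psi>i[OF x] x by (auto simp: EU_def vadd_in)
  have "\<psi> ?s = (x, w + w')"
    using \<psi>_eq[OF s(1)] s(2) snd_\<psi>_vadd[OF \<psi>i_in[OF x] \<psi>i_in[OF x]] proj_\<psi>i[OF x] \<psi>_\<psi>i[OF x] by simp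
  then show ?thesis using \<psi>i_\<psi>[OF s(1)] by simp
qed

lemma vscale_\<psi>i: "x \<in> U \<Longrightarrow> vscale P c (\<psi>i (x, w)) = \<psi>i (x, c *\<^sub>R w)"
proof -
  assume x: "x \<in> U"
  let ?s = "vscale P c (\<psi>i (x, w))"
  have s: "?s \<in> EU" "proj P ?s = x"
    using \<psi>i_in[OF x] proj_\<psi>i[OF x] x by (auto simp: EU_def)
  have "\<psi> ?s = (x, c *\<^sub>R w)"
    using \<psi>_eq[OF s(1)] s(2) snd_\<psi>_vscale[OF \<psi>i_in[OF x]] \<psi>_\<psi>i[OF x] by simp
  then show ?thesis using \<psi>i_\<psi>[OF s(1)] by simp
qed

lemma smooth_snd_\<psi>: "smooth_fun (total_space P) EU (\<lambda>e. snd (\<psi> e))"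
proof -
  have "smooth_fun (open_submanifold (total_space P) EU) UNIV (\<lambda>e. snd (\<psi> e))"
    by (rule smooth_fun_compose_map_UNIV[OF charted_open_submanifold[OF charted_total open_EU] charted_MU \<psi>_smooth
        smooth_map_snd_model[OF charted_open_submanifold[OF charted_base open_U]]])
  then have "smooth_fun (open_submanifold (total_space P) EU) EU (\<lambda>e. snd (\<psi> e))"
    by (rule smooth_fun_subset) simp
  then show ?thesis using smooth_fun_open_submanifold[OF charted_total open_EU open_EU order_refl] by blast
qed

lemma smooth_map_\<psi>i:
  assumes L: "charted L" and f: "smooth_map L M f" "f ` points L \<subseteq> U" and s: "smooth_fun L UNIV s"
  shows "smooth_map L (total_space P) (\<lambda>z. \<psi>i (f z, s z))"
proof -
  have "smooth_map L MU (\<lambda>z. (f z, s z))"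
    using s by (intro smooth_map_Pair charted_open_submanifold charted_base open_U charted_model L
        smooth_map_into_open_submanifold f) (simp add: smooth_map_model[OF L])
  then have "smooth_map L (open_submanifold (total_space P) EU) (\<lambda>z. \<psi>i (f z, s z))"
    by (rule smooth_map_compose[OF L charted_MU _ \<psi>i_smooth charted_open_submanifold[OF charted_total open_EU]])
  from smooth_map_compose[OF L charted_open_submanifold[OF charted_total open_EU] this
      smooth_map_inclusion[OF charted_total open_EU] charted_total]
  show ?thesis .
qed

lemma smooth_vertical_derivative:
  assumes p: "smooth_fun (total_space P) UNIV p"
  shows "smooth_fun (total_space P) EU (\<lambda>e. deriv (\<lambda>t. p (\<psi>i (fst (\<psi> e), snd (\<psi> e) + t *\<^sub>R b))) 0)"
proof -
  let ?EU = "open_submanifold (total_space P) EU"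
  note cEU = charted_open_submanifold[OF charted_total open_EU]
  have "smooth_fun ?EU UNIV (\<lambda>e. p e)"
    by (rule smooth_fun_compose_map_UNIV[OF cEU charted_total smooth_map_inclusion[OF charted_total open_EU] p])
  then have "smooth_fun MU UNIV (\<lambda>z. p (\<psi>i z))"
    by (rule smooth_fun_compose_map_UNIV[OF charted_MU cEU \<psi>i_smooth])
  from smooth_fun_partial_derivative[OF charted_open_submanifold[OF charted_base open_U] this, of b]
  have "smooth_fun ?EU UNIV (\<lambda>e. deriv (\<lambda>t. p (\<psi>i (fst (\<psi> e), snd (\<psi> e) + t *\<^sub>R b))) 0)"
    by (rule smooth_fun_compose_map_UNIV[OF cEU charted_MU \<psi>_smooth])
  then have "smooth_fun ?EU EU (\<lambda>e. deriv (\<lambda>t. p (\<psi>i (fst (\<psi> e), snd (\<psi> e) + t *\<^sub>R b))) 0)"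
    by (rule smooth_fun_subset) simp
  then show ?thesis using smooth_fun_open_submanifold[OF charted_total open_EU open_EU order_refl] by blast
qed

end

text \<open>A cutoff function \<open>\<theta>\<close> turns the coordinates of a trivialization into global fibrewise linear
  functions.\<close>

locale framed_bundle = trivialized_bundle M P U \<psi>
  for M :: "('a, 'm::fin_dim_inner) manifold" and P :: "('a, 'e, 'm, 'f::fin_dim_inner) vbundle"
    and U \<psi> +
  fixes \<theta> :: "'a \<Rightarrow> real" and K W
  assumes smooth_\<theta>: "smooth_fun M UNIV \<theta>" and closed_K: "closedin (top_of M) K" and K_sub: "K \<subseteq> U"
    and open_W: "openin (top_of M) W" and W_sub: "W \<subseteq> U"
    and \<theta>_W: "\<forall>x\<in>W. \<theta> x = 1" and \<theta>_K: "\<forall>x\<in>points M - K. \<theta> x = 0"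
begin

definition frame :: "'f \<Rightarrow> 'e \<Rightarrow> real" where
  "frame b = (\<lambda>e\<in>E. \<theta> (proj P e) * (snd (\<psi> e) \<bullet> b))"

lemma smooth_cutoff:
  assumes "smooth_fun (total_space P) EU g"
  shows "smooth_fun (total_space P) UNIV (\<lambda>e. \<theta> (proj P e) * g e)"
proof (rule smooth_fun_extend_zero[OF charted_total open_EU, of "{e \<in> E. proj P e \<in> K}"])
  show "closedin (top_of (total_space P)) {e \<in> E. proj P e \<in> K}"
    by (rule closedin_continuous_map_preimage[OF smooth_mapD(1)[OF smooth_proj] closed_K])
  show "{e \<in> E. proj P e \<in> K} \<subseteq> EU" using K_sub by (auto simp: EU_def)
  have "smooth_fun (total_space P) EU (\<lambda>e. \<theta> (proj P e))"
    using smooth_fun_compose_map_UNIV[OF charted_total charted_base smooth_proj smooth_\<theta>]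
    by (rule smooth_fun_subset) simp
  then show "smooth_fun (total_space P) EU (\<lambda>e. \<theta> (proj P e) * g e)"
    using assms by (rule smooth_fun_mult[OF charted_total open_EU])
  show "\<theta> (proj P e) * g e = 0" if "e \<in> E" "e \<notin> {e \<in> E. proj P e \<in> K}" for e
    using that \<theta>_K proj_in[OF that(1)] by simp
qed

lemma frame_in: "frame b \<in> Pol_hom M P 1"
  unfolding frame_def
proof (rule Pol_homI)
  show "smooth_fun (total_space P) UNIV (\<lambda>e. \<theta> (proj P e) * (snd (\<psi> e) \<bullet> b))"
    by (intro smooth_cutoff smooth_fun_inner[OF charted_total open_EU] smooth_snd_\<psi> smooth_fun_const[OF charted_total])
  fix x assume x: "x \<in> points M"
  show "homogeneous_polynomial (fibre P x) 1 (\<lambda>e. \<theta> (proj P e) * (snd (\<psi> e) \<bullet> b))"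
  proof (cases "x \<in> U")
    case True
    then have "linear_functional (fibre P x) (\<lambda>e. \<theta> (proj P e) * (snd (\<psi> e) \<bullet> b))"
      using snd_\<psi>_vadd snd_\<psi>_vscale
      by (auto simp: linear_functional_def EU_def inner_add_left algebra_simps)
    then show ?thesis by (rule homogeneous_polynomial_linear)
  next
    case False
    then have "\<theta> x = 0" using \<theta>_K K_sub x by blast
    then show ?thesis by (intro homogeneous_polynomial_cong[OF homogeneous_polynomial_zero]) simp
  qed
qed

text \<open>Euler's identity \<open>(k + 1) p = (\<Sum>b. x\<^sub>b \<partial>\<^sub>b p)\<close> in the coordinates of the frame splits off
  a linear factor, with smooth quotients. One factor \<open>\<theta>\<close> belongs to the frame, the other makes the
  quotients global.\<close>

lemma frame_division:
  assumes p: "p \<in> Pol_hom M P (Suc k)"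
  shows "\<exists>q. (\<forall>b\<in>onb. q b \<in> Pol_hom M P k) \<and>
    (\<forall>e\<in>E. (\<theta> (proj P e))\<^sup>2 * p e = (\<Sum>b\<in>onb. frame b e * q b e))"
proof -
  define D where "D = (\<lambda>b e. deriv (\<lambda>t. p (\<psi>i (fst (\<psi> e), snd (\<psi> e) + t *\<^sub>R b))) 0)"
  define q where "q = (\<lambda>b. \<lambda>e\<in>E. \<theta> (proj P e) * (D b e / real (Suc k)))"
  have shift: "vadd P e (vscale P t (\<psi>i (x, b))) = \<psi>i (fst (\<psi> e), snd (\<psi> e) + t *\<^sub>R b)"
    if "x \<in> U" "e \<in> E" "proj P e = x" for x e t b
  proof -
    have e: "e \<in> EU" using that by (simp add: EU_def)
    have "e = \<psi>i (x, snd (\<psi> e))" using \<psi>i_\<psi>[OF e] \<psi>_eq[OF e] that(3) by metis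
    then have "vadd P e (vscale P t (\<psi>i (x, b))) = vadd P (\<psi>i (x, snd (\<psi> e))) (\<psi>i (x, t *\<^sub>R b))"
      using vscale_\<psi>i[OF that(1)] by metis
    then show ?thesis using vadd_\<psi>i[OF that(1)] fst_\<psi>[OF e] that(3) by simp
  qed
  have "q b \<in> Pol_hom M P k" for b
    unfolding q_def
  proof (rule Pol_homI)
    have "smooth_fun (total_space P) EU (\<lambda>e. D b e * (1 / real (Suc k)))"
      unfolding D_def by (intro smooth_fun_mult[OF charted_total open_EU] smooth_fun_const[OF charted_total]
          smooth_vertical_derivative Pol_hom_smooth[OF p])
    from smooth_cutoff[OF this] show "smooth_fun (total_space P) UNIV (\<lambda>e. \<theta> (proj P e) * (D b e / real (Suc k)))"
      by simp
    fix x assume x: "x \<in> points M"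
    show "homogeneous_polynomial (fibre P x) k (\<lambda>e. \<theta> (proj P e) * (D b e / real (Suc k)))"
    proof (cases "x \<in> U")
      case True
      have "\<psi>i (x, b) \<in> carrier (fibre P x)" using \<psi>i_in[OF True] proj_\<psi>i[OF True] by (simp add: EU_def)
      from homogeneous_polynomial_directional_derivative[OF fibre_closed Pol_hom_poly[OF p x] this]
      obtain p' where p': "homogeneous_polynomial (fibre P x) k p'"
        "\<forall>e\<in>carrier (fibre P x). ((\<lambda>t. p (vadd P e (vscale P t (\<psi>i (x, b))))) has_real_derivative p' e) (at 0)"
        by auto
      have "D b e = p' e" if "e \<in> carrier (fibre P x)" for e
        using p'(2) that shift[OF True] by (auto simp: D_def intro!: DERIV_imp_deriv)
      then show ?thesis
        by (intro homogeneous_polynomial_cong[OF homogeneous_polynomial_scale[OF p'(1), of "\<theta> x / real (Suc k)"]]) simp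
    next
      case False
      then have "\<theta> x = 0" using \<theta>_K K_sub x by blast
      then show ?thesis by (intro homogeneous_polynomial_cong[OF homogeneous_polynomial_zero]) simp
    qed
  qed
  moreover have "(\<theta> (proj P e))\<^sup>2 * p e = (\<Sum>b\<in>onb. frame b e * q b e)" if e: "e \<in> E" for e
  proof (cases "proj P e \<in> U")
    case True
    let ?x = "proj P e"
    have eEU: "e \<in> EU" using e True by (simp add: EU_def)
    have "(\<Sum>b\<in>onb. (snd (\<psi> e) \<bullet> b) * deriv (\<lambda>t. p (e \<oplus>\<^bsub>fibre P ?x\<^esub> (t \<odot>\<^bsub>fibre P ?x\<^esub> \<psi>i (?x, b)))) 0)
        = real (Suc k) * p e"
    proof (rule euler_identity[OF fibre_closed Pol_hom_poly[OF p proj_in[OF e]]])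
      show "e \<in> carrier (fibre P ?x)" using e by simp
      show "\<psi>i (?x, b) \<in> carrier (fibre P ?x)" for b using \<psi>i_in[OF True] proj_\<psi>i[OF True] by (simp add: EU_def)
      fix l assume l: "linear_functional (fibre P ?x) l"
      have E: "\<psi>i (?x, w) \<in> E \<and> proj P (\<psi>i (?x, w)) = ?x" for w
        using \<psi>i_in[OF True] proj_\<psi>i[OF True] by (simp add: EU_def)
      have l_add: "l (vadd P u v) = l u + l v" and l_scale: "l (vscale P c u) = c * l u"
        if "u \<in> E" "proj P u = ?x" "v \<in> E" "proj P v = ?x" for u v c
        using l that by (simp_all add: linear_functional_def)
      have "linear (\<lambda>w. l (\<psi>i (?x, w)))"
      proof (rule linearI)
        show "l (\<psi>i (?x, w + w')) = l (\<psi>i (?x, w)) + l (\<psi>i (?x, w'))" for w w'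
          using l_add E vadd_\<psi>i[OF True, of w w'] by metis
        show "l (\<psi>i (?x, c *\<^sub>R w)) = c *\<^sub>R l (\<psi>i (?x, w))" for c w
          using l_scale[of "\<psi>i (?x, w)" "\<psi>i (?x, w)" c] E[of w] vscale_\<psi>i[OF True, of c w] by simp
      qed
      then have "l (\<psi>i (?x, \<Sum>b\<in>onb. (snd (\<psi> e) \<bullet> b) *\<^sub>R b)) = (\<Sum>b\<in>onb. (snd (\<psi> e) \<bullet> b) * l (\<psi>i (?x, b)))"
        by (simp add: linear_sum[where f="\<lambda>w. l (\<psi>i (?x, w))"] linear_scale[where f="\<lambda>w. l (\<psi>i (?x, w))"])
      moreover have "\<psi>i (?x, \<Sum>b\<in>onb. (snd (\<psi> e) \<bullet> b) *\<^sub>R b) = e"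
        unfolding onb_representation[symmetric] using \<psi>i_\<psi>[OF eEU] \<psi>_eq[OF eEU] by simp
      ultimately show "l e = (\<Sum>b\<in>onb. (snd (\<psi> e) \<bullet> b) * l (\<psi>i (?x, b)))" by simp
    qed
    then have eu: "(\<Sum>b\<in>onb. (snd (\<psi> e) \<bullet> b) * D b e) = real (Suc k) * p e"
      using shift[OF True e refl] by (simp add: D_def)
    have "(\<Sum>b\<in>onb. frame b e * q b e) = (\<theta> ?x)\<^sup>2 / real (Suc k) * (\<Sum>b\<in>onb. (snd (\<psi> e) \<bullet> b) * D b e)"
      using e unfolding sum_distrib_left
      by (intro sum.cong) (auto simp: frame_def q_def power2_eq_square)
    also have "\<dots> = (\<theta> ?x)\<^sup>2 * p e" unfolding eu by simp
    finally show ?thesis by simp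
  next
    case False
    then have "\<theta> (proj P e) = 0" using \<theta>_K K_sub proj_in[OF e] by blast
    then show ?thesis using e by (simp add: frame_def)
  qed
  ultimately show ?thesis by blast
qed

lemma frame_\<psi>i: "x \<in> W \<Longrightarrow> frame b (\<psi>i (x, w)) = w \<bullet> b"
  using W_sub \<psi>i_in[of x w] proj_\<psi>i[of x w] \<psi>_\<psi>i[of x w] \<theta>_W by (auto simp: frame_def EU_def)

lemma frame_reconstruct:
  assumes "e \<in> E" "proj P e \<in> W"
  shows "\<psi>i (proj P e, \<Sum>b\<in>onb. frame b e *\<^sub>R b) = e"
proof -
  have e: "e \<in> EU" using assms W_sub by (auto simp: EU_def)
  have "(\<Sum>b\<in>onb. frame b e *\<^sub>R b) = (\<Sum>b\<in>onb. (snd (\<psi> e) \<bullet> b) *\<^sub>R b)"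
    using assms \<theta>_W by (simp add: frame_def)
  also have "\<dots> = snd (\<psi> e)" by (rule onb_representation[symmetric])
  finally show ?thesis using \<psi>i_\<psi>[OF e] \<psi>_eq[OF e] by simp
qed

text \<open>Over \<open>W\<close>, a point of the bundle is a smooth function of its base point and of its frame
  coordinates.\<close>

lemma smooth_map_into_frame:
  fixes g :: "'e \<Rightarrow> real"
  assumes L: "charted L" and T: "openin (top_of L) T" and G: "G ` points L \<subseteq> E"
    and TW: "\<And>z. z \<in> T \<Longrightarrow> proj P (G z) \<in> W" and pG: "smooth_map L M (\<lambda>z. proj P (G z))"
    and fG: "\<And>b. b \<in> onb \<Longrightarrow> smooth_fun L T (\<lambda>z. frame b (G z))"
    and g: "smooth_fun (total_space P) UNIV g"
  shows "smooth_fun L T (\<lambda>z. g (G z))"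
proof -
  let ?T = "open_submanifold L T"
  note cT = charted_open_submanifold[OF L T]
  have Tsub: "T \<subseteq> points L" using T by (rule openin_subset)
  define s where "s = (\<lambda>z. \<Sum>b\<in>onb. frame b (G z) *\<^sub>R b)"
  have "smooth_fun L T s" unfolding s_def
    by (intro smooth_fun_sum[OF L T] smooth_fun_scaleR[OF L T] fG smooth_fun_const[OF L])
  then have "smooth_fun ?T T s" using smooth_fun_open_submanifold[OF L T T order_refl] by blast
  then have s: "smooth_fun ?T UNIV s"
    using smooth_fun_points[OF cT, of s] Tsub by (simp add: Int_absorb1)
  have f: "smooth_map ?T M (\<lambda>z. proj P (G z))"
    by (rule smooth_map_compose[OF cT L smooth_map_inclusion[OF L T] pG charted_base])
  have "smooth_map ?T (total_space P) (\<lambda>z. \<psi>i (proj P (G z), s z))"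
    using TW W_sub by (intro smooth_map_\<psi>i[OF cT f _ s]) auto
  from smooth_fun_compose_map_UNIV[OF cT charted_total this g]
  have "smooth_fun ?T T (\<lambda>z. g (\<psi>i (proj P (G z), s z)))" by (rule smooth_fun_subset) simp
  then have sm: "smooth_fun L T (\<lambda>z. g (\<psi>i (proj P (G z), s z)))"
    using smooth_fun_open_submanifold[OF L T T order_refl] by blast
  have eq: "g (\<psi>i (proj P (G z), s z)) = g (G z)" if "z \<in> T" for z
  proof -
    have "G z \<in> E" using G Tsub that by blast
    then show ?thesis using frame_reconstruct TW[OF that] by (simp add: s_def)
  qed
  show ?thesis by (rule iffD1[OF smooth_fun_cong[OF L T eq] sm])
qed

end

context smooth_bundle
begin

lemma framed_bundle_exists:
  assumes "x \<in> points M"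
  obtains U \<psi> \<theta> K W where "framed_bundle M P U \<psi> \<theta> K W" "x \<in> W"
proof -
  obtain U \<psi> where U: "openin (top_of M) U" "x \<in> U" "local_trivialization M P U \<psi>"
    using vector_bundle assms by (auto simp: vector_bundle_def)
  obtain \<theta> :: "'a \<Rightarrow> real" and K W where *: "smooth_fun M UNIV \<theta>" "compactin (top_of M) K" "K \<subseteq> U"
    "openin (top_of M) W" "x \<in> W" "W \<subseteq> K" "\<forall>y\<in>W. \<theta> y = 1" "\<forall>y\<in>points M - K. \<theta> y = 0"
    "\<forall>y. 0 \<le> \<theta> y \<and> \<theta> y \<le> 1"
    by (rule bump_function_exists[OF base_manifold U(1,2)])
  have "closedin (top_of M) K"
    using base_manifold *(2) by (intro compactin_imp_closedin) (auto simp: smooth_manifold_def)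
  with U * have "framed_bundle M P U \<psi> \<theta> K W"
    by unfold_locales auto
  with *(5) show ?thesis using that by blast
qed

text \<open>This criterion gives the smoothness of the maps into total spaces that are constructed below: the fibrewise linear
  functions contain the coordinates of every local frame.\<close>

lemma smooth_map_into_bundle:
  assumes L: "charted L" and G: "G ` points L \<subseteq> E" and pG: "smooth_map L M (\<lambda>z. proj P (G z))"
    and lG: "\<And>l. l \<in> Pol_hom M P 1 \<Longrightarrow> smooth_fun L UNIV (\<lambda>z. l (G z))"
  shows "smooth_map L (total_space P) G"
proof (rule smooth_map_if_pulls_back_smooth_functions[OF total_manifold L G])
  fix g :: "'e \<Rightarrow> real" assume g: "smooth_fun (total_space P) UNIV g"
  show "smooth_fun L UNIV (\<lambda>z. g (G z))"
  proof (rule smooth_fun_local[OF L])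
    fix z assume z: "z \<in> points L"
    then have "proj P (G z) \<in> points M" using G proj_in by blast
    then obtain U \<psi> \<theta> K W where F: "framed_bundle M P U \<psi> \<theta> K W" and W: "proj P (G z) \<in> W"
      by (rule framed_bundle_exists)
    interpret framed_bundle M P U \<psi> \<theta> K W by (rule F)
    let ?T = "points L \<inter> (\<lambda>z. proj P (G z)) -` W"
    have T: "openin (top_of L) ?T" by (rule smooth_map_preimage_open[OF pG open_W])
    have "smooth_fun L ?T (\<lambda>z. g (G z))"
    proof (rule smooth_map_into_frame[OF L T G _ pG _ g])
      show "smooth_fun L ?T (\<lambda>z. frame b (G z))" for b
        using lG[OF frame_in] by (rule smooth_fun_subset) simp
    qed simp
    then show "\<exists>T. openin (top_of L) T \<and> z \<in> T \<and> smooth_fun L T (\<lambda>z. g (G z))"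
      using T z W by (intro exI[of _ ?T]) auto
  qed
qed

lemma fibre_eqI:
  assumes "e \<in> E" "e' \<in> E" "proj P e = proj P e'" "\<And>l. l \<in> Pol_hom M P 1 \<Longrightarrow> l e = l e'"
  shows "e = e'"
proof -
  obtain U \<psi> \<theta> K W where F: "framed_bundle M P U \<psi> \<theta> K W" and W: "proj P e \<in> W"
    by (rule framed_bundle_exists[OF proj_in[OF assms(1)]])
  interpret framed_bundle M P U \<psi> \<theta> K W by (rule F)
  have fr: "frame b e = frame b e'" for b using assms(4)[OF frame_in] .
  have "e = \<psi>i (proj P e, \<Sum>b\<in>onb. frame b e *\<^sub>R b)" using frame_reconstruct[OF assms(1) W] by simp
  also have "\<dots> = \<psi>i (proj P e', \<Sum>b\<in>onb. frame b e' *\<^sub>R b)" unfolding fr assms(3) ..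
  also have "\<dots> = e'" using frame_reconstruct[OF assms(2)] W assms(3) by simp
  finally show ?thesis .
qed

lemma smooth_zero_section: "smooth_map M (total_space P) (vzero P)"
proof (rule smooth_map_into_bundle[OF charted_base])
  show "vzero P ` points M \<subseteq> E" by auto
  have id: "smooth_map M M (\<lambda>x. x)"
    by (auto simp: smooth_map_iff continuous_map_def intro: smooth_fun_chart[OF charted_base]
        dest: openin_subset intro!: back_subst[of "openin (top_of M)"])
  then show "smooth_map M M (\<lambda>x. proj P (vzero P x))"
    by (subst smooth_map_cong[OF charted_base charted_base, of _ "\<lambda>x. x"]) auto
  fix l assume l: "l \<in> Pol_hom M P 1"
  have "l (vzero P x) = 0" if "x \<in> points M" for x
    using Pol_hom_vscale[OF l, of "vzero P x" 0] vscale_zero[of "vzero P x"] that by simp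
  then show "smooth_fun M UNIV (\<lambda>x. l (vzero P x))"
    by (subst smooth_fun_cong_UNIV[OF charted_base, of _ "\<lambda>x. 0"]) (auto simp: smooth_fun_const[OF charted_base])
qed

end

section \<open>Homomorphisms of the algebras of polynomial functions\<close>

text \<open>The composite \<open>f \<circ> g\<close> is an injective endomorphism of a finite-dimensional space.\<close>

lemma injective_linear_maps_both_ways_surj:
  fixes f :: "'f::fin_dim_inner \<Rightarrow> 'g::fin_dim_inner" and g :: "'g \<Rightarrow> 'f"
  assumes f: "linear f" "inj f" and g: "linear g" "inj g"
  shows "surj f"
proof -
  have lin: "Vector_Spaces.linear scaleR scaleR (f \<circ> g)"
    using linear_compose[OF g(1) f(1)] by (simp add: linear_def)
  have "finite_dimensional_vector_space (scaleR :: real \<Rightarrow> 'g \<Rightarrow> 'g) onb"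
  proof unfold_locales
    show "finite (onb :: 'g set)" by simp
    have "independent (onb :: 'g set)"
    proof (rule pairwise_orthogonal_independent)
      show "pairwise orthogonal (onb :: 'g set)" by (simp add: pairwise_def orthogonal_def onb_inner)
      show "0 \<notin> (onb :: 'g set)" using onb_inner[of 0 "0::'g"] by auto
    qed
    then show "\<not> module.dependent scaleR (onb :: 'g set)" unfolding dependent_raw_def .
    have "v \<in> span onb" for v :: 'g
      by (subst onb_representation) (intro span_sum span_scale span_base)
    then have "span (onb :: 'g set) = UNIV" by (intro UNIV_eq_I[symmetric])
    then show "module.span scaleR (onb :: 'g set) = UNIV" unfolding span_raw_def .
  qed
  then interpret V: finite_dimensional_vector_space "scaleR :: real \<Rightarrow> 'g \<Rightarrow> 'g" onb .
  have "surj (f \<circ> g)"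
    by (rule V.linear_inj_imp_surj[OF lin inj_compose[OF f(2) g(2)]])
  then show ?thesis by (metis image_comp top.extremum_uniqueI subset_UNIV image_mono)
qed

locale algebra_map = P: smooth_bundle M P + Q: smooth_bundle N Q
  for M :: "('a, 'm::fin_dim_inner) manifold" and P :: "('a, 'd, 'm, 'f::fin_dim_inner) vbundle"
    and N :: "('b, 'n::fin_dim_inner) manifold" and Q :: "('b, 'e, 'n, 'g::fin_dim_inner) vbundle" +
  fixes h :: "('d \<Rightarrow> real) \<Rightarrow> ('e \<Rightarrow> real)"
  assumes hom: "h \<in> ring_hom (Pol M P) (Pol N Q)"
    and scale: "\<And>c p. p \<in> carrier (Pol M P) \<Longrightarrow> h (c \<odot>\<^bsub>Pol M P\<^esub> p) = c \<odot>\<^bsub>Pol N Q\<^esub> h p"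
begin

lemma h_in: "p \<in> carrier (Pol M P) \<Longrightarrow> h p \<in> carrier (Pol N Q)"
  using hom by (rule ring_hom_closed)

lemma h_add: "p \<in> carrier (Pol M P) \<Longrightarrow> q \<in> carrier (Pol M P) \<Longrightarrow>
    h (\<lambda>e\<in>P.E. p e + q e) = (\<lambda>v\<in>Q.E. h p v + h q v)"
  using ring_hom_add[OF hom, of p q] by simp

lemma h_mult: "p \<in> carrier (Pol M P) \<Longrightarrow> q \<in> carrier (Pol M P) \<Longrightarrow>
    h (\<lambda>e\<in>P.E. p e * q e) = (\<lambda>v\<in>Q.E. h p v * h q v)"
  using ring_hom_mult[OF hom, of p q] by simp

lemma h_const: "h (\<lambda>e\<in>P.E. c) = (\<lambda>v\<in>Q.E. c)"
proof -
  have one: "(\<lambda>e\<in>P.E. 1) \<in> carrier (Pol M P)" by (rule P.Pol_hom_carrier[OF P.Pol_const_in])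
  have "h (\<lambda>e\<in>P.E. 1) = (\<lambda>v\<in>Q.E. 1)" using ring_hom_one[OF hom] by simp
  then have "h (\<lambda>e\<in>P.E. c * (\<lambda>e\<in>P.E. 1) e) = (\<lambda>v\<in>Q.E. c * (\<lambda>v\<in>Q.E. 1) v)" using scale[OF one, of c] by simp
  moreover have "(\<lambda>e\<in>P.E. c * (\<lambda>e\<in>P.E. 1) e) = (\<lambda>e\<in>P.E. c)" by (rule restrict_ext) simp
  moreover have "(\<lambda>v\<in>Q.E. c * (\<lambda>v\<in>Q.E. 1) v) = (\<lambda>v\<in>Q.E. c)" by (rule restrict_ext) simp
  ultimately show ?thesis by simp
qed

subsection \<open>The map of base manifolds\<close>

lemma h_unit_const:
  assumes p: "p \<in> Pol_hom M P 0" and nz: "\<And>e. e \<in> P.E \<Longrightarrow> p e \<noteq> 0"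
  shows "h p \<in> Pol_hom N Q 0"
proof -
  define q where "q = (\<lambda>e\<in>P.E. inverse (p e))"
  have "smooth_fun (total_space P) UNIV (\<lambda>e. inverse (p e))"
    using smooth_fun_inverse[OF P.charted_total openin_topspace, of p] P.Pol_hom_smooth[OF p] nz
    by (simp add: smooth_fun_points[OF P.charted_total])
  moreover have "homogeneous_polynomial (fibre P x) 0 (\<lambda>e. inverse (p e))" if "x \<in> points M" for x
    using P.Pol_hom_poly[OF p that] unfolding homogeneous_polynomial_0_iff by metis
  ultimately have q: "q \<in> Pol_hom M P 0" unfolding q_def by (rule P.Pol_homI)
  have "(\<lambda>e\<in>P.E. p e * q e) = (\<lambda>e\<in>P.E. 1)" using nz by (intro restrict_ext) (simp add: q_def)
  then have eq: "(\<lambda>v\<in>Q.E. h p v * h q v) = (\<lambda>v\<in>Q.E. 1)"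
    using h_mult[OF P.Pol_hom_carrier[OF p] P.Pol_hom_carrier[OF q]] h_const[of 1] by simp
  have "h p v * h q v = 1" if "v \<in> Q.E" for v using fun_cong[OF eq, of v] that by simp
  then show ?thesis
    by (rule Q.unit_fibrewise_constant[OF h_in[OF P.Pol_hom_carrier[OF p]] h_in[OF P.Pol_hom_carrier[OF q]]])
qed

text \<open>The functions of degree 0 are the differences of units: \<open>p = (p\<^sup>2 + p + 1) - (p\<^sup>2 + 1)\<close>.\<close>

lemma h_const_in:
  assumes p: "p \<in> Pol_hom M P 0"
  shows "h p \<in> Pol_hom N Q 0"
proof -
  define w where "w = (\<lambda>e\<in>P.E. (\<lambda>e\<in>P.E. p e * p e) e + (\<lambda>e\<in>P.E. 1) e)"
  define u where "u = (\<lambda>e\<in>P.E. w e + p e)"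
  have w: "w \<in> Pol_hom M P 0"
    unfolding w_def by (rule P.Pol_hom_add[OF P.Pol_hom_mult[OF p p, unfolded add_0] P.Pol_const_in])
  have u: "u \<in> Pol_hom M P 0" unfolding u_def by (rule P.Pol_hom_add[OF w p])
  have hw: "h w \<in> Pol_hom N Q 0"
  proof (rule h_unit_const[OF w])
    fix e assume "e \<in> P.E"
    moreover have "0 < p e * p e + 1" by (rule add_nonneg_pos) simp_all
    ultimately show "w e \<noteq> 0" by (simp add: w_def)
  qed
  have hu: "h u \<in> Pol_hom N Q 0"
  proof (rule h_unit_const[OF u])
    fix e assume e: "e \<in> P.E"
    \<comment> \<open>completing the square in \<open>p\<^sup>2 + p + 1\<close>\<close>
    have "0 < (p e + 1/2)^2 + 3/4" by (rule add_nonneg_pos) auto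
    also have "\<dots> = u e" using e by (simp add: u_def w_def power2_eq_square algebra_simps)
    finally show "u e \<noteq> 0" by simp
  qed
  have "h u = (\<lambda>v\<in>Q.E. h w v + h p v)"
    unfolding u_def by (rule h_add[OF P.Pol_hom_carrier[OF w] P.Pol_hom_carrier[OF p]])
  then have "h p v = h u v + (\<lambda>v\<in>Q.E. (-1) * h w v) v" if "v \<in> Q.E" for v using that by simp
  then have "restrict (h p) Q.E = (\<lambda>v\<in>Q.E. h u v + (\<lambda>v\<in>Q.E. (-1) * h w v) v)" by (rule restrict_ext)
  moreover have "restrict (h p) Q.E = h p"
    using Q.Pol_extensional[OF h_in[OF P.Pol_hom_carrier[OF p]]] by (rule extensional_restrict)
  moreover have "(\<lambda>v\<in>Q.E. h u v + (\<lambda>v\<in>Q.E. (-1) * h w v) v) \<in> Pol_hom N Q 0"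
    by (rule Q.Pol_hom_add[OF hu Q.Pol_hom_scale[OF hw]])
  ultimately show ?thesis by simp
qed

text \<open>Restricted to the functions of degree 0 and evaluated over a point of \<open>N\<close>, the homomorphism
  is a character of \<open>C\<^sup>\<infinity>(M)\<close>.\<close>

lemma base_map_exists:
  assumes y: "y \<in> points N"
  shows "\<exists>x\<in>points M. \<forall>f. smooth_fun M UNIV f \<longrightarrow> h (P.pull f) (vzero Q y) = f x"
proof (rule character_is_evaluation[OF P.base_manifold])
  note v = Q.vzero_in[OF y]
  fix f g :: "'a \<Rightarrow> real" assume f: "smooth_fun M UNIV f" and g: "smooth_fun M UNIV g"
  note fg = P.Pol_hom_carrier[OF P.pull_in[OF f]] P.Pol_hom_carrier[OF P.pull_in[OF g]]
  have "P.pull (\<lambda>x. f x + g x) = (\<lambda>e\<in>P.E. P.pull f e + P.pull g e)"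
    unfolding P.pull_def by (rule restrict_ext) simp
  then show "h (P.pull (\<lambda>x. f x + g x)) (vzero Q y) = h (P.pull f) (vzero Q y) + h (P.pull g) (vzero Q y)"
    using h_add[OF fg] v by simp
  have "P.pull (\<lambda>x. f x * g x) = (\<lambda>e\<in>P.E. P.pull f e * P.pull g e)"
    unfolding P.pull_def by (rule restrict_ext) simp
  then show "h (P.pull (\<lambda>x. f x * g x)) (vzero Q y) = h (P.pull f) (vzero Q y) * h (P.pull g) (vzero Q y)"
    using h_mult[OF fg] v by simp
next
  fix t show "h (P.pull (\<lambda>x. t)) (vzero Q y) = t"
    using h_const[of t] Q.vzero_in[OF y] by (simp add: P.pull_def)
next
  fix f g :: "'a \<Rightarrow> real" assume "\<And>x. x \<in> points M \<Longrightarrow> f x = g x"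
  then have "P.pull f = P.pull g" unfolding P.pull_def using P.proj_in by (intro restrict_ext) blast
  then show "h (P.pull f) (vzero Q y) = h (P.pull g) (vzero Q y)" by simp
qed

definition base_map :: "'b \<Rightarrow> 'a" where
  "base_map y = (SOME x. x \<in> points M \<and> (\<forall>f. smooth_fun M UNIV f \<longrightarrow> h (P.pull f) (vzero Q y) = f x))"

lemma base_map_in: "y \<in> points N \<Longrightarrow> base_map y \<in> points M"
  and h_pull_vzero: "y \<in> points N \<Longrightarrow> smooth_fun M UNIV f \<Longrightarrow> h (P.pull f) (vzero Q y) = f (base_map y)"
proof -
  assume "y \<in> points N"
  then have *: "\<exists>x. x \<in> points M \<and> (\<forall>f. smooth_fun M UNIV f \<longrightarrow> h (P.pull f) (vzero Q y) = f x)"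
    using base_map_exists by blast
  show "base_map y \<in> points M" "smooth_fun M UNIV f \<Longrightarrow> h (P.pull f) (vzero Q y) = f (base_map y)"
    using someI_ex[OF *] unfolding base_map_def by blast+
qed

lemma h_pull:
  assumes "smooth_fun M UNIV f" "v \<in> Q.E"
  shows "h (P.pull f) v = f (base_map (proj Q v))"
  using Q.const_part_const[OF h_const_in[OF P.pull_in[OF assms(1)]] assms(2)]
    h_pull_vzero[OF Q.proj_in[OF assms(2)] assms(1)] assms(2) by (simp add: Q.const_part_def)

lemma smooth_pullback_base_map:
  fixes f :: "'a \<Rightarrow> real"
  assumes "smooth_fun M UNIV f"
  shows "smooth_fun N UNIV (\<lambda>y. f (base_map y))"
proof -
  have "smooth_fun N UNIV (\<lambda>y. h (P.pull f) (vzero Q y))"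
    by (rule smooth_fun_compose_map_UNIV[OF Q.charted_base Q.charted_total Q.smooth_zero_section
        Q.Pol_hom_smooth[OF h_const_in[OF P.pull_in[OF assms]]]])
  then show ?thesis
    using h_pull_vzero[OF _ assms] by (subst smooth_fun_cong_UNIV[OF Q.charted_base]) auto
qed

lemma smooth_base_map: "smooth_map N M base_map"
  using base_map_in smooth_pullback_base_map
  by (intro smooth_map_if_pulls_back_smooth_functions[OF P.base_manifold Q.charted_base]) auto

lemma smooth_base_map_proj: "smooth_map (total_space Q) M (\<lambda>v. base_map (proj Q v))"
  by (rule smooth_map_compose[OF Q.charted_total Q.charted_base Q.smooth_proj smooth_base_map P.charted_base])

lemma h_const_apply:
  assumes p: "p \<in> Pol_hom M P 0" and v: "v \<in> Q.E"
  shows "h p v = p (vzero P (base_map (proj Q v)))"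
proof -
  have s: "smooth_fun M UNIV (\<lambda>x. p (vzero P x))"
    by (rule smooth_fun_compose_map_UNIV[OF P.charted_base P.charted_total P.smooth_zero_section P.Pol_hom_smooth[OF p]])
  have "P.pull (\<lambda>x. p (vzero P x)) = restrict p P.E"
    unfolding P.pull_def using P.const_part_const[OF p] by (intro restrict_ext) (simp add: P.const_part_def)
  then have "P.pull (\<lambda>x. p (vzero P x)) = p" using P.Pol_hom_extensional[OF p] by simp
  then show ?thesis using h_pull[OF s v] by simp
qed

subsection \<open>The linear part on fibres\<close>

text \<open>The homomorphism corresponds to a map from \<open>Q\<close> to \<open>P\<close> that is polynomial on fibres. On fibrewise
  linear functions, \<open>tangent\<close> is the transpose of its derivative along the zero section.\<close>

definition tangent :: "('d \<Rightarrow> real) \<Rightarrow> 'e \<Rightarrow> real" where "tangent p = Q.lin_part (h p)"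

lemma tangent_in: "p \<in> carrier (Pol M P) \<Longrightarrow> tangent p \<in> Pol_hom N Q 1"
  unfolding tangent_def by (rule Q.lin_part_in[OF h_in])

lemma tangent_add:
  "p \<in> carrier (Pol M P) \<Longrightarrow> q \<in> carrier (Pol M P) \<Longrightarrow> v \<in> Q.E \<Longrightarrow>
    tangent (\<lambda>e\<in>P.E. p e + q e) v = tangent p v + tangent q v"
  unfolding tangent_def by (simp only: h_add Q.lin_part_add h_in)

lemma tangent_const: "p \<in> Pol_hom M P 0 \<Longrightarrow> v \<in> Q.E \<Longrightarrow> tangent p v = 0"
  unfolding tangent_def by (rule Q.lin_part_const[OF h_const_in])

lemma tangent_mult:
  "p \<in> carrier (Pol M P) \<Longrightarrow> q \<in> carrier (Pol M P) \<Longrightarrow> v \<in> Q.E \<Longrightarrow>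
    tangent (\<lambda>e\<in>P.E. p e * q e) v = Q.const_part (h p) v * tangent q v + Q.const_part (h q) v * tangent p v"
  unfolding tangent_def by (simp only: h_mult Q.lin_part_mult h_in)

lemma tangent_const_mult:
  assumes "p \<in> Pol_hom M P 0" "q \<in> carrier (Pol M P)" "v \<in> Q.E"
  shows "tangent (\<lambda>e\<in>P.E. p e * q e) v = p (vzero P (base_map (proj Q v))) * tangent q v"
  using tangent_mult[OF P.Pol_hom_carrier[OF assms(1)] assms(2,3)] tangent_const[OF assms(1,3)]
    Q.const_part_const[OF h_const_in[OF assms(1)] assms(3)] h_const_apply[OF assms(1,3)] by simp

lemma tangent_sum:
  assumes "finite I" "\<And>i. i \<in> I \<Longrightarrow> p i \<in> carrier (Pol M P)" "v \<in> Q.E"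
  shows "tangent (\<lambda>e\<in>P.E. \<Sum>i\<in>I. p i e) v = (\<Sum>i\<in>I. tangent (p i) v)"
  using assms(1,2)
proof (induction I rule: finite_induct)
  case empty
  then show ?case using tangent_const[OF P.Pol_hom_zero assms(3)] by (simp only: sum.empty)
next
  case (insert i I)
  have "(\<lambda>e\<in>P.E. \<Sum>i\<in>insert i I. p i e) = (\<lambda>e\<in>P.E. p i e + (\<lambda>e\<in>P.E. \<Sum>i\<in>I. p i e) e)"
    using insert by (intro restrict_ext) auto
  moreover have "tangent (\<lambda>e\<in>P.E. p i e + (\<lambda>e\<in>P.E. \<Sum>i\<in>I. p i e) e) v = tangent (p i) v + tangent (\<lambda>e\<in>P.E. \<Sum>i\<in>I. p i e) v"
  proof (rule tangent_add[OF _ _ assms(3)])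
    show "p i \<in> carrier (Pol M P)" using insert.prems by blast
    show "(\<lambda>e\<in>P.E. \<Sum>i\<in>I. p i e) \<in> carrier (Pol M P)"
      using insert by (intro P.Pol_sum_closed) auto
  qed
  moreover have "tangent (\<lambda>e\<in>P.E. \<Sum>i\<in>I. p i e) v = (\<Sum>i\<in>I. tangent (p i) v)" using insert by blast
  ultimately show ?case by (simp only: sum.insert[OF insert(1,2)])
qed

text \<open>For fixed \<open>v\<close> the functional \<open>l \<mapsto> tangent l v\<close> on the fibrewise linear functions is
  \<open>C\<^sup>\<infinity>\<close>-linear over evaluation at a point, hence is evaluation at a vector above that point.\<close>

lemma fibre_map_exists:
  assumes v: "v \<in> Q.E"
  shows "\<exists>w. w \<in> P.E \<and> proj P w = base_map (proj Q v) \<and> (\<forall>l\<in>Pol_hom M P 1. l w = tangent l v)"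
proof -
  define x where "x = base_map (proj Q v)"
  have x: "x \<in> points M" unfolding x_def by (rule base_map_in[OF Q.proj_in[OF v]])
  obtain U \<psi> \<theta> K W where F: "framed_bundle M P U \<psi> \<theta> K W" and W: "x \<in> W"
    by (rule P.framed_bundle_exists[OF x])
  interpret F: framed_bundle M P U \<psi> \<theta> K W by (rule F)
  define w where "w = F.\<psi>i (x, \<Sum>b\<in>onb. tangent (F.frame b) v *\<^sub>R b)"
  have xU: "x \<in> U" using W F.W_sub by blast
  have w: "w \<in> P.E" "proj P w = x"
    using F.\<psi>i_in[OF xU] F.EU_sub F.proj_\<psi>i[OF xU] by (auto simp: w_def)
  have frame_w: "F.frame b w = tangent (F.frame b) v" if "b \<in> onb" for b
    unfolding w_def F.frame_\<psi>i[OF W] by (rule onb_sum_inner[OF that])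
  have \<theta>x: "\<theta> x = 1" using F.\<theta>_W W by blast
  have "l w = tangent l v" if l: "l \<in> Pol_hom M P 1" for l
  proof -
    obtain q where q: "\<forall>b\<in>onb. q b \<in> Pol_hom M P 0"
      "\<forall>e\<in>P.E. (\<theta> (proj P e))\<^sup>2 * l e = (\<Sum>b\<in>onb. F.frame b e * q b e)"
      using F.frame_division[of l 0] l by auto
    have \<theta>2: "smooth_fun M UNIV (\<lambda>x. \<theta> x * \<theta> x)"
      by (intro smooth_fun_mult_UNIV[OF P.charted_base] F.smooth_\<theta>)
    let ?r = "\<lambda>b. \<lambda>e\<in>P.E. q b e * F.frame b e"
    have eq: "(\<lambda>e\<in>P.E. \<Sum>b\<in>onb. ?r b e) = (\<lambda>e\<in>P.E. P.pull (\<lambda>x. \<theta> x * \<theta> x) e * l e)"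
      using q(2) by (intro restrict_ext) (simp add: power2_eq_square mult.commute)
    have r: "?r b \<in> carrier (Pol M P)" if "b \<in> onb" for b
      using q(1) that by (intro P.Pol_mult_closed P.Pol_hom_carrier[OF F.frame_in]) (auto intro: P.Pol_hom_carrier)
    have "tangent l v = tangent (\<lambda>e\<in>P.E. P.pull (\<lambda>x. \<theta> x * \<theta> x) e * l e) v"
      using tangent_const_mult[OF P.pull_in[OF \<theta>2] P.Pol_hom_carrier[OF l] v] x \<theta>x by (simp add: x_def[symmetric])
    also have "\<dots> = (\<Sum>b\<in>onb. tangent (?r b) v)" unfolding eq[symmetric] by (rule tangent_sum[OF finite_onb r v])
    also have "\<dots> = (\<Sum>b\<in>onb. q b (vzero P x) * tangent (F.frame b) v)"
      using q(1) by (intro sum.cong refl) (simp add: tangent_const_mult P.Pol_hom_carrier[OF F.frame_in] v x_def)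
    also have "\<dots> = (\<Sum>b\<in>onb. F.frame b w * q b w)"
    proof (intro sum.cong refl)
      fix b :: 'f assume b: "b \<in> onb"
      have "q b (vzero P x) = q b w"
        using P.const_part_const[of "q b" w] q(1) b w by (simp add: P.const_part_def)
      then show "q b (vzero P x) * tangent (F.frame b) v = F.frame b w * q b w" using frame_w[OF b] by simp
    qed
    also have "\<dots> = l w" using q(2) w \<theta>x by force
    finally show ?thesis by simp
  qed
  with w show ?thesis unfolding x_def by blast
qed

definition fibre_map :: "'e \<Rightarrow> 'd" where
  "fibre_map v = (SOME w. w \<in> P.E \<and> proj P w = base_map (proj Q v) \<and> (\<forall>l\<in>Pol_hom M P 1. l w = tangent l v))"

lemma
  assumes "v \<in> Q.E"
  shows fibre_map_in: "fibre_map v \<in> P.E"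
    and proj_fibre_map: "proj P (fibre_map v) = base_map (proj Q v)"
    and linear_fibre_map: "l \<in> Pol_hom M P 1 \<Longrightarrow> l (fibre_map v) = tangent l v"
  using someI_ex[OF fibre_map_exists[OF assms]] unfolding fibre_map_def by blast+

lemma fibre_map_vadd:
  assumes "u \<in> Q.E" "v \<in> Q.E" "proj Q u = proj Q v"
  shows "fibre_map (vadd Q u v) = vadd P (fibre_map u) (fibre_map v)"
proof (rule P.fibre_eqI)
  have s: "vadd Q u v \<in> Q.E" "proj Q (vadd Q u v) = proj Q v"
    using assms Q.vadd_in by auto
  have p: "proj P (fibre_map u) = proj P (fibre_map v)" using assms by (simp add: proj_fibre_map)
  show "fibre_map (vadd Q u v) \<in> P.E" by (rule fibre_map_in[OF s(1)])
  show "vadd P (fibre_map u) (fibre_map v) \<in> P.E"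
    by (intro P.vadd_in fibre_map_in assms p)
  show "proj P (fibre_map (vadd Q u v)) = proj P (vadd P (fibre_map u) (fibre_map v))"
    using s assms p by (simp add: proj_fibre_map fibre_map_in)
  fix l assume l: "l \<in> Pol_hom M P 1"
  have "l (vadd P (fibre_map u) (fibre_map v)) = tangent l u + tangent l v"
    using P.Pol_hom_vadd[OF l fibre_map_in[OF assms(1)] fibre_map_in[OF assms(2)] p] linear_fibre_map[OF _ l] assms
    by simp
  then show "l (fibre_map (vadd Q u v)) = l (vadd P (fibre_map u) (fibre_map v))"
    using Q.Pol_hom_vadd[OF tangent_in[OF P.Pol_hom_carrier[OF l]] assms] linear_fibre_map[OF s(1) l] by simp
qed

lemma fibre_map_vscale:
  assumes "v \<in> Q.E"
  shows "fibre_map (vscale Q c v) = vscale P c (fibre_map v)"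
proof (rule P.fibre_eqI)
  have s: "vscale Q c v \<in> Q.E" "proj Q (vscale Q c v) = proj Q v" using assms by auto
  show "fibre_map (vscale Q c v) \<in> P.E" by (rule fibre_map_in[OF s(1)])
  show "vscale P c (fibre_map v) \<in> P.E" using fibre_map_in[OF assms] by simp
  show "proj P (fibre_map (vscale Q c v)) = proj P (vscale P c (fibre_map v))"
    using s assms by (simp add: proj_fibre_map fibre_map_in)
  fix l assume l: "l \<in> Pol_hom M P 1"
  show "l (fibre_map (vscale Q c v)) = l (vscale P c (fibre_map v))"
    using P.Pol_hom_vscale[OF l fibre_map_in[OF assms], of c] linear_fibre_map[OF s(1) l]
      linear_fibre_map[OF assms l] Q.Pol_hom_vscale[OF tangent_in[OF P.Pol_hom_carrier[OF l]] assms, of c] by simp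
qed

lemma smooth_fibre_map: "smooth_map (total_space Q) (total_space P) fibre_map"
proof (rule P.smooth_map_into_bundle[OF Q.charted_total])
  show "fibre_map ` Q.E \<subseteq> P.E" using fibre_map_in by blast
  show "smooth_map (total_space Q) M (\<lambda>v. proj P (fibre_map v))"
    using smooth_base_map_proj
    by (subst smooth_map_cong[OF Q.charted_total P.charted_base, of _ "\<lambda>v. base_map (proj Q v)"])
      (auto simp: proj_fibre_map)
  fix l assume l: "l \<in> Pol_hom M P 1"
  have "smooth_fun (total_space Q) UNIV (tangent l)" by (rule Q.Pol_hom_smooth[OF tangent_in[OF P.Pol_hom_carrier[OF l]]])
  then show "smooth_fun (total_space Q) UNIV (\<lambda>v. l (fibre_map v))"
    using l by (subst smooth_fun_cong_UNIV[OF Q.charted_total, of _ "tangent l"]) (auto simp: linear_fibre_map)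
qed

end

subsection \<open>Surjective homomorphisms\<close>

locale surjective_algebra_map = algebra_map M P N Q h
  for M :: "('a, 'm::fin_dim_inner) manifold" and P :: "('a, 'd, 'm, 'f::fin_dim_inner) vbundle"
    and N :: "('b, 'n::fin_dim_inner) manifold" and Q :: "('b, 'e, 'n, 'g::fin_dim_inner) vbundle"
    and h :: "('d \<Rightarrow> real) \<Rightarrow> ('e \<Rightarrow> real)" +
  assumes surj: "h ` carrier (Pol M P) = carrier (Pol N Q)"
begin

text \<open>The functions \<open>p\<close> for which \<open>tangent p\<close> lies in the span of the \<open>tangent l\<^sub>b\<close>, for a frame \<open>l\<^sub>b\<close>, form a
  subalgebra because \<open>tangent\<close> is a derivation. It contains the functions of degree 0 and the frame, thus
  locally everything; and every linear function of \<open>Q\<close> is some \<open>tangent p\<close>.\<close>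

lemma linear_functions_locally_spanned:
  assumes l': "l' \<in> Pol_hom N Q 1" and y0: "y0 \<in> points N"
  shows "\<exists>O' a l. openin (top_of N) O' \<and> y0 \<in> O' \<and>
    (\<forall>b\<in>(onb :: 'f set). a b \<in> Pol_hom N Q 0 \<and> l b \<in> Pol_hom M P 1) \<and>
    (\<forall>v\<in>Q.E. proj Q v \<in> O' \<longrightarrow> l' v = (\<Sum>b\<in>onb. a b v * l b (fibre_map v)))"
proof -
  obtain U \<psi> \<theta> K W where F: "framed_bundle M P U \<psi> \<theta> K W" and W: "base_map y0 \<in> W"
    by (rule P.framed_bundle_exists[OF base_map_in[OF y0]])
  interpret F: framed_bundle M P U \<psi> \<theta> K W by (rule F)
  define spanned where "spanned p \<longleftrightarrow> p \<in> carrier (Pol M P) \<and>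
    (\<exists>a. (\<forall>b\<in>(onb :: 'f set). a b \<in> Pol_hom N Q 0) \<and> (\<forall>v\<in>Q.E. tangent p v = (\<Sum>b\<in>onb. a b v * tangent (F.frame b) v)))"
    for p
  have sp_const: "spanned p" if "p \<in> Pol_hom M P 0" for p
    unfolding spanned_def using tangent_const[OF that] P.Pol_hom_carrier[OF that] Q.Pol_hom_zero[of 0]
    by (auto intro!: exI[of _ "\<lambda>b. \<lambda>v\<in>Q.E. 0"])
  have sp_frame: "spanned (F.frame b)" if b: "b \<in> onb" for b
    unfolding spanned_def
  proof (intro conjI exI ballI)
    show "F.frame b \<in> carrier (Pol M P)" by (rule P.Pol_hom_carrier[OF F.frame_in])
    show "(\<lambda>v\<in>Q.E. if c = b then 1 else 0) \<in> Pol_hom N Q 0" for c by (rule Q.Pol_const_in)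
    fix v assume v: "v \<in> Q.E"
    have "(\<Sum>c\<in>onb. (\<lambda>v\<in>Q.E. if c = b then 1 else 0) v * tangent (F.frame c) v) =
        (\<Sum>c\<in>onb. if c = b then tangent (F.frame b) v else 0)" using v by (intro sum.cong) auto
    then show "tangent (F.frame b) v = (\<Sum>c\<in>onb. (\<lambda>v\<in>Q.E. if c = b then 1 else 0) v * tangent (F.frame c) v)"
      using b by simp
  qed
  have sp_add: "spanned (\<lambda>e\<in>P.E. p e + q e)" if p: "spanned p" and q: "spanned q" for p q
  proof -
    obtain a where a: "p \<in> carrier (Pol M P)" "\<forall>b\<in>(onb :: 'f set). a b \<in> Pol_hom N Q 0"
      "\<forall>v\<in>Q.E. tangent p v = (\<Sum>b\<in>onb. a b v * tangent (F.frame b) v)" using p unfolding spanned_def by blast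
    obtain c where c: "q \<in> carrier (Pol M P)" "\<forall>b\<in>(onb :: 'f set). c b \<in> Pol_hom N Q 0"
      "\<forall>v\<in>Q.E. tangent q v = (\<Sum>b\<in>onb. c b v * tangent (F.frame b) v)" using q unfolding spanned_def by blast
    show ?thesis unfolding spanned_def
    proof (intro conjI exI ballI)
      show "(\<lambda>e\<in>P.E. p e + q e) \<in> carrier (Pol M P)" by (rule P.Pol_add_closed[OF a(1) c(1)])
      show "(\<lambda>v\<in>Q.E. a b v + c b v) \<in> Pol_hom N Q 0" if "b \<in> onb" for b
        using a(2) c(2) that by (intro Q.Pol_hom_add) auto
      show "tangent (\<lambda>e\<in>P.E. p e + q e) v = (\<Sum>b\<in>onb. (\<lambda>v\<in>Q.E. a b v + c b v) v * tangent (F.frame b) v)"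
        if v: "v \<in> Q.E" for v
        using a(3) c(3) v by (simp add: tangent_add[OF a(1) c(1) v] distrib_right sum.distrib)
    qed
  qed
  have sp_mult: "spanned (\<lambda>e\<in>P.E. p e * q e)" if p: "spanned p" and q: "spanned q" for p q
  proof -
    obtain a where a: "p \<in> carrier (Pol M P)" "\<forall>b\<in>(onb :: 'f set). a b \<in> Pol_hom N Q 0"
      "\<forall>v\<in>Q.E. tangent p v = (\<Sum>b\<in>onb. a b v * tangent (F.frame b) v)" using p unfolding spanned_def by blast
    obtain c where c: "q \<in> carrier (Pol M P)" "\<forall>b\<in>(onb :: 'f set). c b \<in> Pol_hom N Q 0"
      "\<forall>v\<in>Q.E. tangent q v = (\<Sum>b\<in>onb. c b v * tangent (F.frame b) v)" using q unfolding spanned_def by blast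
    define r where "r = (\<lambda>b. \<lambda>v\<in>Q.E. (\<lambda>v\<in>Q.E. Q.const_part (h p) v * c b v) v + (\<lambda>v\<in>Q.E. Q.const_part (h q) v * a b v) v)"
    show ?thesis unfolding spanned_def
    proof (intro conjI exI ballI)
      show "(\<lambda>e\<in>P.E. p e * q e) \<in> carrier (Pol M P)" by (rule P.Pol_mult_closed[OF a(1) c(1)])
      show "r b \<in> Pol_hom N Q 0" if "b \<in> onb" for b
      proof -
        have "(\<lambda>v\<in>Q.E. Q.const_part (h p) v * c b v) \<in> Pol_hom N Q 0"
          using Q.Pol_hom_mult[OF Q.const_part_in[OF h_in[OF a(1)]], of "c b" 0] c(2) that
          by (simp only: add_0)
        moreover have "(\<lambda>v\<in>Q.E. Q.const_part (h q) v * a b v) \<in> Pol_hom N Q 0"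
          using Q.Pol_hom_mult[OF Q.const_part_in[OF h_in[OF c(1)]], of "a b" 0] a(2) that
          by (simp only: add_0)
        ultimately show ?thesis unfolding r_def by (rule Q.Pol_hom_add)
      qed
      show "tangent (\<lambda>e\<in>P.E. p e * q e) v = (\<Sum>b\<in>onb. r b v * tangent (F.frame b) v)" if v: "v \<in> Q.E" for v
        using a(3) c(3) v
        by (simp add: tangent_mult[OF a(1) c(1) v] r_def distrib_right sum.distrib sum_distrib_left mult.assoc)
    qed
  qed
  have sp_sum: "spanned (\<lambda>e\<in>P.E. \<Sum>i\<in>I. f i e)" if "finite I" "\<And>i. i \<in> I \<Longrightarrow> spanned (f i)" for I :: "'f set" and f
    using that
  proof (induction I rule: finite_induct)
    case empty
    then show ?case using sp_const[OF P.Pol_hom_zero] by (simp only: sum.empty)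
  next
    case (insert i I)
    then have "spanned (\<lambda>e\<in>P.E. f i e + (\<lambda>e\<in>P.E. \<Sum>i\<in>I. f i e) e)" by (intro sp_add) auto
    moreover have "(\<lambda>e\<in>P.E. f i e + (\<lambda>e\<in>P.E. \<Sum>i\<in>I. f i e) e) = (\<lambda>e\<in>P.E. \<Sum>i\<in>insert i I. f i e)"
      using insert by (intro restrict_ext) auto
    ultimately show ?case by (simp only:)
  qed
  \<comment> \<open>each division by the frame costs a factor \<open>\<theta>\<^sup>2\<close>, which is 1 over \<open>W\<close>\<close>
  define \<Theta> where "\<Theta> k = P.pull (\<lambda>x. ((\<theta> x)\<^sup>2) ^ k)" for k
  have \<Theta>: "\<Theta> k \<in> Pol_hom M P 0" for k
  proof -
    have "smooth_fun M (points M) (\<lambda>x. ((\<theta> x)\<^sup>2) ^ k)"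
      by (intro smooth_fun_power[OF P.charted_base openin_topspace] smooth_fun_subset[OF F.smooth_\<theta>]) simp
    then show ?thesis unfolding \<Theta>_def by (intro P.pull_in) (simp add: smooth_fun_points[OF P.charted_base])
  qed
  have sp_hom: "spanned (\<lambda>e\<in>P.E. \<Theta> k e * p e)" if "p \<in> Pol_hom M P k" for p k
    using that
  proof (induction k arbitrary: p)
    case 0
    then show ?case using sp_mult[OF sp_const[OF \<Theta>] sp_const] by blast
  next
    case (Suc k)
    obtain q where q: "\<forall>b\<in>onb. q b \<in> Pol_hom M P k"
      "\<forall>e\<in>P.E. (\<theta> (proj P e))\<^sup>2 * p e = (\<Sum>b\<in>onb. F.frame b e * q b e)"
      using F.frame_division[OF Suc.prems] by blast
    have "spanned (\<lambda>e\<in>P.E. \<Sum>b\<in>onb. (\<lambda>e\<in>P.E. F.frame b e * (\<lambda>e\<in>P.E. \<Theta> k e * q b e) e) e)"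
      using q(1) by (intro sp_sum sp_mult sp_frame Suc.IH) auto
    moreover have "(\<lambda>e\<in>P.E. \<Sum>b\<in>onb. (\<lambda>e\<in>P.E. F.frame b e * (\<lambda>e\<in>P.E. \<Theta> k e * q b e) e) e) =
        (\<lambda>e\<in>P.E. \<Theta> (Suc k) e * p e)"
    proof (rule restrict_ext)
      fix e assume e: "e \<in> P.E"
      have "\<Theta> (Suc k) e * p e = \<Theta> k e * ((\<theta> (proj P e))\<^sup>2 * p e)" using e by (simp add: \<Theta>_def)
      also have "\<dots> = \<Theta> k e * (\<Sum>b\<in>onb. F.frame b e * q b e)" using q(2) e by simp
      finally show "(\<Sum>b\<in>onb. (\<lambda>e\<in>P.E. F.frame b e * (\<lambda>e\<in>P.E. \<Theta> k e * q b e) e) e) = \<Theta> (Suc k) e * p e"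
        using e by (simp add: sum_distrib_left mult.left_commute)
    qed
    ultimately show ?case by (simp only:)
  qed
  define O' where "O' = points N \<inter> base_map -` W"
  have O': "openin (top_of N) O'" unfolding O'_def by (rule smooth_map_preimage_open[OF smooth_base_map F.open_W])
  obtain p where p: "p \<in> carrier (Pol M P)" "h p = l'" using surj Q.Pol_hom_carrier[OF l'] by (metis imageE)
  obtain d p' where p': "\<forall>k\<le>d. p' k \<in> Pol_hom M P k" "p = (\<lambda>e\<in>P.E. \<Sum>k\<le>(d::nat). p' k e)"
    using p(1) by (rule P.Pol_carrierE)
  define combines where "combines k a \<longleftrightarrow> (\<forall>b\<in>(onb :: 'f set). a b \<in> Pol_hom N Q 0) \<and>
      (\<forall>v\<in>Q.E. proj Q v \<in> O' \<longrightarrow> tangent (p' k) v = (\<Sum>b\<in>onb. a b v * tangent (F.frame b) v))" for k a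
  have "\<exists>a. combines k a" if "k \<in> {..d}" for k
  proof -
    have pk: "p' k \<in> Pol_hom M P k" using p'(1) that by simp
    obtain a where a: "\<forall>b\<in>(onb :: 'f set). a b \<in> Pol_hom N Q 0"
      "\<forall>v\<in>Q.E. tangent (\<lambda>e\<in>P.E. \<Theta> k e * p' k e) v = (\<Sum>b\<in>onb. a b v * tangent (F.frame b) v)"
      using sp_hom[OF pk] unfolding spanned_def by blast
    have "tangent (\<lambda>e\<in>P.E. \<Theta> k e * p' k e) v = tangent (p' k) v" if v: "v \<in> Q.E" "proj Q v \<in> O'" for v
    proof -
      have "\<theta> (base_map (proj Q v)) = 1" using F.\<theta>_W v(2) by (simp add: O'_def)
      then have "\<Theta> k (vzero P (base_map (proj Q v))) = 1"
        using base_map_in[OF Q.proj_in[OF v(1)]] by (simp add: \<Theta>_def)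
      then show ?thesis using tangent_const_mult[OF \<Theta> P.Pol_hom_carrier[OF pk] v(1)] by simp
    qed
    with a have "combines k a" unfolding combines_def by simp
    then show ?thesis by blast
  qed
  then obtain a' where "\<forall>k\<in>{..d}. combines k (a' k)" using bchoice[of "{..d}" combines] by blast
  then have a: "\<And>k b. k \<le> d \<Longrightarrow> b \<in> (onb :: 'f set) \<Longrightarrow> a' k b \<in> Pol_hom N Q 0"
    "\<And>k v. k \<le> d \<Longrightarrow> v \<in> Q.E \<Longrightarrow> proj Q v \<in> O' \<Longrightarrow> tangent (p' k) v = (\<Sum>b\<in>onb. a' k b v * tangent (F.frame b) v)"
    unfolding combines_def by simp_all
  define c where "c b = (\<lambda>v\<in>Q.E. \<Sum>k\<le>d. a' k b v)" for b
  have c: "c b \<in> Pol_hom N Q 0" if "b \<in> onb" for b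
    unfolding c_def using a(1) that by (intro Q.Pol_hom_sum) auto
  have "l' v = (\<Sum>b\<in>onb. c b v * F.frame b (fibre_map v))" if v: "v \<in> Q.E" "proj Q v \<in> O'" for v
  proof -
    have "l' v = tangent p v" using Q.lin_part_linear[OF l' v(1)] by (simp add: tangent_def p(2))
    also have "\<dots> = (\<Sum>k\<le>d. tangent (p' k) v)"
      unfolding p'(2) using p'(1) by (intro tangent_sum v) (auto intro: P.Pol_hom_carrier)
    also have "\<dots> = (\<Sum>k\<le>d. \<Sum>b\<in>onb. a' k b v * tangent (F.frame b) v)" using a(2) v by (intro sum.cong) auto
    also have "\<dots> = (\<Sum>b\<in>onb. c b v * tangent (F.frame b) v)"
      using v by (subst sum.swap) (simp add: c_def sum_distrib_right)
    also have "\<dots> = (\<Sum>b\<in>onb. c b v * F.frame b (fibre_map v))"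
      using linear_fibre_map[OF v(1) F.frame_in] by simp
    finally show ?thesis .
  qed
  moreover have "y0 \<in> O'" using y0 W by (simp add: O'_def)
  ultimately show ?thesis using O' c F.frame_in
    by (intro exI[of _ O'] exI[of _ c] exI[of _ F.frame]) simp
qed

lemma fibre_map_inj:
  assumes "u \<in> Q.E" "v \<in> Q.E" "proj Q u = proj Q v" "fibre_map u = fibre_map v"
  shows "u = v"
proof (rule Q.fibre_eqI[OF assms(1-3)])
  fix l' assume "l' \<in> Pol_hom N Q 1"
  then obtain O' a l where *: "proj Q v \<in> O'"
    "\<forall>b\<in>(onb :: 'f set). a b \<in> Pol_hom N Q 0 \<and> l b \<in> Pol_hom M P 1"
    "\<forall>v\<in>Q.E. proj Q v \<in> O' \<longrightarrow> l' v = (\<Sum>b\<in>onb. a b v * l b (fibre_map v))"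
    using linear_functions_locally_spanned[OF _ Q.proj_in[OF assms(2)]] by blast
  have "a b u = a b v" if "b \<in> onb" for b
    using Q.Pol_hom_const[OF _ assms(1-3)] *(2) that by blast
  then have "(\<Sum>b\<in>onb. a b u * l b (fibre_map u)) = (\<Sum>b\<in>onb. a b v * l b (fibre_map v))"
    using assms(4) by (intro sum.cong) auto
  then show "l' u = l' v" using * assms by simp
qed

text \<open>Read in trivializations, the fibre map becomes a linear map of the typical fibres, to which
  linear algebra applies.\<close>

lemma fibre_map_in_coordinates:
  assumes Ut: "trivialized_bundle M P U \<psi>" and Vt: "trivialized_bundle N Q V \<xi>"
    and y: "y \<in> V" "base_map y \<in> U"
  defines "L \<equiv> \<lambda>w. snd (\<psi> (fibre_map (trivialized_bundle.\<psi>i Q V \<xi> (y, w))))"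
  shows "linear L" "inj L"
proof -
  interpret PU: trivialized_bundle M P U \<psi> by (rule Ut)
  interpret QV: trivialized_bundle N Q V \<xi> by (rule Vt)
  have e: "QV.\<psi>i (y, w) \<in> Q.E" "proj Q (QV.\<psi>i (y, w)) = y" for w
    using QV.\<psi>i_in[OF y(1)] QV.EU_sub QV.proj_\<psi>i[OF y(1)] by auto
  have f: "fibre_map (QV.\<psi>i (y, w)) \<in> PU.EU" "proj P (fibre_map (QV.\<psi>i (y, w))) = base_map y" for w
    using fibre_map_in[OF e(1)] proj_fibre_map[OF e(1)] e(2) y(2) by (auto simp: PU.EU_def)
  show "linear L"
  proof (rule linearI)
    show "L (w + w') = L w + L w'" for w w'
      using PU.snd_\<psi>_vadd[OF f(1) f(1)] fibre_map_vadd[OF e(1) e(1)] f(2) e(2)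
      by (simp add: L_def QV.vadd_\<psi>i[OF y(1), symmetric])
    show "L (c *\<^sub>R w) = c *\<^sub>R L w" for c w
      using PU.snd_\<psi>_vscale[OF f(1)] fibre_map_vscale[OF e(1)]
      by (simp add: L_def QV.vscale_\<psi>i[OF y(1), symmetric])
  qed
  show "inj L"
  proof (rule injI)
    fix w w' assume "L w = L w'"
    then have "\<psi> (fibre_map (QV.\<psi>i (y, w))) = \<psi> (fibre_map (QV.\<psi>i (y, w')))"
      using PU.\<psi>_eq[OF f(1)[of w]] PU.\<psi>_eq[OF f(1)[of w']] f(2) by (simp add: L_def)
    then have "fibre_map (QV.\<psi>i (y, w)) = fibre_map (QV.\<psi>i (y, w'))"
      using PU.\<psi>i_\<psi>[OF f(1)] by metis
    then have "QV.\<psi>i (y, w) = QV.\<psi>i (y, w')" by (intro fibre_map_inj) (simp_all add: e)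
    from arg_cong[OF this, of \<xi>] show "w = w'" by (simp add: QV.\<psi>_\<psi>i[OF y(1)])
  qed
qed

end

section \<open>Isomorphic algebras belong to isomorphic bundles\<close>

text \<open>The composite fixes the values of all smooth functions, and these separate points.\<close>

lemma base_map_inverse:
  fixes M :: "('a, 'm::fin_dim_inner) manifold" and P :: "('a, 'd, 'm, 'f::fin_dim_inner) vbundle"
    and N :: "('b, 'n::fin_dim_inner) manifold" and Q :: "('b, 'e, 'n, 'g::fin_dim_inner) vbundle"
  assumes h: "algebra_map M P N Q h" and g: "algebra_map N Q M P g"
    and gh: "\<And>p. p \<in> carrier (Pol M P) \<Longrightarrow> g (h p) = p" and x: "x \<in> points M"
  shows "algebra_map.base_map M P Q h (algebra_map.base_map N Q P g x) = x"
proof -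
  interpret H: algebra_map M P N Q h by (rule h)
  interpret G: algebra_map N Q M P g by (rule g)
  let ?x = "H.base_map (G.base_map x)"
  have f_eq: "f ?x = f x" if f: "smooth_fun M UNIV f" for f :: "'a \<Rightarrow> real"
  proof -
    have pf: "H.P.pull f \<in> carrier (Pol M P)" by (rule H.P.Pol_hom_carrier[OF H.P.pull_in[OF f]])
    have s: "smooth_fun N UNIV (\<lambda>y. f (H.base_map y))" by (rule H.smooth_pullback_base_map[OF f])
    have "h (H.P.pull f) = H.Q.pull (\<lambda>y. f (H.base_map y))"
      by (rule H.Q.Pol_eqI[OF H.h_in[OF pf] H.Q.Pol_hom_carrier[OF H.Q.pull_in[OF s]]])
        (simp add: H.h_pull[OF f])
    then have "H.P.pull f = g (H.Q.pull (\<lambda>y. f (H.base_map y)))" using gh[OF pf] by simp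
    then have "H.P.pull f (vzero P x) = f ?x" using G.h_pull[OF s, of "vzero P x"] x by simp
    then show ?thesis using x by simp
  qed
  have x': "?x \<in> points M" by (intro H.base_map_in G.base_map_in x)
  show ?thesis
  proof (rule ccontr)
    assume "?x \<noteq> x"
    then obtain f :: "'a \<Rightarrow> real" where "smooth_fun M UNIV f" "f ?x \<noteq> f x"
      by (rule smooth_functions_separate_points[OF H.P.base_manifold x' x])
    then show False using f_eq by blast
  qed
qed

locale inverse_algebra_maps =
  H: surjective_algebra_map M P N Q h + G: surjective_algebra_map N Q M P g
  for M :: "('a, 'm::fin_dim_inner) manifold" and P :: "('a, 'd, 'm, 'f::fin_dim_inner) vbundle"
    and N :: "('b, 'n::fin_dim_inner) manifold" and Q :: "('b, 'e, 'n, 'g::fin_dim_inner) vbundle"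
    and h :: "('d \<Rightarrow> real) \<Rightarrow> ('e \<Rightarrow> real)" and g :: "('e \<Rightarrow> real) \<Rightarrow> ('d \<Rightarrow> real)" +
  assumes g_h: "\<And>p. p \<in> carrier (Pol M P) \<Longrightarrow> g (h p) = p"
    and h_g: "\<And>q. q \<in> carrier (Pol N Q) \<Longrightarrow> h (g q) = q"
begin

lemma base_map_H_G: "x \<in> points M \<Longrightarrow> H.base_map (G.base_map x) = x"
  by (rule base_map_inverse[OF H.algebra_map_axioms G.algebra_map_axioms g_h])

lemma base_map_G_H: "y \<in> points N \<Longrightarrow> G.base_map (H.base_map y) = y"
  by (rule base_map_inverse[OF G.algebra_map_axioms H.algebra_map_axioms h_g])

lemma base_diffeomorphism: "diffeomorphism M N G.base_map"
  unfolding diffeomorphism_def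
proof (intro conjI)
  show bij: "bij_betw G.base_map (points M) (points N)"
    by (rule bij_betw_byWitness[where f'=H.base_map])
      (auto simp: base_map_H_G base_map_G_H H.base_map_in G.base_map_in)
  show "smooth_map M N G.base_map" by (rule G.smooth_base_map)
  have "inv_into (points M) G.base_map y = H.base_map y" if y: "y \<in> points N" for y
    using bij_betw_imp_inj_on[OF bij] base_map_G_H[OF y] H.base_map_in[OF y] by (intro inv_into_f_eq)
  then show "smooth_map N M (inv_into (points M) G.base_map)"
    using H.smooth_base_map by (subst smooth_map_cong[OF H.Q.charted_base H.P.charted_base, of _ H.base_map]) auto
qed

text \<open>Both fibre maps are injective, so that the fibres have the same dimension and an injective map
  between them is onto.\<close>

lemma fibre_map_onto_fibre:
  assumes v: "v \<in> H.Q.E" and x: "x \<in> points M" and vx: "proj Q v = G.base_map x"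
  shows "\<exists>e\<in>H.P.E. proj P e = x \<and> G.fibre_map e = v"
proof -
  let ?y = "G.base_map x"
  have y: "?y \<in> points N" by (rule G.base_map_in[OF x])
  obtain U \<psi> where U: "openin (top_of M) U" "x \<in> U" "local_trivialization M P U \<psi>"
    using H.P.vector_bundle x by (auto simp: vector_bundle_def)
  obtain V \<xi> where V: "openin (top_of N) V" "?y \<in> V" "local_trivialization N Q V \<xi>"
    using H.Q.vector_bundle y by (auto simp: vector_bundle_def)
  interpret PU: trivialized_bundle M P U \<psi> by unfold_locales (fact U)+
  interpret QV: trivialized_bundle N Q V \<xi> by unfold_locales (fact V)+
  have HU: "H.base_map ?y \<in> U" using U(2) base_map_H_G[OF x] by simp
  let ?L = "\<lambda>w. snd (\<xi> (G.fibre_map (PU.\<psi>i (x, w))))"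
  have "surj ?L"
    by (rule injective_linear_maps_both_ways_surj[OF
        G.fibre_map_in_coordinates[OF QV.trivialized_bundle_axioms PU.trivialized_bundle_axioms U(2) V(2)]
        H.fibre_map_in_coordinates[OF PU.trivialized_bundle_axioms QV.trivialized_bundle_axioms V(2) HU]])
  then obtain w where w: "snd (\<xi> v) = ?L w" by (rule surjE)
  define e where "e = PU.\<psi>i (x, w)"
  have e: "e \<in> H.P.E" "proj P e = x"
    using PU.\<psi>i_in[OF U(2)] PU.EU_sub PU.proj_\<psi>i[OF U(2)] by (auto simp: e_def)
  have EU: "v \<in> QV.EU" "G.fibre_map e \<in> QV.EU"
    using v vx V(2) G.fibre_map_in[OF e(1)] G.proj_fibre_map[OF e(1)] e(2) by (auto simp: QV.EU_def)
  have "\<xi> (G.fibre_map e) = \<xi> v"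
    using QV.\<psi>_eq[OF EU(1)] QV.\<psi>_eq[OF EU(2)] w vx G.proj_fibre_map[OF e(1)] e(2) by (simp add: e_def)
  then have "G.fibre_map e = v" using QV.\<psi>i_\<psi>[OF EU(1)] QV.\<psi>i_\<psi>[OF EU(2)] by simp
  with e show ?thesis by blast
qed

lemma fibre_map_bij: "bij_betw G.fibre_map H.P.E H.Q.E"
  unfolding bij_betw_def
proof
  show "inj_on G.fibre_map H.P.E"
  proof (rule inj_onI)
    fix e e' assume e: "e \<in> H.P.E" "e' \<in> H.P.E" "G.fibre_map e = G.fibre_map e'"
    have eq: "G.base_map (proj P e) = G.base_map (proj P e')"
      unfolding G.proj_fibre_map[OF e(1), symmetric] G.proj_fibre_map[OF e(2), symmetric] e(3) ..
    have "proj P e = H.base_map (G.base_map (proj P e))" by (rule base_map_H_G[OF H.P.proj_in[OF e(1)], symmetric])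
    also have "\<dots> = proj P e'" unfolding eq by (rule base_map_H_G[OF H.P.proj_in[OF e(2)]])
    finally show "e = e'" by (rule G.fibre_map_inj[OF e(1,2) _ e(3)])
  qed
  show "G.fibre_map ` H.P.E = H.Q.E"
  proof (intro equalityI subsetI)
    fix v assume "v \<in> G.fibre_map ` H.P.E"
    then show "v \<in> H.Q.E" using G.fibre_map_in by blast
  next
    fix v assume v: "v \<in> H.Q.E"
    have "proj Q v = G.base_map (H.base_map (proj Q v))" using base_map_G_H[OF H.Q.proj_in[OF v]] by simp
    then show "v \<in> G.fibre_map ` H.P.E"
      using fibre_map_onto_fibre[OF v H.base_map_in[OF H.Q.proj_in[OF v]]] by blast
  qed
qed

text \<open>For the smoothness of the inverse, a linear function of \<open>P\<close> is locally a combination of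
  linear functions of \<open>Q\<close> composed with the fibre map, and the coefficients come from the base.
  Composed with the inverse, it is the same combination of those linear functions of \<open>Q\<close>.\<close>

lemma total_diffeomorphism: "diffeomorphism (total_space P) (total_space Q) G.fibre_map"
  unfolding diffeomorphism_def
proof (intro conjI fibre_map_bij G.smooth_fibre_map)
  define i where "i = inv_into H.P.E G.fibre_map"
  have i: "i v \<in> H.P.E" "G.fibre_map (i v) = v" if "v \<in> H.Q.E" for v
    using that fibre_map_bij by (auto simp: i_def bij_betw_def inv_into_into f_inv_into_f)
  have proj_i: "proj P (i v) = H.base_map (proj Q v)" if v: "v \<in> H.Q.E" for v
    using G.proj_fibre_map[OF i(1)[OF v]] i[OF v] base_map_H_G[OF H.P.proj_in[OF i(1)[OF v]]] by simp
  show "smooth_map (total_space Q) (total_space P) i"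
  proof (rule H.P.smooth_map_into_bundle[OF H.Q.charted_total])
    show "i ` H.Q.E \<subseteq> H.P.E" using i by blast
    show "smooth_map (total_space Q) M (\<lambda>v. proj P (i v))"
      using H.smooth_base_map_proj
      by (subst smooth_map_cong[OF H.Q.charted_total H.P.charted_base, of _ "\<lambda>v. H.base_map (proj Q v)"])
        (auto simp: proj_i)
    fix l assume l: "l \<in> Pol_hom M P 1"
    show "smooth_fun (total_space Q) UNIV (\<lambda>v. l (i v))"
    proof (rule smooth_fun_local[OF H.Q.charted_total])
      fix v0 assume v0: "v0 \<in> H.Q.E"
      obtain O' a b where O': "openin (top_of M) O'" "H.base_map (proj Q v0) \<in> O'"
        and ab: "\<forall>c\<in>(onb :: 'g set). a c \<in> Pol_hom M P 0 \<and> b c \<in> Pol_hom N Q 1"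
        and eq: "\<forall>e\<in>H.P.E. proj P e \<in> O' \<longrightarrow> l e = (\<Sum>c\<in>onb. a c e * b c (G.fibre_map e))"
        using G.linear_functions_locally_spanned[OF l H.base_map_in[OF H.Q.proj_in[OF v0]]] by blast
      let ?T = "H.Q.E \<inter> (\<lambda>v. H.base_map (proj Q v)) -` O'"
      have T: "openin (top_of (total_space Q)) ?T"
        by (rule smooth_map_preimage_open[OF H.smooth_base_map_proj O'(1)])
      have "smooth_fun (total_space Q) UNIV (\<lambda>v. a c (vzero P (H.base_map (proj Q v))))" if "c \<in> onb" for c
      proof (rule smooth_fun_compose_map_UNIV[OF H.Q.charted_total H.P.charted_base H.smooth_base_map_proj])
        show "smooth_fun M UNIV (\<lambda>x. a c (vzero P x))"
          using ab that by (intro smooth_fun_compose_map_UNIV[OF H.P.charted_base H.P.charted_total H.P.smooth_zero_section]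
              H.P.Pol_hom_smooth) blast
      qed
      moreover have "smooth_fun (total_space Q) UNIV (b c)" if "c \<in> onb" for c
        using ab that H.Q.Pol_hom_smooth by blast
      ultimately have "smooth_fun (total_space Q) UNIV (\<lambda>v. \<Sum>c\<in>onb. a c (vzero P (H.base_map (proj Q v))) * b c v)"
        by (intro smooth_fun_sum_UNIV[OF H.Q.charted_total] smooth_fun_mult_UNIV[OF H.Q.charted_total])
      then have sm: "smooth_fun (total_space Q) ?T (\<lambda>v. \<Sum>c\<in>onb. a c (vzero P (H.base_map (proj Q v))) * b c v)"
        by (rule smooth_fun_subset) simp
      have li: "l (i v) = (\<Sum>c\<in>onb. a c (vzero P (H.base_map (proj Q v))) * b c v)" if "v \<in> ?T" for v
      proof -
        have v: "v \<in> H.Q.E" using that by blast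
        have "a c (i v) = a c (vzero P (H.base_map (proj Q v)))" if "c \<in> onb" for c
          using H.P.const_part_const[of "a c" "i v"] ab that i(1)[OF v] proj_i[OF v] by (simp add: H.P.const_part_def)
        moreover have "l (i v) = (\<Sum>c\<in>onb. a c (i v) * b c (G.fibre_map (i v)))"
          using eq i(1)[OF v] proj_i[OF v] that by simp
        ultimately show ?thesis using i(2)[OF v] by simp
      qed
      have "smooth_fun (total_space Q) ?T (\<lambda>v. l (i v))"
        by (rule iffD2[OF smooth_fun_cong[OF H.Q.charted_total T li] sm])
      then show "\<exists>T. openin (top_of (total_space Q)) T \<and> v0 \<in> T \<and> smooth_fun (total_space Q) T (\<lambda>v. l (i v))"
        using T v0 O'(2) by (intro exI[of _ ?T]) auto
    qed
  qed
qed

lemma bundle_isomorphic: "bundle_isomorphic M P N Q"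
  unfolding bundle_isomorphic_def
proof (intro exI conjI ballI)
  show "diffeomorphism (total_space P) (total_space Q) G.fibre_map" by (rule total_diffeomorphism)
  show "diffeomorphism M N G.base_map" by (rule base_diffeomorphism)
  show "proj Q (G.fibre_map e) = G.base_map (proj P e)" if "e \<in> H.P.E" for e
    using G.proj_fibre_map that .
  fix x assume x: "x \<in> points M"
  show "linear_iso (fibre P x) (fibre Q (G.base_map x)) G.fibre_map"
    unfolding linear_iso_def
  proof (intro conjI ballI allI)
    show "bij_betw G.fibre_map (carrier (fibre P x)) (carrier (fibre Q (G.base_map x)))"
      unfolding bij_betw_def
    proof
      show "inj_on G.fibre_map (carrier (fibre P x))" by (rule inj_onI) (auto intro: G.fibre_map_inj)
      show "G.fibre_map ` carrier (fibre P x) = carrier (fibre Q (G.base_map x))"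
      proof (intro equalityI subsetI)
        fix v assume "v \<in> G.fibre_map ` carrier (fibre P x)"
        then show "v \<in> carrier (fibre Q (G.base_map x))"
          using G.fibre_map_in G.proj_fibre_map by auto
      next
        fix v assume "v \<in> carrier (fibre Q (G.base_map x))"
        then have "v \<in> H.Q.E" "proj Q v = G.base_map x" by simp_all
        from fibre_map_onto_fibre[OF this(1) x this(2)]
        show "v \<in> G.fibre_map ` carrier (fibre P x)" by auto
      qed
    qed
  qed (auto simp: G.fibre_map_vadd G.fibre_map_vscale)
qed

end

lemma bundle_isomorphic_if_algebra_isomorphic:
  assumes P: "smooth_bundle M P" and Q: "smooth_bundle N Q" and iso: "algebra_isomorphic (Pol M P) (Pol N Q)"
  shows "bundle_isomorphic M P N Q"
proof -
  interpret P: smooth_bundle M P by (rule P)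
  interpret Q: smooth_bundle N Q by (rule Q)
  let ?A = "Pol M P" and ?B = "Pol N Q"
  obtain h where h: "h \<in> ring_iso ?A ?B" "\<forall>c. \<forall>a\<in>carrier ?A. h (c \<odot>\<^bsub>?A\<^esub> a) = c \<odot>\<^bsub>?B\<^esub> h a"
    using iso unfolding algebra_isomorphic_def by blast
  have hom: "h \<in> ring_hom ?A ?B" and bij: "bij_betw h (carrier ?A) (carrier ?B)"
    using h(1) by (auto simp: ring_iso_def)
  define g where "g = inv_into (carrier ?A) h"
  have g_in: "g q \<in> carrier ?A" and hg: "h (g q) = q" if "q \<in> carrier ?B" for q
    using bij that by (auto simp: g_def bij_betw_def inv_into_into f_inv_into_f)
  have gh: "g (h p) = p" if "p \<in> carrier ?A" for p
    using bij that by (simp add: g_def bij_betw_def inv_into_f_f)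
  have A_closed: "p \<otimes>\<^bsub>?A\<^esub> q \<in> carrier ?A" "p \<oplus>\<^bsub>?A\<^esub> q \<in> carrier ?A" "c \<odot>\<^bsub>?A\<^esub> p \<in> carrier ?A"
    if "p \<in> carrier ?A" "q \<in> carrier ?A" for p q c
    using P.Pol_mult_closed[OF that] P.Pol_add_closed[OF that] P.Pol_scale_closed[OF that(1)]
    by (simp_all only: P.Pol_ops)
  have one: "\<one>\<^bsub>?A\<^esub> \<in> carrier ?A"
    using P.Pol_hom_carrier[OF P.Pol_const_in[of 1]] by (simp only: P.Pol_ops)
  have g_hom: "g \<in> ring_hom ?B ?A"
  proof (rule ring_hom_memI)
    fix p q assume p: "p \<in> carrier ?B" and q: "q \<in> carrier ?B"
    show "g p \<in> carrier ?A" by (rule g_in[OF p])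
    have "h (g p \<otimes>\<^bsub>?A\<^esub> g q) = p \<otimes>\<^bsub>?B\<^esub> q"
      using ring_hom_mult[OF hom g_in[OF p] g_in[OF q]] hg p q by simp
    then show "g (p \<otimes>\<^bsub>?B\<^esub> q) = g p \<otimes>\<^bsub>?A\<^esub> g q"
      using gh[OF A_closed(1)[OF g_in[OF p] g_in[OF q]]] by simp
    have "h (g p \<oplus>\<^bsub>?A\<^esub> g q) = p \<oplus>\<^bsub>?B\<^esub> q"
      using ring_hom_add[OF hom g_in[OF p] g_in[OF q]] hg p q by simp
    then show "g (p \<oplus>\<^bsub>?B\<^esub> q) = g p \<oplus>\<^bsub>?A\<^esub> g q"
      using gh[OF A_closed(2)[OF g_in[OF p] g_in[OF q]]] by simp
  next
    show "g \<one>\<^bsub>?B\<^esub> = \<one>\<^bsub>?A\<^esub>" using gh[OF one] ring_hom_one[OF hom] by simp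
  qed
  have g_scale: "g (c \<odot>\<^bsub>?B\<^esub> q) = c \<odot>\<^bsub>?A\<^esub> g q" if q: "q \<in> carrier ?B" for c q
  proof -
    have "c \<odot>\<^bsub>?B\<^esub> q = h (c \<odot>\<^bsub>?A\<^esub> g q)" using h(2) g_in[OF q] hg[OF q] by simp
    then show ?thesis by (simp only: gh[OF A_closed(3)[OF g_in[OF q] g_in[OF q]]])
  qed
  have "h ` carrier ?A = carrier ?B" using bij by (simp add: bij_betw_def)
  moreover have "g ` carrier ?B = carrier ?A"
    unfolding g_def using bij_betw_inv_into[OF bij] by (simp add: bij_betw_def)
  ultimately interpret inverse_algebra_maps M P N Q h g
    using hom h(2) g_hom g_scale gh hg by unfold_locales auto
  show ?thesis by (rule bundle_isomorphic)
qed

section \<open>Isomorphic bundles have isomorphic algebras\<close>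

lemma Pol_hom_pullback:
  assumes P: "smooth_bundle M P" and Q: "smooth_bundle N Q"
    and F: "smooth_map (total_space Q) (total_space P) F"
    and proj_F: "\<And>v. v \<in> points (total_space Q) \<Longrightarrow> proj P (F v) = f (proj Q v)"
    and F_add: "\<And>u v. u \<in> points (total_space Q) \<Longrightarrow> v \<in> points (total_space Q) \<Longrightarrow> proj Q u = proj Q v \<Longrightarrow>
      F (vadd Q u v) = vadd P (F u) (F v)"
    and F_scale: "\<And>c v. v \<in> points (total_space Q) \<Longrightarrow> F (vscale Q c v) = vscale P c (F v)"
    and p: "p \<in> Pol_hom M P k"
  shows "(\<lambda>v\<in>points (total_space Q). p (F v)) \<in> Pol_hom N Q k"
proof -
  interpret P: smooth_bundle M P by (rule P)
  interpret Q: smooth_bundle N Q by (rule Q)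
  have F_in: "F v \<in> P.E" if "v \<in> Q.E" for v using smooth_mapD(2)[OF F] that by blast
  show ?thesis
  proof (rule Q.Pol_homI)
    show "smooth_fun (total_space Q) UNIV (\<lambda>v. p (F v))"
      by (rule smooth_fun_compose_map_UNIV[OF Q.charted_total P.charted_total F P.Pol_hom_smooth[OF p]])
    fix y assume y: "y \<in> points N"
    have "f y \<in> points M"
      using P.proj_in[OF F_in[OF Q.vzero_in[OF y]]] proj_F[OF Q.vzero_in[OF y]] y by simp
    from P.Pol_hom_poly[OF p this] show "homogeneous_polynomial (fibre Q y) k (\<lambda>v. p (F v))"
      by (rule homogeneous_polynomial_pullback) (auto simp: F_in proj_F F_add F_scale)
  qed
qed

lemma Pol_pullback:
  assumes P: "smooth_bundle M P" and Q: "smooth_bundle N Q"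
    and F: "smooth_map (total_space Q) (total_space P) F"
    and pull: "\<And>k p. p \<in> Pol_hom M P k \<Longrightarrow> (\<lambda>v\<in>points (total_space Q). p (F v)) \<in> Pol_hom N Q k"
    and p: "p \<in> carrier (Pol M P)"
  shows "(\<lambda>v\<in>points (total_space Q). p (F v)) \<in> carrier (Pol N Q)"
proof -
  interpret P: smooth_bundle M P by (rule P)
  interpret Q: smooth_bundle N Q by (rule Q)
  obtain d q where q: "\<forall>k\<le>d. q k \<in> Pol_hom M P k" "p = (\<lambda>e\<in>P.E. \<Sum>k\<le>(d::nat). q k e)"
    using p by (rule P.Pol_carrierE)
  have "(\<lambda>v\<in>Q.E. \<Sum>k\<le>d. (\<lambda>v\<in>Q.E. q k (F v)) v) \<in> carrier (Pol N Q)"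
    using q(1) by (intro Q.Pol_sum_closed Q.Pol_hom_carrier[OF pull]) auto
  moreover have "(\<lambda>v\<in>Q.E. \<Sum>k\<le>d. (\<lambda>v\<in>Q.E. q k (F v)) v) = (\<lambda>v\<in>Q.E. p (F v))"
    using smooth_mapD(2)[OF F] by (intro restrict_ext) (auto simp: q(2))
  ultimately show ?thesis by (simp only:)
qed

lemma algebra_isomorphic_if_bundle_isomorphic:
  assumes P: "smooth_bundle M P" and Q: "smooth_bundle N Q" and iso: "bundle_isomorphic M P N Q"
  shows "algebra_isomorphic (Pol M P) (Pol N Q)"
proof -
  interpret P: smooth_bundle M P by (rule P)
  interpret Q: smooth_bundle N Q by (rule Q)
  obtain F f where F: "diffeomorphism (total_space P) (total_space Q) F" and f: "diffeomorphism M N f"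
    and Ff: "\<forall>e\<in>P.E. proj Q (F e) = f (proj P e)"
    and lin: "\<forall>x\<in>points M. linear_iso (fibre P x) (fibre Q (f x)) F"
    using iso unfolding bundle_isomorphic_def by blast
  define G where "G = inv_into P.E F"
  define g where "g = inv_into (points M) f"
  have bijF: "bij_betw F P.E Q.E" and smF: "smooth_map (total_space P) (total_space Q) F"
    and smG: "smooth_map (total_space Q) (total_space P) G"
    using F by (auto simp: diffeomorphism_def G_def)
  have F_in: "F e \<in> Q.E" and GF: "G (F e) = e" if "e \<in> P.E" for e
    using bijF that by (auto simp: G_def bij_betw_def inv_into_f_f)
  have G_in: "G v \<in> P.E" and FG: "F (G v) = v" if "v \<in> Q.E" for v
    using bijF that by (auto simp: G_def bij_betw_def inv_into_into f_inv_into_f)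
  have gf: "g (f x) = x" if "x \<in> points M" for x
    using f that by (simp add: diffeomorphism_def g_def bij_betw_def inv_into_f_f)
  have proj_G: "proj P (G v) = g (proj Q v)" if "v \<in> Q.E" for v
    using Ff G_in[OF that] FG[OF that] gf[OF P.proj_in[OF G_in[OF that]]] by metis
  have F_add: "F (vadd P u v) = vadd Q (F u) (F v)" if "u \<in> P.E" "v \<in> P.E" "proj P u = proj P v" for u v
    using lin P.proj_in[OF that(2)] that by (auto simp: linear_iso_def)
  have F_scale: "F (vscale P c u) = vscale Q c (F u)" if "u \<in> P.E" for c u
    using lin P.proj_in[OF that] that by (auto simp: linear_iso_def)
  have G_add: "G (vadd Q u v) = vadd P (G u) (G v)" if "u \<in> Q.E" "v \<in> Q.E" "proj Q u = proj Q v" for u v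
  proof -
    have pr: "proj P (G u) = proj P (G v)" using that proj_G by simp
    have "F (vadd P (G u) (G v)) = vadd Q u v"
      using F_add[OF G_in[OF that(1)] G_in[OF that(2)] pr] FG that by simp
    then show ?thesis using GF[OF P.vadd_in[OF G_in[OF that(1)] G_in[OF that(2)] pr]] by simp
  qed
  have G_scale: "G (vscale Q c v) = vscale P c (G v)" if "v \<in> Q.E" for c v
  proof -
    have "F (vscale P c (G v)) = vscale Q c v" using F_scale[OF G_in[OF that]] FG[OF that] by simp
    then show ?thesis using GF[OF P.vscale_in[OF G_in[OF that]], of c] by simp
  qed
  define h where "h p = (\<lambda>v\<in>Q.E. p (G v))" for p :: "_ \<Rightarrow> real"
  define k where "k q = (\<lambda>e\<in>P.E. q (F e))" for q :: "_ \<Rightarrow> real"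
  have h_in: "h p \<in> carrier (Pol N Q)" if "p \<in> carrier (Pol M P)" for p
    unfolding h_def
    by (rule Pol_pullback[OF P Q smG Pol_hom_pullback[OF P Q smG proj_G G_add G_scale] that])
  have k_in: "k q \<in> carrier (Pol M P)" if "q \<in> carrier (Pol N Q)" for q
    unfolding k_def using Ff
    by (intro Pol_pullback[OF Q P smF Pol_hom_pullback[OF Q P smF _ F_add F_scale] that]) auto
  have "k (h p) = p" if "p \<in> carrier (Pol M P)" for p
    by (rule P.Pol_eqI[OF k_in[OF h_in[OF that]] that]) (simp add: k_def h_def F_in GF)
  moreover have "h (k q) = q" if "q \<in> carrier (Pol N Q)" for q
    by (rule Q.Pol_eqI[OF h_in[OF k_in[OF that]] that]) (simp add: k_def h_def G_in FG)
  ultimately have "bij_betw h (carrier (Pol M P)) (carrier (Pol N Q))"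
    using h_in k_in by (intro bij_betw_byWitness[where f'=k]) auto
  moreover have "h \<in> ring_hom (Pol M P) (Pol N Q)"
  proof (rule ring_hom_memI)
    show "h p \<in> carrier (Pol N Q)" if "p \<in> carrier (Pol M P)" for p by (rule h_in[OF that])
  qed (auto simp: h_def G_in intro!: restrict_ext)
  moreover have "h (c \<odot>\<^bsub>Pol M P\<^esub> p) = c \<odot>\<^bsub>Pol N Q\<^esub> h p" for c p
    by (auto simp: h_def G_in intro!: restrict_ext)
  ultimately show ?thesis unfolding algebra_isomorphic_def ring_iso_def by blast
qed

theorem corollary2:
  fixes M :: "('a, 'm::fin_dim_inner) manifold"
    and N :: "('b, 'n::fin_dim_inner) manifold"
    and P :: "('a, 'd, 'm, 'f::fin_dim_inner) vbundle"
    and Q :: "('b, 'e, 'n, 'g::fin_dim_inner) vbundle"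
  assumes "smooth_manifold M" and "connected_space (top_of M)"
    and "smooth_manifold N" and "connected_space (top_of N)"
    and "vector_bundle M P" and "vector_bundle N Q"
  shows "bundle_isomorphic M P N Q \<longleftrightarrow> algebra_isomorphic (Pol M P) (Pol N Q)"
proof -
  have "smooth_bundle M P" "smooth_bundle N Q" using assms(5,6) by unfold_locales
  then show ?thesis
    using algebra_isomorphic_if_bundle_isomorphic bundle_isomorphic_if_algebra_isomorphic by blast
qed

end
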